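(* Let $1<q<\infty$. Assume that $|F|\in L^q_{\mathrm{loc}}(\Omega_T)$ and that $u\in L^q_{\mathrm{loc}}(0,T;W^{1,q}_{\mathrm{loc}}(\Omega;\mathbb{R}^N))$ satisfies $$\iint_{\Omega_T}\bigl(-u\cdot\varphi_t+\mathcal{A}(z,\nabla u)\cdot\nabla\varphi\bigr)\,dz=\iint_{\Omega_T}F\cdot\nabla\varphi\,dz$$ for every $\varphi\in C_0^\infty(\Omega_T;\mathbb{R}^N)$. For a parabolic cylinder $Q$ with $2Q\Subset\Omega_T$ let $g=M^*\bigl((|\nabla u|+|F|)1_{2Q}\bigr)$. (i) If $1<q<2$, then for $1<q\le q^*<\frac{2q}{2-q}$ there exists a constant $c=c(n,q,q^*,L)$ such that $$\left(\frac1{|I|}\int_{I}\frac{|u(x,t)-u_{I}(x)|^{q^*}}{|I|^{\frac{q^*}2}}\,dt\right)^{\frac1{q^*}}\le c\left(\frac1{|I|}\int_{I}g(x,t)^q\,dt\right)^{\frac1q}$$ for every parabolic cylinder $Q=Q_\rho=B\times I$ such that $2Q\Subset\Omega_T$ and for almost every $x\in B$. (ii) If $q=2$, then there exists a constant $c=c(n,L)$ such that $$\frac1{|I|}\int_I\exp\left(\left(\frac{|u(x,t)-u_{I}(x)|}{c|I|^{\frac12}\left(\frac1{|I|}\int_{I}g(x,t)^2\,dt\right)^{\frac12}}\right)^{2}\right)dt\le c$$ for every parabolic cylinder $Q=Q_\rho=B\times I$ such that $2Q\Subset\Omega_T$ and for almost every $x\in B$. (iii) If $q>2$, then there exists a constant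 $c=c(n,q,L)$ such that $$\operatorname*{ess\,sup}_{t\in I}\frac{|u(x,t)-u_{I}(x)|}{|I|^{\frac12}}\le c\left(\frac1{|I|}\int_{I}g(x,t)^q\,dt\right)^{\frac1q}$$ for every parabolic cylinder $Q=Q_\rho=B\times I$ such that $2Q\Subset\Omega_T$ and for almost every $x\in B$.
   Context: $\Omega\subset\mathbb{R}^n$, $n\ge1$, is a bounded open domain, $T>0$, $\Omega_T=\Omega\times(0,T)$, $N\ge1$, $0<\nu<L<\infty$. $\mathcal{A}:\Omega_T\times\mathbb{R}^{Nn}\to\mathbb{R}^{Nn}$ is a Carathéodory vector field ($\mathcal{A}(\cdot,\xi)$ measurable for every $\xi$, $\mathcal{A}(z,\cdot)$ continuous for a.e. $z$) with $\nu|\xi|^2\le\mathcal{A}(z,\xi)\cdot\xi$ and $|\mathcal{A}(z,\xi)|\le L|\xi|$ for a.e. $z\in\Omega_T$ and every $\xi\in\mathbb{R}^{Nn}$. $F:\Omega_T\to\mathbb{R}^{Nn}$ is measurable. We write $z=(x,t)$, $dz=dx\,dt$, and $\nabla$ is the gradient in $x$. $u\in L^q_{\mathrm{loc}}(0,T;W^{1,q}_{\mathrm{loc}}(\Omega;\mathbb{R}^N))$ means that for all $\Omega'\Subset\Omega$ and $0<t_1<t_2<T$ one has $u(\cdot,t)\in W^{1,q}(\Omega';\mathbb{R}^N)$ for a.e. $t\in(t_1,t_2)$ and $\int_{t_1}^{t_2}\int_{\Omega'}(|u|^q+|\nabla u|^q)\,dx\,dt<\infty$. Parabolic cylinders: $Q_\rho=B\times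 I$ with $B=B_\rho(x_0)$, $I=(t_0-\rho^2,t_0+\rho^2)$, and $2Q_\rho=B_{2\rho}(x_0)\times(t_0-(2\rho)^2,t_0+(2\rho)^2)$. $2Q\Subset\Omega_T$ means that the closure of $2Q$ is a compact subset of $\Omega_T$. $u_I(x)=\frac1{|I|}\int_I u(x,t)\,dt$ (componentwise). Functions multiplied by $1_{2Q}$ are extended by zero outside $2Q$. The strong maximal function of $f\in L^1_{\mathrm{loc}}(\mathbb{R}^{n+1})$ is $M^*f(z)=\sup\frac1{|B'\times I'|}\iint_{B'\times I'}|f|\,d\zeta$, the supremum taken over all cylinders $B'\times I'\ni z$ with $B'\subset\mathbb{R}^n$ an open ball and $I'\subset\mathbb{R}$ a bounded open interval (radius and length independent of each other). In (ii), if the denominator vanishes the quotient is read as $0$. *)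

theory Defs
  imports "HOL-Analysis.Analysis" "HOL-Probability.Essential_Supremum"
begin

section \<open>Vectors with a variable number of components\<close>

text \<open>
  The constants of the theorem do not depend on the number \<open>N\<close> of equations, so \<open>N\<close> has to be
  quantified inside the statement and cannot be a type. An element of \<open>V^N\<close> is represented by a
  sequence in \<open>V\<close> that vanishes from index \<open>N\<close> on: \<open>V = real\<close> gives \<open>R^N\<close>, and \<open>V = real ^ 'n\<close>
  gives \<open>R^(Nn)\<close>, component \<open>i\<close> of a gradient being the gradient of the \<open>i\<close>-th scalar component.
  The product topology of \<open>nat \<Rightarrow> 'v\<close> induces the Euclidean topology on \<open>vecs N\<close>.
\<close>

definition vecs :: "nat \<Rightarrow> (nat \<Rightarrow> 'v::euclidean_space) set" where
  "vecs N = {v. \<forall>i\<ge>N. v i = 0}"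

definition vinner :: "nat \<Rightarrow> (nat \<Rightarrow> 'v::euclidean_space) \<Rightarrow> (nat \<Rightarrow> 'v) \<Rightarrow> real" where
  "vinner N v w = (\<Sum>i<N. v i \<bullet> w i)"

definition vnorm :: "nat \<Rightarrow> (nat \<Rightarrow> 'v::euclidean_space) \<Rightarrow> real" where
  "vnorm N v = sqrt (vinner N v v)"

definition vmeasurable_on ::
    "nat \<Rightarrow> 'a::euclidean_space set \<Rightarrow> ('a \<Rightarrow> nat \<Rightarrow> 'v::euclidean_space) \<Rightarrow> bool" where
  "vmeasurable_on N S f \<longleftrightarrow> (\<forall>i<N. (\<lambda>z. f z i) \<in> borel_measurable (lebesgue_on S))"


section \<open>Test functions and derivatives\<close>

primrec Ck :: "nat \<Rightarrow> ('a::euclidean_space \<Rightarrow> real) \<Rightarrow> bool" where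
  "Ck 0 f \<longleftrightarrow> continuous_on UNIV f"
| "Ck (Suc k) f \<longleftrightarrow> (\<forall>x. f differentiable (at x)) \<and>
     (\<forall>b\<in>Basis. Ck k (\<lambda>x. frechet_derivative f (at x) b))"

definition compactly_in :: "'a::euclidean_space set \<Rightarrow> 'a set \<Rightarrow> bool" where
  "compactly_in S U \<longleftrightarrow> compact (closure S) \<and> closure S \<subseteq> U"

text \<open>Test functions on an open set are identified with their extensions by zero.\<close>

definition test_fun :: "'a::euclidean_space set \<Rightarrow> ('a \<Rightarrow> real) \<Rightarrow> bool" where
  "test_fun U f \<longleftrightarrow> (\<forall>k. Ck k f) \<and> compactly_in {x. f x \<noteq> 0} U"

definition grad :: "('a::euclidean_space \<Rightarrow> real) \<Rightarrow> 'a \<Rightarrow> 'a" where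
  "grad f x = (\<Sum>b\<in>Basis. frechet_derivative f (at x) b *\<^sub>R b)"

definition space_grad :: "('a::euclidean_space \<times> real \<Rightarrow> real) \<Rightarrow> 'a \<times> real \<Rightarrow> 'a" where
  "space_grad f z = grad (\<lambda>x. f (x, snd z)) (fst z)"

definition time_deriv :: "('a::euclidean_space \<times> real \<Rightarrow> real) \<Rightarrow> 'a \<times> real \<Rightarrow> real" where
  "time_deriv f z = deriv (\<lambda>t. f (fst z, t)) (snd z)"


section \<open>Function spaces\<close>

definition weak_gradient ::
    "'a::euclidean_space set \<Rightarrow> ('a \<Rightarrow> real) \<Rightarrow> ('a \<Rightarrow> 'a) \<Rightarrow> bool" where
  "weak_gradient U v G \<longleftrightarrow> (\<forall>\<phi>. test_fun U \<phi> \<longrightarrow>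
     (LINT x:U|lebesgue. v x *\<^sub>R grad \<phi> x) = - (LINT x:U|lebesgue. \<phi> x *\<^sub>R G x))"

definition Lq_on ::
    "nat \<Rightarrow> real \<Rightarrow> 'a::euclidean_space set \<Rightarrow> ('a \<Rightarrow> nat \<Rightarrow> 'v::euclidean_space) \<Rightarrow> bool" where
  "Lq_on N q S f \<longleftrightarrow> vmeasurable_on N S f \<and>
     (\<integral>\<^sup>+z\<in>S. ennreal (vnorm N (f z) powr q) \<partial>lebesgue) < \<infinity>"

definition Lq_loc ::
    "nat \<Rightarrow> real \<Rightarrow> 'a::euclidean_space set \<Rightarrow> ('a \<Rightarrow> nat \<Rightarrow> 'v::euclidean_space) \<Rightarrow> bool" where
  "Lq_loc N q U f \<longleftrightarrow> (\<forall>K. compact K \<and> K \<subseteq> U \<longrightarrow> Lq_on N q K f)"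

text \<open>\<open>W1q N q U v G\<close>: \<open>v \<in> W^(1,q)(U; R^N)\<close> for a bounded open set \<open>U\<close>, and \<open>G\<close> is a
  representative of its weak gradient.\<close>

definition W1q ::
    "nat \<Rightarrow> real \<Rightarrow> 'a::euclidean_space set \<Rightarrow> ('a \<Rightarrow> nat \<Rightarrow> real) \<Rightarrow> ('a \<Rightarrow> nat \<Rightarrow> 'a) \<Rightarrow> bool" where
  "W1q N q U v G \<longleftrightarrow> Lq_on N q U v \<and> Lq_on N q U G \<and>
     (\<forall>i<N. weak_gradient U (\<lambda>x. v x i) (\<lambda>x. G x i))"

text \<open>\<open>parabolic_space N q \<Omega> T u Du\<close>: \<open>u\<close> belongs to \<open>L^q_loc(0,T; W^(1,q)_loc(\<Omega>; R^N))\<close>, and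
  \<open>Du\<close> is a (jointly measurable) representative of its weak gradient in the space variable.\<close>

definition parabolic_space ::
    "nat \<Rightarrow> real \<Rightarrow> 'a::euclidean_space set \<Rightarrow> real \<Rightarrow>
     ('a \<times> real \<Rightarrow> nat \<Rightarrow> real) \<Rightarrow> ('a \<times> real \<Rightarrow> nat \<Rightarrow> 'a) \<Rightarrow> bool" where
  "parabolic_space N q \<Omega> T u Du \<longleftrightarrow>
     (\<forall>z\<in>\<Omega> \<times> {0<..<T}. u z \<in> vecs N \<and> Du z \<in> vecs N) \<and>
     vmeasurable_on N (\<Omega> \<times> {0<..<T}) u \<and> vmeasurable_on N (\<Omega> \<times> {0<..<T}) Du \<and>
     (\<forall>\<Omega>' t1 t2. open \<Omega>' \<and> compactly_in \<Omega>' \<Omega> \<and> 0 < t1 \<and> t1 < t2 \<and> t2 < T \<longrightarrow>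
        (AE t in lebesgue_on {t1<..<t2}. W1q N q \<Omega>' (\<lambda>x. u (x, t)) (\<lambda>x. Du (x, t))) \<and>
        (\<integral>\<^sup>+z\<in>\<Omega>' \<times> {t1<..<t2}.
           ennreal (vnorm N (u z) powr q + vnorm N (Du z) powr q) \<partial>lebesgue) < \<infinity>)"


section \<open>The parabolic system\<close>

definition structure_conditions ::
    "nat \<Rightarrow> real \<Rightarrow> real \<Rightarrow> ('a::euclidean_space \<times> real) set \<Rightarrow>
     ('a \<times> real \<Rightarrow> (nat \<Rightarrow> 'a) \<Rightarrow> (nat \<Rightarrow> 'a)) \<Rightarrow> bool" where
  "structure_conditions N \<nu> L \<Omega>\<^sub>T A \<longleftrightarrow>
     (\<forall>z\<in>\<Omega>\<^sub>T. \<forall>\<xi>\<in>vecs N. A z \<xi> \<in> vecs N) \<and>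
     (\<forall>\<xi>\<in>vecs N. vmeasurable_on N \<Omega>\<^sub>T (\<lambda>z. A z \<xi>)) \<and>
     (AE z in lebesgue_on \<Omega>\<^sub>T. continuous_on (vecs N) (A z)) \<and>
     (AE z in lebesgue_on \<Omega>\<^sub>T. \<forall>\<xi>\<in>vecs N.
        \<nu> * (vnorm N \<xi>)\<^sup>2 \<le> vinner N (A z \<xi>) \<xi> \<and> vnorm N (A z \<xi>) \<le> L * vnorm N \<xi>)"

definition weak_solution ::
    "nat \<Rightarrow> ('a::euclidean_space \<times> real) set \<Rightarrow>
     ('a \<times> real \<Rightarrow> (nat \<Rightarrow> 'a) \<Rightarrow> (nat \<Rightarrow> 'a)) \<Rightarrow> ('a \<times> real \<Rightarrow> nat \<Rightarrow> 'a) \<Rightarrow>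
     ('a \<times> real \<Rightarrow> nat \<Rightarrow> real) \<Rightarrow> ('a \<times> real \<Rightarrow> nat \<Rightarrow> 'a) \<Rightarrow> bool" where
  "weak_solution N \<Omega>\<^sub>T A F u Du \<longleftrightarrow>
     (\<forall>\<phi>. (\<forall>i<N. test_fun \<Omega>\<^sub>T (\<phi> i)) \<longrightarrow>
        (LINT z:\<Omega>\<^sub>T|lebesgue. - vinner N (u z) (\<lambda>i. time_deriv (\<phi> i) z)
                             + vinner N (A z (Du z)) (\<lambda>i. space_grad (\<phi> i) z))
        = (LINT z:\<Omega>\<^sub>T|lebesgue. vinner N (F z) (\<lambda>i. space_grad (\<phi> i) z)))"

definition solution_setting ::
    "real \<Rightarrow> real \<Rightarrow> nat \<Rightarrow> 'a::euclidean_space set \<Rightarrow> real \<Rightarrow> real \<Rightarrow>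
     ('a \<times> real \<Rightarrow> (nat \<Rightarrow> 'a) \<Rightarrow> (nat \<Rightarrow> 'a)) \<Rightarrow> ('a \<times> real \<Rightarrow> nat \<Rightarrow> 'a) \<Rightarrow>
     ('a \<times> real \<Rightarrow> nat \<Rightarrow> real) \<Rightarrow> ('a \<times> real \<Rightarrow> nat \<Rightarrow> 'a) \<Rightarrow> bool" where
  "solution_setting q L N \<Omega> T \<nu> A F u Du \<longleftrightarrow>
     1 \<le> N \<and> open \<Omega> \<and> connected \<Omega> \<and> \<Omega> \<noteq> {} \<and> bounded \<Omega> \<and> 0 < T \<and> 0 < \<nu> \<and> \<nu> < L \<and>
     structure_conditions N \<nu> L (\<Omega> \<times> {0<..<T}) A \<and>
     (\<forall>z\<in>\<Omega> \<times> {0<..<T}. F z \<in> vecs N) \<and> vmeasurable_on N (\<Omega> \<times> {0<..<T}) F \<and>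
     Lq_loc N q (\<Omega> \<times> {0<..<T}) F \<and>
     parabolic_space N q \<Omega> T u Du \<and>
     weak_solution N (\<Omega> \<times> {0<..<T}) A F u Du"


section \<open>Cylinders, means and the strong maximal function\<close>

definition tint :: "real \<Rightarrow> real \<Rightarrow> real set" where
  "tint t0 r = {t0 - r\<^sup>2<..<t0 + r\<^sup>2}"

definition pcyl :: "'a::euclidean_space \<Rightarrow> real \<Rightarrow> real \<Rightarrow> ('a \<times> real) set" where
  "pcyl x0 t0 r = ball x0 r \<times> tint t0 r"

definition mean_on :: "'a::euclidean_space set \<Rightarrow> ('a \<Rightarrow> ennreal) \<Rightarrow> ennreal" where
  "mean_on S f = (\<integral>\<^sup>+z\<in>S. f z \<partial>lebesgue) / emeasure lebesgue S"

definition time_mean ::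
    "real set \<Rightarrow> ('a::euclidean_space \<times> real \<Rightarrow> nat \<Rightarrow> real) \<Rightarrow> 'a \<Rightarrow> nat \<Rightarrow> real" where
  "time_mean I u x = (\<lambda>i. (LINT t:I|lebesgue. u (x, t) i) / measure lebesgue I)"

definition osc ::
    "nat \<Rightarrow> real set \<Rightarrow> ('a::euclidean_space \<times> real \<Rightarrow> nat \<Rightarrow> real) \<Rightarrow> 'a \<Rightarrow> real \<Rightarrow> real" where
  "osc N I u x t = vnorm N (\<lambda>i. u (x, t) i - time_mean I u x i)"

definition strong_maximal ::
    "('a::euclidean_space \<times> real \<Rightarrow> real) \<Rightarrow> 'a \<times> real \<Rightarrow> ennreal" where
  "strong_maximal f z =
     (SUP (y, r, a, b) \<in> {(y, r, a, b). 0 < r \<and> a < b \<and> z \<in> ball y r \<times> {a<..<b}}.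
        mean_on (ball y r \<times> {a<..<b}) (\<lambda>\<zeta>. ennreal \<bar>f \<zeta>\<bar>))"

definition data_maximal ::
    "nat \<Rightarrow> ('a::euclidean_space \<times> real) set \<Rightarrow> ('a \<times> real \<Rightarrow> nat \<Rightarrow> 'a) \<Rightarrow>
     ('a \<times> real \<Rightarrow> nat \<Rightarrow> 'a) \<Rightarrow> 'a \<times> real \<Rightarrow> ennreal" where
  "data_maximal N S Du F =
     strong_maximal (\<lambda>z. indicat_real S z * (vnorm N (Du z) + vnorm N (F z)))"

text \<open>The power \<open>x^p\<close> of \<open>x \<in> [0,\<infinity>]\<close>, for \<open>p > 0\<close>.\<close>

definition epowr :: "ennreal \<Rightarrow> real \<Rightarrow> ennreal" where
  "epowr x p = (if x = top then top else ennreal (enn2real x powr p))"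

text \<open>The quotient \<open>a / d\<close> of \<open>a \<in> [0,\<infinity>)\<close> and \<open>d \<in> [0,\<infinity>]\<close>, with \<open>a / 0 = 0\<close> and \<open>a / \<infinity> = 0\<close>.\<close>

definition quot :: "real \<Rightarrow> ennreal \<Rightarrow> real" where
  "quot a d = (if d = 0 then 0 else enn2real (ennreal a / d))"

end

theory Submission
  imports Defs
begin

text \<open>
  The theorem follows from one pointwise inequality: for almost every \<open>x\<close> in \<open>B\<close> and almost every
  \<open>t\<close> in \<open>I\<close>,

    \<open>|u(x,t) - u_I(x)| \<le> C \<integral>_I g(x,s) |t-s|^(-1/2) ds,\<close>

  with \<open>C\<close> depending only on \<open>n\<close> and \<open>L\<close> (\<open>oscillation_estimate\<close>). In the time variable alone the
  right-hand side is a fractional integral of order \<open>1/2\<close> over an interval, and the three parts are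
  its mapping properties on \<open>L^q\<close> for \<open>q < 2\<close>, \<open>q = 2\<close> and \<open>q > 2\<close>: Young's inequality
  (\<open>potential_mean_power\<close>), the same inequality with explicit constants summed over the exponential
  series (\<open>potential_mean_exp\<close>), and Hoelder's inequality (\<open>potential_mean_sup\<close>).

  The pointwise inequality compares averages of \<open>u\<close> over shrinking parabolic cylinders. The weight
  is a smooth bump \<open>kernel x t \<theta> r\<close> of constant mass, supported in the product \<open>cyl x t \<theta> r\<close> of the
  ball of radius \<open>r\<close> about \<open>x\<close> and a time window of length \<open>2 r^2\<close> that contains \<open>t\<close>. The
  derivative of the kernel in the scale \<open>r\<close> is a parabolic divergence,

    \<open>\<partial>_r K = - (1/r) (div_y ((y-x) K) + 2 \<partial>_s ((s-t) K)).\<close>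

  Tested against \<open>u\<close>, the first term is moved onto \<open>\<nabla>u\<close> by the weak gradient, and the second onto
  \<open>A(z,\<nabla>u) - F\<close> by the equation. Hence the average changes between the scales \<open>r\<close> and \<open>r/2\<close> by at
  most a constant times \<open>r\<close> times the mean of \<open>|\<nabla>u| + |F|\<close> over the cylinder (\<open>avg_step\<close>). That mean
  is at most \<open>g(x,s)\<close> for every \<open>s\<close> in the time window, so \<open>g(x,s)\<close> may be averaged in \<open>s\<close>. Summing
  over \<open>r = \<rho>, \<rho>/2, \<rho>/4, ...\<close>, the windows containing a given \<open>s\<close> are among those with \<open>r^2\<close> at least
  about \<open>|t-s|\<close>, and the weights \<open>1/r\<close> add up to at most a multiple of \<open>|t-s|^(-1/2)\<close> (\<open>dyadic_sum\<close>).

  Two choices make the sum close up. The window at scale \<open>r\<close> is the image of \<open>I\<close> under the homothety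
  with centre \<open>t\<close> and ratio \<open>(r/\<rho>)^2\<close>, which is what the parameter \<open>\<theta>\<close> encodes. So all windows stay
  inside \<open>I\<close>, and at \<open>r = \<rho>\<close> the window is \<open>I\<close> itself: the average at the largest scale does not
  depend on \<open>t\<close> (\<open>kernel_rho\<close>) and serves as a base value, which the time mean \<open>u_I\<close> then replaces at
  the cost of a factor (\<open>vmean_estimate\<close>). Systems are reduced to scalar functions by duality,
  pairing with unit vectors \<open>e\<close> of \<open>R^N\<close>, so that no constant depends on \<open>N\<close>.
\<close>

section \<open>Calculus of smooth functions\<close>

lemma Ck_SucI:
  fixes f :: "'a::euclidean_space \<Rightarrow> real"
  assumes "\<And>x. (f has_derivative f' x) (at x)" "\<And>b. b \<in> Basis \<Longrightarrow> Ck k (\<lambda>x. f' x b)"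
  shows "Ck (Suc k) f"
proof -
  have "frechet_derivative f (at x) = f' x" for x
    using assms(1)[of x] by (metis frechet_derivative_at)
  with assms show ?thesis by (auto simp: differentiable_def)
qed

lemma Ck_Suc_derivative:
  assumes "Ck (Suc k) f"
  shows "(f has_derivative frechet_derivative f (at x)) (at x)"
  using assms by (simp add: frechet_derivative_works[symmetric])

lemma Ck_SucD: "Ck (Suc k) f \<Longrightarrow> Ck k f"
proof (induction k arbitrary: f)
  case 0
  then show ?case
    by (simp add: continuous_on_eq_continuous_at differentiable_imp_continuous_within)
next
  case (Suc k)
  show ?case using Suc.prems Suc.IH unfolding Ck.simps(2)[of "Suc k"] Ck.simps(2)[of k] by blast
qed

lemma Ck_const [simp]: "Ck k (\<lambda>x::'a::euclidean_space. c)"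
proof (induction k arbitrary: c)
  case (Suc k)
  show ?case by (rule Ck_SucI[where f'="\<lambda>_ _. 0"]) (simp_all add: Suc)
qed auto

lemma Ck_linear: "bounded_linear f \<Longrightarrow> Ck k f"
proof (cases k)
  case (Suc k')
  assume "bounded_linear f"
  then show ?thesis unfolding Suc
    by (intro Ck_SucI[where f'="\<lambda>_. f"]) (auto intro: bounded_linear_imp_has_derivative)
qed (auto intro: linear_continuous_on)

lemma Ck_add: "Ck k f \<Longrightarrow> Ck k g \<Longrightarrow> Ck k (\<lambda>x. f x + g x)"
proof (induction k arbitrary: f g)
  case (Suc k)
  show ?case
  proof (rule Ck_SucI[where f'="\<lambda>x b. frechet_derivative f (at x) b + frechet_derivative g (at x) b"])
    show "((\<lambda>x. f x + g x) has_derivative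
         (\<lambda>b. frechet_derivative f (at x) b + frechet_derivative g (at x) b)) (at x)" for x
      by (rule has_derivative_add[OF Ck_Suc_derivative Ck_Suc_derivative]) (use Suc.prems in blast)+
    show "Ck k (\<lambda>x. frechet_derivative f (at x) b + frechet_derivative g (at x) b)" if "b \<in> Basis" for b
      using Suc.prems that by (intro Suc.IH) auto
  qed
qed (simp add: continuous_on_add continuous_on_mult)

lemma Ck_mult: "Ck k f \<Longrightarrow> Ck k g \<Longrightarrow> Ck k (\<lambda>x. f x * g x)"
proof (induction k arbitrary: f g)
  case (Suc k)
  have *: "Ck k f" "Ck k g" using Suc.prems Ck_SucD by blast+
  show ?case
  proof (rule Ck_SucI[where f'="\<lambda>x b. f x * frechet_derivative g (at x) b + frechet_derivative f (at x) b * g x"])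
    show "((\<lambda>x. f x * g x) has_derivative
         (\<lambda>b. f x * frechet_derivative g (at x) b + frechet_derivative f (at x) b * g x)) (at x)" for x
      by (rule has_derivative_mult[OF Ck_Suc_derivative Ck_Suc_derivative]) (use Suc.prems in blast)+
    show "Ck k (\<lambda>x. f x * frechet_derivative g (at x) b + frechet_derivative f (at x) b * g x)"
      if "b \<in> Basis" for b
      using Suc.prems that * by (intro Ck_add Suc.IH) auto
  qed
qed (simp add: continuous_on_add continuous_on_mult)

lemma Ck_compose:
  fixes h :: "real \<Rightarrow> real"
  shows "Ck k h \<Longrightarrow> Ck k f \<Longrightarrow> Ck k (\<lambda>x. h (f x))"
proof (induction k arbitrary: h f)
  case 0
  then show ?case by (auto intro!: continuous_on_compose2[of UNIV h UNIV f])
next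
  case (Suc k)
  have *: "Ck k h" "Ck k f" using Suc.prems Ck_SucD by blast+
  have lin: "frechet_derivative h (at y) r = r * frechet_derivative h (at y) 1" for y r
    using linear_scale[OF has_derivative_linear[OF Ck_Suc_derivative[OF Suc.prems(1), of y]], of r 1] by simp
  show ?case
  proof (rule Ck_SucI[where f'="\<lambda>x b. frechet_derivative f (at x) b * frechet_derivative h (at (f x)) 1"])
    show "((\<lambda>x. h (f x)) has_derivative
         (\<lambda>b. frechet_derivative f (at x) b * frechet_derivative h (at (f x)) 1)) (at x)" for x
      using has_derivative_compose[OF Ck_Suc_derivative[OF Suc.prems(2)] Ck_Suc_derivative[OF Suc.prems(1)], of x]
      unfolding lin[of _ "frechet_derivative f (at x) _"] .
    show "Ck k (\<lambda>x. frechet_derivative f (at x) b * frechet_derivative h (at (f x)) 1)" if "b \<in> Basis" for b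
    proof (rule Ck_mult)
      show "Ck k (\<lambda>x. frechet_derivative f (at x) b)" using Suc.prems(2) that by simp
      have "Ck k (\<lambda>y. frechet_derivative h (at y) 1)" using Suc.prems(1) by simp
      from Suc.IH[OF this *(2)] show "Ck k (\<lambda>x. frechet_derivative h (at (f x)) 1)" .
    qed
  qed
qed

lemma Ck_sum: "(\<And>i. i \<in> I \<Longrightarrow> Ck k (f i)) \<Longrightarrow> Ck k (\<lambda>x. \<Sum>i\<in>I. f i x)"
proof (induction I rule: infinite_finite_induct)
  case (insert i I) then show ?case using Ck_add[of k "f i"] by simp
qed auto

lemma Ck_diff: "Ck k f \<Longrightarrow> Ck k g \<Longrightarrow> Ck k (\<lambda>x. f x - g x)"
  using Ck_add[of k f "\<lambda>x. - 1 * g x"] Ck_mult[OF Ck_const, of k g "-1"] by simp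

section \<open>The flat function \<open>exp(-1/s)\<close>\<close>

definition flat :: "real \<Rightarrow> real" where
  "flat s = (if 0 < s then exp (- (1 / s)) else 0)"

definition dflat :: "real \<Rightarrow> real" where
  "dflat s = (if 0 < s then exp (- (1 / s)) / s\<^sup>2 else 0)"

text \<open>
  The functions \<open>s^(-m) exp(-1/s)\<close>, extended by zero. The span of this family is closed under
  differentiation, which yields smoothness of \<open>flat\<close> by induction.
\<close>

definition flatp :: "nat \<Rightarrow> real \<Rightarrow> real" where
  "flatp m s = (if 0 < s then (1 / s) ^ m * exp (- (1 / s)) else 0)"

text \<open>
  With \<open>x = 1/s\<close> this is the statement that \<open>exp\<close> beats every power at infinity.
\<close>

lemma flatp_tendsto_0: "(flatp m \<longlongrightarrow> 0) (at_right 0)"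
proof -
  have "((\<lambda>s::real. inverse s ^ m / exp (inverse s)) \<longlongrightarrow> 0) (at_right 0)"
    using filterlim_compose[OF tendsto_power_div_exp_0 filterlim_inverse_at_top_right] .
  then show ?thesis
    by (rule Lim_transform_eventually)
       (auto simp: flatp_def eventually_at_filter exp_minus divide_simps)
qed

lemma flatp_has_derivative:
  "(flatp m has_field_derivative (flatp (m + 2) s - real m * flatp (m + 1) s)) (at s)"
proof -
  consider "s > 0" | "s < 0" | "s = 0" by linarith
  then show ?thesis
  proof cases
    case 1
    have pw: "real m * inverse s ^ (m - Suc 0) * (inverse s)\<^sup>2 = real m * inverse s ^ (m + 1)"
      by (cases m) (auto simp: power2_eq_square)
    have *: "((\<lambda>s. (inverse s) ^ m * exp (- inverse s)) has_field_derivative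
        (flatp (m + 2) s - real m * flatp (m + 1) s)) (at s)"
      using 1 pw by (auto intro!: derivative_eq_intros
          simp: flatp_def inverse_eq_divide[symmetric] algebra_simps power2_eq_square)
    show ?thesis
      by (rule has_field_derivative_transform_within_open[OF *, of "{0<..}"])
         (use 1 in \<open>auto simp: flatp_def inverse_eq_divide\<close>)
  next
    case 2
    have "((\<lambda>_. 0) has_field_derivative (flatp (m + 2) s - real m * flatp (m + 1) s)) (at s)"
      using 2 by (auto simp: flatp_def)
    then show ?thesis
      by (rule has_field_derivative_transform_within_open[of _ _ _ "{..<0}"])
         (use 2 in \<open>auto simp: flatp_def\<close>)
  next
    case 3
    \<comment> \<open>the difference quotient at \<open>0\<close> is again a member of the family, of index \<open>m + 1\<close>\<close>
    have "((\<lambda>s. flatp m s / s) \<longlongrightarrow> 0) (at_right 0)"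
      by (rule Lim_transform_eventually[OF flatp_tendsto_0[of "Suc m"]])
         (auto simp: flatp_def eventually_at_filter divide_simps)
    moreover have "((\<lambda>s. flatp m s / s) \<longlongrightarrow> 0) (at_left 0)"
      by (rule Lim_transform_eventually[OF tendsto_const])
         (auto simp: flatp_def eventually_at_filter)
    ultimately show ?thesis
      using 3 by (simp add: has_field_derivative_iff filterlim_at_split flatp_def)
  qed
qed

lemma Ck_flatp: "Ck k (flatp m)"
proof (induction k arbitrary: m)
  case 0
  show ?case
    using flatp_has_derivative by (auto simp: continuous_on_eq_continuous_at intro: DERIV_isCont)
next
  case (Suc k)
  show ?case
    by (rule Ck_SucI[OF has_field_derivative_imp_has_derivative[OF flatp_has_derivative]])
       (auto intro!: Ck_mult Ck_diff Suc)
qed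

lemma flat_eq: "flat = flatp 0" and dflat_eq: "dflat = flatp 2"
  by (auto simp: fun_eq_iff flat_def dflat_def flatp_def power_one_over)

lemma Ck_flat: "Ck k flat"
  unfolding flat_eq by (rule Ck_flatp)

lemma flat_has_derivative: "(flat has_field_derivative dflat s) (at s)"
  using flatp_has_derivative[of 0 s] by (simp add: flat_eq dflat_eq numeral_2_eq_2)

lemma continuous_on_flat: "continuous_on S flat" and continuous_on_dflat: "continuous_on S dflat"
  using Ck_flatp[of 0 0] Ck_flatp[of 0 2] unfolding flat_eq dflat_eq
  by (auto intro: continuous_on_subset)

lemma flat_nonneg: "0 \<le> flat s" and dflat_nonneg: "0 \<le> dflat s" and flat_le_1: "flat s \<le> 1"
  by (auto simp: flat_def dflat_def)

lemma flat_pos_iff: "0 < flat s \<longleftrightarrow> 0 < s"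
  by (auto simp: flat_def)

lemma flat_zero: "s \<le> 0 \<Longrightarrow> flat s = 0" and dflat_zero: "s \<le> 0 \<Longrightarrow> dflat s = 0"
  by (auto simp: flat_def dflat_def)

text \<open>
  The constant comes from \<open>x^2 / 2 \<le> exp x\<close> at \<open>x = 1/s\<close>.
\<close>

lemma dflat_le_2: "dflat s \<le> 2"
proof (cases "0 < s")
  case True
  have "(1/s)\<^sup>2 / 2 \<le> exp (1/s)"
  proof -
    have "0 < 1/s" using True by simp
    with exp_lower_Taylor_quadratic[of "1/s"] show ?thesis by linarith
  qed
  then show ?thesis using True
    by (simp add: dflat_def exp_minus divide_simps mult.commute)
qed (auto simp: dflat_def)

section \<open>Bumps with parabolic scaling\<close>

definition sbump :: "'a::euclidean_space \<Rightarrow> real \<Rightarrow> 'a \<Rightarrow> real" where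
  "sbump x r y = flat (1 - (y - x) \<bullet> (y - x) / r\<^sup>2)"

definition dsbump :: "'a::euclidean_space \<Rightarrow> real \<Rightarrow> 'a \<Rightarrow> real" where
  "dsbump x r y = dflat (1 - (y - x) \<bullet> (y - x) / r\<^sup>2)"

definition tbump :: "real \<Rightarrow> real \<Rightarrow> real \<Rightarrow> real \<Rightarrow> real" where
  "tbump t \<theta> r s = flat (1 - ((s - t) / r\<^sup>2 - \<theta>)\<^sup>2)"

definition dtbump :: "real \<Rightarrow> real \<Rightarrow> real \<Rightarrow> real \<Rightarrow> real" where
  "dtbump t \<theta> r s = dflat (1 - ((s - t) / r\<^sup>2 - \<theta>)\<^sup>2)"

text \<open>
  The divergence of the field \<open>y \<mapsto> sbump x r y \<cdot> (y - x)\<close>; see \<open>sum_space_test_derivative\<close>.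
\<close>

definition space_div :: "'a::euclidean_space \<Rightarrow> real \<Rightarrow> 'a \<Rightarrow> real" where
  "space_div x r y = DIM('a) * sbump x r y - 2 * dsbump x r y * ((y - x) \<bullet> (y - x)) / r\<^sup>2"

text \<open>
  The derivative of \<open>s \<mapsto> (s - t) \<cdot> tbump t \<theta> r s\<close>; see \<open>time_deriv_time_test\<close>.
\<close>

definition time_div :: "real \<Rightarrow> real \<Rightarrow> real \<Rightarrow> real \<Rightarrow> real" where
  "time_div t \<theta> r s = tbump t \<theta> r s - 2 * (s - t) * ((s - t) / r\<^sup>2 - \<theta>) * dtbump t \<theta> r s / r\<^sup>2"

text \<open>
  The power \<open>r^(n+2)\<close> is, up to a constant, the volume of the support, so the mass does not depend on
  \<open>r\<close>. The parameter \<open>\<theta>\<close> shifts the time window relative to \<open>t\<close>; for \<open>|\<theta>| < 1\<close> it contains \<open>t\<close>.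
\<close>

definition kernel :: "'a::euclidean_space \<Rightarrow> real \<Rightarrow> real \<Rightarrow> real \<Rightarrow> 'a \<times> real \<Rightarrow> real" where
  "kernel x t \<theta> r z = sbump x r (fst z) * tbump t \<theta> r (snd z) / r ^ (DIM('a) + 2)"

text \<open>
  The derivative of the kernel in the scale \<open>r\<close>, written as a parabolic divergence. The factor \<open>2\<close>
  is the exponent of time in the parabolic scaling \<open>(y - x)/r\<close>, \<open>(s - t)/r^2\<close>.
\<close>

definition dkernel :: "'a::euclidean_space \<Rightarrow> real \<Rightarrow> real \<Rightarrow> real \<Rightarrow> 'a \<times> real \<Rightarrow> real" where
  "dkernel x t \<theta> r z = - (space_div x r (fst z) * tbump t \<theta> r (snd z)
      + 2 * (sbump x r (fst z) * time_div t \<theta> r (snd z))) / r ^ (DIM('a) + 3)"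

definition window :: "real \<Rightarrow> real \<Rightarrow> real \<Rightarrow> real set" where
  "window t \<theta> r = {t + r\<^sup>2 * (\<theta> - 1) <..< t + r\<^sup>2 * (\<theta> + 1)}"

lemma flat_deriv_chain:
  assumes "(f has_derivative f') (at x)"
  shows "((\<lambda>x. flat (f x)) has_derivative (\<lambda>h. f' h * dflat (f x))) (at x)"
  using has_derivative_compose[OF assms, of flat "(*) (dflat (f x))"] flat_has_derivative[of "f x"]
  by (simp add: has_field_derivative_def mult.commute)

lemma sbump_has_derivative:
  "(sbump x r has_derivative (\<lambda>h. - 2 / r\<^sup>2 * dsbump x r y * ((y - x) \<bullet> h))) (at y)"
proof -
  have "((\<lambda>y. 1 - (y - x) \<bullet> (y - x) / r\<^sup>2) has_derivative (\<lambda>h. - 2 / r\<^sup>2 * ((y - x) \<bullet> h))) (at y)"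
    unfolding divide_inverse by (auto intro!: derivative_eq_intros simp: fun_eq_iff inner_commute)
  from flat_deriv_chain[OF this] show ?thesis
    unfolding sbump_def[abs_def] dsbump_def by (simp add: mult_ac)
qed

lemma flat_DERIV_chain:
  assumes "(f has_real_derivative f') (at x)"
  shows "((\<lambda>x. flat (f x)) has_real_derivative (f' * dflat (f x))) (at x)"
  using DERIV_chain2[OF flat_has_derivative assms] by (simp add: mult.commute)

lemma tbump_DERIV:
  "(tbump t \<theta> r has_real_derivative - 2 * ((s - t) / r\<^sup>2 - \<theta>) * dtbump t \<theta> r s / r\<^sup>2) (at s)"
proof -
  have "((\<lambda>s. 1 - ((s - t) / r\<^sup>2 - \<theta>)\<^sup>2) has_real_derivative - 2 * ((s - t) / r\<^sup>2 - \<theta>) / r\<^sup>2) (at s)"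
    by (cases "r = 0") (auto intro!: derivative_eq_intros simp: divide_simps)
  from flat_DERIV_chain[OF this] show ?thesis
    unfolding tbump_def[abs_def] dtbump_def by (simp add: mult_ac)
qed

text \<open>
  The kernel is \<open>r^(-n-2) \<Phi>((y-x)/r, (s-t)/r^2)\<close>. Differentiating in \<open>r\<close> produces the generator
  of the scaling, \<open>(y-x) \<cdot> \<nabla> + 2 (s-t) \<partial>\<close>, together with \<open>n + 2\<close> copies of the kernel; these copies
  are exactly what turns the generator into a divergence.
\<close>

lemma kernel_DERIV:
  assumes "0 < r"
  shows "((\<lambda>r. kernel x t \<theta> r z) has_real_derivative dkernel x t \<theta> r z) (at r)"
proof -
  obtain y s where z: "z = (y, s)" by (cases z)
  define d where "d = (y - x) \<bullet> (y - x)"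
  define a a' where "a = sbump x r y" and "a' = dsbump x r y"
  define \<tau> where "\<tau> = (s - t) / r\<^sup>2 - \<theta>"
  define b b' where "b = tbump t \<theta> r s" and "b' = dtbump t \<theta> r s"
  have "((\<lambda>r. 1 - d / r\<^sup>2) has_real_derivative 2 * d / r ^ 3) (at r)"
    using assms by (auto intro!: derivative_eq_intros simp: power2_eq_square power3_eq_cube mult_ac)
  from flat_DERIV_chain[OF this]
  have 1: "((\<lambda>r. sbump x r y) has_real_derivative 2 * d / r ^ 3 * a') (at r)"
    unfolding sbump_def a'_def dsbump_def d_def .
  have "((\<lambda>r. 1 - ((s - t) / r\<^sup>2 - \<theta>)\<^sup>2) has_real_derivative 4 * \<tau> * (s - t) / r ^ 3) (at r)"
  proof -
    have "((\<lambda>r. (s - t) / r\<^sup>2 - \<theta>) has_real_derivative 2 * (t - s) / r ^ 3) (at r)"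
      using assms by (auto intro!: derivative_eq_intros simp: power2_eq_square power3_eq_cube algebra_simps divide_inverse)
    from DERIV_diff[OF DERIV_const[of 1] DERIV_power[OF this, of 2]] show ?thesis
      by (simp add: \<tau>_def divide_inverse algebra_simps)
  qed
  from flat_DERIV_chain[OF this]
  have 2: "((\<lambda>r. tbump t \<theta> r s) has_real_derivative 4 * \<tau> * (s - t) / r ^ 3 * b') (at r)"
    unfolding tbump_def b'_def dtbump_def .
  have 3: "((\<lambda>r. r ^ (DIM('a) + 2)) has_real_derivative (DIM('a) + 2) * r ^ (DIM('a) + 1)) (at r)"
    using DERIV_pow[of "DIM('a) + 2" r UNIV] by (simp add: add.commute)
  have "((\<lambda>r. sbump x r y * tbump t \<theta> r s / r ^ (DIM('a) + 2)) has_real_derivative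
     ((2 * d / r ^ 3 * a' * b + 4 * \<tau> * (s - t) / r ^ 3 * b' * a) * r ^ (DIM('a) + 2)
       - a * b * ((DIM('a) + 2) * r ^ (DIM('a) + 1))) / (r ^ (DIM('a) + 2) * r ^ (DIM('a) + 2))) (at r)"
    using DERIV_divide[OF DERIV_mult[OF 1 2] 3] assms unfolding a_def b_def by simp
  moreover have "((2 * d / r ^ 3 * a' * b + 4 * \<tau> * (s - t) / r ^ 3 * b' * a) * r ^ (DIM('a) + 2)
       - a * b * ((DIM('a) + 2) * r ^ (DIM('a) + 1))) / (r ^ (DIM('a) + 2) * r ^ (DIM('a) + 2))
     = dkernel x t \<theta> r z"
    unfolding dkernel_def z fst_conv snd_conv space_div_def time_div_def
      a_def[symmetric] a'_def[symmetric] b_def[symmetric] b'_def[symmetric] d_def[symmetric] \<tau>_def[symmetric]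
    using assms by (simp add: power_add divide_simps power2_eq_square power3_eq_cube) algebra
  ultimately show ?thesis
    unfolding kernel_def z by simp
qed

section \<open>Supports and bounds of the bumps\<close>

lemma mem_window_iff: "r \<noteq> 0 \<Longrightarrow> s \<in> window t \<theta> r \<longleftrightarrow> \<bar>(s - t) / r\<^sup>2 - \<theta>\<bar> < 1"
  unfolding window_def abs_less_iff by (auto simp: field_simps)

lemma sbump_zero: "0 < r \<Longrightarrow> y \<notin> ball x r \<Longrightarrow> sbump x r y = 0"
  and dsbump_zero: "0 < r \<Longrightarrow> y \<notin> ball x r \<Longrightarrow> dsbump x r y = 0"
proof -
  assume "0 < r" "y \<notin> ball x r"
  then have "r\<^sup>2 \<le> (norm (y - x))\<^sup>2" by (intro power_mono) (auto simp: dist_norm norm_minus_commute)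
  then have "1 - (y - x) \<bullet> (y - x) / r\<^sup>2 \<le> 0"
    using \<open>0 < r\<close> by (simp add: dot_square_norm)
  then show "sbump x r y = 0" "dsbump x r y = 0"
    by (simp_all add: sbump_def dsbump_def flat_zero dflat_zero)
qed

lemma sbump_pos: "0 < r \<Longrightarrow> y \<in> ball x r \<Longrightarrow> 0 < sbump x r y"
proof -
  assume "0 < r" "y \<in> ball x r"
  then have "(norm (y - x))\<^sup>2 < r\<^sup>2" by (intro power_strict_mono) (auto simp: dist_norm norm_minus_commute)
  then show ?thesis
    using \<open>0 < r\<close> by (simp add: sbump_def flat_pos_iff dot_square_norm)
qed

lemma tbump_zero: "0 < r \<Longrightarrow> s \<notin> window t \<theta> r \<Longrightarrow> tbump t \<theta> r s = 0"
  and dtbump_zero: "0 < r \<Longrightarrow> s \<notin> window t \<theta> r \<Longrightarrow> dtbump t \<theta> r s = 0"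
proof -
  assume "0 < r" "s \<notin> window t \<theta> r"
  then have "1 \<le> \<bar>(s - t) / r\<^sup>2 - \<theta>\<bar>" by (simp add: mem_window_iff)
  then have "1 - ((s - t) / r\<^sup>2 - \<theta>)\<^sup>2 \<le> 0" by (metis abs_le_square_iff abs_one diff_le_0_iff_le one_power2)
  then show "tbump t \<theta> r s = 0" "dtbump t \<theta> r s = 0"
    by (simp_all add: tbump_def dtbump_def flat_zero dflat_zero)
qed

lemma tbump_pos: "0 < r \<Longrightarrow> s \<in> window t \<theta> r \<Longrightarrow> 0 < tbump t \<theta> r s"
  by (simp add: mem_window_iff tbump_def flat_pos_iff abs_square_less_1)

lemma bump_bounds:
  "0 \<le> sbump x r y" "sbump x r y \<le> 1" "0 \<le> dsbump x r y" "dsbump x r y \<le> 2"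
  "0 \<le> tbump t \<theta> r s" "tbump t \<theta> r s \<le> 1" "0 \<le> dtbump t \<theta> r s" "dtbump t \<theta> r s \<le> 2"
  by (simp_all add: sbump_def dsbump_def tbump_def dtbump_def flat_nonneg dflat_nonneg flat_le_1 dflat_le_2)

lemma window_dist:
  assumes "s \<in> window t \<theta> r" "\<bar>\<theta>\<bar> \<le> 1"
  shows "\<bar>s - t\<bar> \<le> 2 * r\<^sup>2"
proof -
  have "r\<^sup>2 * (\<theta> + 1) \<le> r\<^sup>2 * 2" "r\<^sup>2 * (-2) \<le> r\<^sup>2 * (\<theta> - 1)"
    using assms(2) by (intro mult_left_mono; simp)+
  with assms(1) show ?thesis by (auto simp: window_def)
qed

lemma space_div_bound: "0 < r \<Longrightarrow> \<bar>space_div (x::'a::euclidean_space) r y\<bar> \<le> real DIM('a) + 4"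
proof -
  assume r: "0 < r"
  have 1: "dsbump x r y * (((y - x) \<bullet> (y - x)) / r\<^sup>2) \<le> 2 * 1"
  proof (cases "y \<in> ball x r")
    case True
    then have "(norm (y - x))\<^sup>2 \<le> r\<^sup>2" by (intro power_mono) (auto simp: dist_norm norm_minus_commute)
    then show ?thesis using r by (intro mult_mono) (auto simp: bump_bounds dot_square_norm)
  qed (use r in \<open>simp add: dsbump_zero\<close>)
  have 2: "0 \<le> dsbump x r y * (((y - x) \<bullet> (y - x)) / r\<^sup>2)"
    using bump_bounds(3)[of x r y] by simp
  have 3: "0 \<le> DIM('a) * sbump x r y" "DIM('a) * sbump x r y \<le> DIM('a) * 1"
    using bump_bounds(1,2)[of x r y] by (auto intro!: mult_left_mono)
  show ?thesis
    using 1 2 3 unfolding space_div_def times_divide_eq_right[symmetric] mult.assoc abs_le_iff by linarith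
qed

lemma time_div_bound: assumes r: "0 < r" and \<theta>: "\<bar>\<theta>\<bar> \<le> 1" shows "\<bar>time_div t \<theta> r s\<bar> \<le> 9"
proof (cases "s \<in> window t \<theta> r")
  case True
  have "\<bar>(s - t) / r\<^sup>2\<bar> \<le> 2"
    using window_dist[OF True \<theta>] r by (simp add: abs_divide divide_le_eq)
  moreover have "\<bar>(s - t) / r\<^sup>2 - \<theta>\<bar> \<le> 1"
    using True r by (simp add: mem_window_iff)
  moreover have "\<bar>dtbump t \<theta> r s\<bar> \<le> 2"
    using bump_bounds(7,8)[of t \<theta> r s] by simp
  ultimately have "\<bar>(s - t) / r\<^sup>2\<bar> * \<bar>(s - t) / r\<^sup>2 - \<theta>\<bar> * \<bar>dtbump t \<theta> r s\<bar> \<le> 2 * 1 * 2"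
    by (intro mult_mono) auto
  then have "\<bar>(s - t) / r\<^sup>2 * ((s - t) / r\<^sup>2 - \<theta>) * dtbump t \<theta> r s\<bar> \<le> 4"
    by (simp add: abs_mult)
  moreover have "time_div t \<theta> r s = tbump t \<theta> r s - 2 * ((s - t) / r\<^sup>2 * ((s - t) / r\<^sup>2 - \<theta>) * dtbump t \<theta> r s)"
    by (simp add: time_div_def)
  ultimately show ?thesis
    using bump_bounds(5,6)[of t \<theta> r s] by linarith
qed (use r in \<open>simp add: time_div_def tbump_zero dtbump_zero\<close>)

lemma dkernel_bound:
  assumes r: "0 < r" and \<theta>: "\<bar>\<theta>\<bar> \<le> 1"
  shows "\<bar>dkernel (x::'a::euclidean_space) t \<theta> r z\<bar> \<le> (real DIM('a) + 22) / r ^ (DIM('a) + 3)"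
proof -
  have 1: "\<bar>space_div x r (fst z) * tbump t \<theta> r (snd z)\<bar> \<le> (real DIM('a) + 4) * 1"
    unfolding abs_mult using space_div_bound[OF r] bump_bounds(5,6)[of t \<theta> r "snd z"] by (intro mult_mono) auto
  have 2: "\<bar>sbump x r (fst z) * time_div t \<theta> r (snd z)\<bar> \<le> 1 * 9"
    unfolding abs_mult using time_div_bound[OF r \<theta>] bump_bounds(1,2)[of x r "fst z"] by (intro mult_mono) auto
  have "\<bar>space_div x r (fst z) * tbump t \<theta> r (snd z)
      + 2 * (sbump x r (fst z) * time_div t \<theta> r (snd z))\<bar> \<le> real DIM('a) + 22"
  proof -
    have "\<bar>A + 2 * B\<bar> \<le> c + 22" if "\<bar>A\<bar> \<le> (c + 4) * 1" "\<bar>B\<bar> \<le> 1 * 9" for A B c :: real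
      using that by (simp add: abs_le_iff)
    from this[OF 1 2] show ?thesis .
  qed
  then show ?thesis
    using r unfolding dkernel_def by (simp add: abs_divide divide_right_mono)
qed

lemma kernel_bound: "0 < r \<Longrightarrow> 0 \<le> kernel x t \<theta> r z"
   "0 < r \<Longrightarrow> kernel (x::'a::euclidean_space) t \<theta> r z \<le> 1 / r ^ (DIM('a) + 2)"
proof -
  assume r: "0 < r"
  show "0 \<le> kernel x t \<theta> r z" using r by (auto simp: kernel_def bump_bounds intro!: mult_nonneg_nonneg)
  have "sbump x r (fst z) * tbump t \<theta> r (snd z) \<le> 1 * 1"
    by (intro mult_mono) (auto simp: bump_bounds)
  then show "kernel x t \<theta> r z \<le> 1 / r ^ (DIM('a) + 2)"
    unfolding kernel_def using r by (intro divide_right_mono) auto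
qed

lemma kernel_zero: "0 < r \<Longrightarrow> z \<notin> ball x r \<times> window t \<theta> r \<Longrightarrow> kernel x t \<theta> r z = 0"
  by (auto simp: kernel_def mem_Times_iff sbump_zero tbump_zero simp del: mem_ball)

section \<open>Bumps as test functions\<close>

lemma continuous_on_bumps:
  fixes g :: "'c::topological_space \<Rightarrow> 'a::euclidean_space"
  assumes "continuous_on S f" "continuous_on S g" "continuous_on S k" "continuous_on S h"
    "\<And>z. z \<in> S \<Longrightarrow> k z \<noteq> 0"
  shows "continuous_on S (\<lambda>z. sbump (f z) (k z) (g z))" "continuous_on S (\<lambda>z. dsbump (f z) (k z) (g z))"
  unfolding sbump_def dsbump_def using assms
  by (auto intro!: continuous_intros continuous_on_compose2[OF continuous_on_flat[of UNIV]]
      continuous_on_compose2[OF continuous_on_dflat[of UNIV]])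

lemma continuous_on_tbumps:
  fixes g :: "'c::topological_space \<Rightarrow> real"
  assumes "continuous_on S f" "continuous_on S g" "continuous_on S k" "continuous_on S h"
    "\<And>z. z \<in> S \<Longrightarrow> k z \<noteq> 0"
  shows "continuous_on S (\<lambda>z. tbump (f z) (h z) (k z) (g z))" "continuous_on S (\<lambda>z. dtbump (f z) (h z) (k z) (g z))"
  unfolding tbump_def dtbump_def using assms
  by (auto intro!: continuous_intros continuous_on_compose2[OF continuous_on_flat[of UNIV]]
      continuous_on_compose2[OF continuous_on_dflat[of UNIV]])

lemma Ck_affine: "bounded_linear P \<Longrightarrow> Ck k (\<lambda>z. P z \<bullet> b - c)"
  by (intro Ck_diff Ck_linear Ck_const) (rule bounded_linear_compose[OF bounded_linear_inner_left])

lemma Ck_sbump: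
  assumes "bounded_linear P"
  shows "Ck k (\<lambda>z. sbump x r (P z))"
proof -
  have eq: "(\<lambda>z. (P z - x) \<bullet> (P z - x)) = (\<lambda>z. \<Sum>b\<in>Basis. (P z \<bullet> b - x \<bullet> b) * (P z \<bullet> b - x \<bullet> b))"
    by (subst euclidean_inner) (simp add: inner_diff_left)
  have "Ck k (\<lambda>z. (P z - x) \<bullet> (P z - x))"
    unfolding eq by (intro Ck_sum Ck_mult Ck_affine assms)
  then have "Ck k (\<lambda>z. 1 - (P z - x) \<bullet> (P z - x) * (1 / r\<^sup>2))"
    by (intro Ck_diff Ck_mult Ck_const)
  from Ck_compose[OF Ck_flat this] show ?thesis
    by (simp add: sbump_def)
qed

lemma Ck_tbump:
  fixes P :: "_ \<Rightarrow> real"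
  assumes "bounded_linear P"
  shows "Ck k (\<lambda>z. tbump t \<theta> r (P z))"
proof -
  have "Ck k (\<lambda>z. 1 - ((P z \<bullet> 1 - t) * (1 / r\<^sup>2) - \<theta>) * ((P z \<bullet> 1 - t) * (1 / r\<^sup>2) - \<theta>))"
    by (intro Ck_diff Ck_mult Ck_affine[OF assms] Ck_const)
  from Ck_compose[OF Ck_flat this] show ?thesis
    by (simp add: tbump_def power2_eq_square)
qed

lemma compactly_inI:
  assumes "compact K" "S \<subseteq> K" "K \<subseteq> U"
  shows "compactly_in S U"
  unfolding compactly_in_def
  using assms by (meson bounded_subset closure_minimal compact_closure compact_imp_bounded compact_imp_closed order_trans)

text \<open>
  Component \<open>b\<close> of the field \<open>(y - x) sbump\<close> is the function against which the weak partial derivative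
  in direction \<open>b\<close> is tested.
\<close>

lemma test_fun_space:
  assumes "0 < r" "cball x r \<subseteq> U"
  shows "test_fun U (\<lambda>y. ((y - x) \<bullet> b) * sbump x r y)"
  unfolding test_fun_def
proof (intro conjI allI)
  show "Ck k (\<lambda>y. ((y - x) \<bullet> b) * sbump x r y)" for k
    using Ck_mult[OF Ck_affine[OF bounded_linear_ident] Ck_sbump[OF bounded_linear_ident], of k b "x \<bullet> b"]
    by (simp add: inner_diff_left)
  show "compactly_in {y. ((y - x) \<bullet> b) * sbump x r y \<noteq> 0} U"
    by (rule compactly_inI[of "cball x r"]) (use assms sbump_zero in \<open>force+\<close>)
qed

text \<open>
  The closure of the time window, which has to lie in the domain for the bump to be a test function.
\<close>

definition closed_window :: "real \<Rightarrow> real \<Rightarrow> real \<Rightarrow> real set" where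
  "closed_window t \<theta> r = {t + r\<^sup>2 * (\<theta> - 1) .. t + r\<^sup>2 * (\<theta> + 1)}"

text \<open>
  The function \<open>(s - t) K\<close> whose time derivative is the second part of the parabolic divergence.
\<close>

lemma test_fun_time:
  assumes "0 < r" "cball x r \<subseteq> U" "closed_window t \<theta> r \<subseteq> J"
  shows "test_fun (U \<times> J) (\<lambda>z. (snd z - t) * (sbump x r (fst z) * tbump t \<theta> r (snd z)))"
  unfolding test_fun_def
proof (intro conjI allI)
  show "Ck k (\<lambda>z::'a \<times> real. (snd z - t) * (sbump x r (fst z) * tbump t \<theta> r (snd z)))" for k
    using Ck_mult[OF Ck_affine[OF bounded_linear_snd, of k 1 t]
       Ck_mult[OF Ck_sbump[OF bounded_linear_fst] Ck_tbump[OF bounded_linear_snd]], of x r t \<theta> r]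
    by simp
  show "compactly_in {z::'a \<times> real. (snd z - t) * (sbump x r (fst z) * tbump t \<theta> r (snd z)) \<noteq> 0} (U \<times> J)"
  proof (rule compactly_inI[of "cball x r \<times> closed_window t \<theta> r"])
    have "y \<in> cball x r" if "sbump x r y \<noteq> 0" for y using sbump_zero[OF assms(1), of y x] that by force
    moreover have "s \<in> closed_window t \<theta> r" if "tbump t \<theta> r s \<noteq> 0" for s
      using tbump_zero[OF assms(1), of s t \<theta>] that by (force simp: window_def closed_window_def)
    ultimately show "{z::'a \<times> real. (snd z - t) * (sbump x r (fst z) * tbump t \<theta> r (snd z)) \<noteq> 0} \<subseteq> cball x r \<times> closed_window t \<theta> r"
      by (auto simp: mem_Times_iff simp del: mem_cball)
  qed (use assms in \<open>auto simp: closed_window_def intro!: compact_Times\<close>)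
qed

lemma space_test_derivative:
  "frechet_derivative (\<lambda>y. ((y - x) \<bullet> b) * sbump x r y) (at y) b
     = (b \<bullet> b) * sbump x r y - 2 / r\<^sup>2 * dsbump x r y * ((y - x) \<bullet> b)\<^sup>2"
proof -
  have "((\<lambda>y. ((y - x) \<bullet> b) * sbump x r y) has_derivative
     (\<lambda>h. ((y - x) \<bullet> b) * (- 2 / r\<^sup>2 * dsbump x r y * ((y - x) \<bullet> h)) + (h \<bullet> b) * sbump x r y)) (at y)"
    by (auto intro!: derivative_eq_intros sbump_has_derivative)
  from frechet_derivative_at[OF this, symmetric] show ?thesis
    by (simp add: power2_eq_square mult_ac)
qed

lemma sum_space_test_derivative:
  fixes x :: "'a::euclidean_space"
  shows "(\<Sum>b\<in>Basis. frechet_derivative (\<lambda>y. ((y - x) \<bullet> b) * sbump x r y) (at y) b) = space_div x r y"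
proof -
  have "(y - x) \<bullet> (y - x) = (\<Sum>b\<in>Basis. ((y - x) \<bullet> b)\<^sup>2)"
    by (subst euclidean_inner) (simp add: power2_eq_square)
  then show ?thesis
    unfolding space_test_derivative space_div_def sum_subtractf
    by (simp add: sum_distrib_left sum_distrib_right sum_divide_distrib)
qed

lemma space_grad_time_test:
  "space_grad (\<lambda>z. (snd z - t) * (sbump x r (fst z) * tbump t \<theta> r (snd z))) (y, s)
    = ((s - t) * tbump t \<theta> r s * (- 2 / r\<^sup>2 * dsbump x r y)) *\<^sub>R (y - x)"
proof -
  have "((\<lambda>y. (s - t) * (sbump x r y * tbump t \<theta> r s)) has_derivative
     (\<lambda>h. (s - t) * tbump t \<theta> r s * (- 2 / r\<^sup>2 * dsbump x r y) * ((y - x) \<bullet> h))) (at y)"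
    by (auto intro!: derivative_eq_intros sbump_has_derivative)
  from frechet_derivative_at[OF this, symmetric] show ?thesis
    unfolding space_grad_def grad_def fst_conv snd_conv
    by (simp only: scaleR_scaleR[symmetric] scaleR_sum_right[symmetric] euclidean_representation)
qed

lemma time_deriv_time_test:
  "time_deriv (\<lambda>z. (snd z - t) * (sbump x r (fst z) * tbump t \<theta> r (snd z))) (y, s)
    = sbump x r y * time_div t \<theta> r s"
proof -
  have "((\<lambda>s. (s - t) * (sbump x r y * tbump t \<theta> r s)) has_real_derivative
     sbump x r y * time_div t \<theta> r s) (at s)"
    by (auto intro!: derivative_eq_intros tbump_DERIV simp: time_div_def divide_inverse algebra_simps)
  from DERIV_imp_deriv[OF this] show ?thesis by (simp add: time_deriv_def)
qed

section \<open>Test functions on space-time\<close>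

lemma test_fun_derivative:
  assumes "test_fun U \<phi>"
  shows "(\<phi> has_derivative frechet_derivative \<phi> (at x)) (at x)"
    "b \<in> Basis \<Longrightarrow> continuous_on UNIV (\<lambda>x. frechet_derivative \<phi> (at x) b)"
    "continuous_on UNIV \<phi>"
proof -
  have "Ck (Suc 0) \<phi>" "Ck 0 \<phi>" using assms by (auto simp: test_fun_def)
  then show "b \<in> Basis \<Longrightarrow> continuous_on UNIV (\<lambda>x. frechet_derivative \<phi> (at x) b)"
    "continuous_on UNIV \<phi>"
    by auto
  show "(\<phi> has_derivative frechet_derivative \<phi> (at x)) (at x)"
    by (rule Ck_Suc_derivative) fact
qed

lemma test_fun_zero:
  assumes "test_fun U \<phi>"
  shows "x \<notin> closure {x. \<phi> x \<noteq> 0} \<Longrightarrow> \<phi> x = 0"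
    "x \<notin> closure {x. \<phi> x \<noteq> 0} \<Longrightarrow> frechet_derivative \<phi> (at x) b = 0"
    "x \<notin> U \<Longrightarrow> x \<notin> closure {x. \<phi> x \<noteq> 0}"
proof -
  show "x \<notin> U \<Longrightarrow> x \<notin> closure {x. \<phi> x \<noteq> 0}"
    using assms by (auto simp: test_fun_def compactly_in_def)
  assume x: "x \<notin> closure {x. \<phi> x \<noteq> 0}"
  then show "\<phi> x = 0" using closure_subset[of "{x. \<phi> x \<noteq> 0}"] by blast
  have "(\<phi> has_derivative (\<lambda>_. 0)) (at x)"
    by (rule has_derivative_transform_within_open[of "\<lambda>_. 0" _ _ _ "- closure {x. \<phi> x \<noteq> 0}"])
       (use x closure_subset[of "{x. \<phi> x \<noteq> 0}"] in auto)
  from frechet_derivative_at[OF this] show "frechet_derivative \<phi> (at x) b = 0" by metis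
qed

lemma test_fun_bounded:
  assumes "test_fun U \<phi>"
  shows "\<exists>B. \<forall>x. \<bar>\<phi> x\<bar> \<le> B \<and> (\<forall>b\<in>Basis. \<bar>frechet_derivative \<phi> (at x) b\<bar> \<le> B)"
proof -
  let ?K = "closure {x. \<phi> x \<noteq> 0}"
  have K: "compact ?K" using assms by (auto simp: test_fun_def compactly_in_def)
  define f where "f x = \<bar>\<phi> x\<bar> + (\<Sum>b\<in>Basis. \<bar>frechet_derivative \<phi> (at x) b\<bar>)" for x
  have cf: "continuous_on UNIV f"
    unfolding f_def
    by (intro continuous_on_add continuous_on_rabs continuous_on_sum test_fun_derivative(2,3)[OF assms])
  have "bounded (f ` ?K)"
    by (rule compact_imp_bounded, rule compact_continuous_image[OF continuous_on_subset[OF cf subset_UNIV] K])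
  then obtain B where B: "\<And>x. x \<in> ?K \<Longrightarrow> \<bar>f x\<bar> \<le> B"
    unfolding bounded_iff ball_simps real_norm_def by blast
  have f0: "f x = 0" if "x \<notin> ?K" for x using test_fun_zero(1,2)[OF assms that] by (simp add: f_def)
  have fB: "f x \<le> \<bar>B\<bar>" for x using B[of x] f0[of x] by (cases "x \<in> ?K") auto
  have "\<bar>\<phi> x\<bar> \<le> f x" for x unfolding f_def by (simp add: sum_nonneg)
  moreover have "\<bar>frechet_derivative \<phi> (at x) b\<bar> \<le> f x" if "b \<in> Basis" for x b
    unfolding f_def using that member_le_sum[of b Basis "\<lambda>b. \<bar>frechet_derivative \<phi> (at x) b\<bar>"] by simp
  ultimately show ?thesis using fB by (meson order_trans)
qed

lemma time_deriv_eq: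
  assumes "test_fun D \<psi>"
  shows "time_deriv \<psi> z = frechet_derivative \<psi> (at z) (0, 1)"
proof -
  have "((\<lambda>t. \<psi> (fst z, t)) has_derivative (\<lambda>h. frechet_derivative \<psi> (at z) (0, h))) (at (snd z))"
    using has_derivative_compose[OF has_derivative_Pair[OF has_derivative_const has_derivative_ident],
        of \<psi> "frechet_derivative \<psi> (at z)" "fst z" "snd z" UNIV] test_fun_derivative(1)[OF assms, of z]
    by simp
  moreover have "(\<lambda>h. frechet_derivative \<psi> (at z) (0, h)) = (*) (frechet_derivative \<psi> (at z) (0, 1))"
  proof
    fix h :: real
    show "frechet_derivative \<psi> (at z) (0, h) = frechet_derivative \<psi> (at z) (0, 1) * h"
      using linear_scale[OF has_derivative_linear[OF test_fun_derivative(1)[OF assms, of z]], of h "(0, 1)"]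
      by (simp add: mult.commute)
  qed
  ultimately have "((\<lambda>t. \<psi> (fst z, t)) has_real_derivative frechet_derivative \<psi> (at z) (0, 1)) (at (snd z))"
    unfolding has_field_derivative_def by simp
  then show ?thesis by (simp add: time_deriv_def DERIV_imp_deriv)
qed

lemma space_grad_eq:
  assumes "test_fun D \<psi>"
  shows "space_grad \<psi> z = (\<Sum>b\<in>Basis. frechet_derivative \<psi> (at z) (b, 0) *\<^sub>R b)"
proof -
  have "((\<lambda>y. \<psi> (y, snd z)) has_derivative (\<lambda>h. frechet_derivative \<psi> (at z) (h, 0))) (at (fst z))"
    using has_derivative_compose[OF has_derivative_Pair[OF has_derivative_ident has_derivative_const],
        of \<psi> "frechet_derivative \<psi> (at z)" "fst z" "snd z" UNIV] test_fun_derivative(1)[OF assms, of z]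
    by simp
  from frechet_derivative_at[OF this, symmetric] show ?thesis
    by (simp add: space_grad_def grad_def)
qed

lemma test_fun_time_space_continuous:
  fixes \<psi> :: "'a::euclidean_space \<times> real \<Rightarrow> real"
  assumes "test_fun D \<psi>"
  shows "continuous_on UNIV (time_deriv \<psi>)" "continuous_on UNIV (space_grad \<psi>)"
proof -
  have "continuous_on UNIV (\<lambda>z. frechet_derivative \<psi> (at z) (0, 1))"
    by (rule test_fun_derivative(2)[OF assms]) (auto simp: Basis_prod_def)
  moreover have "time_deriv \<psi> = (\<lambda>z. frechet_derivative \<psi> (at z) (0, 1))"
    using time_deriv_eq[OF assms] by (rule ext)
  ultimately show "continuous_on UNIV (time_deriv \<psi>)" by (simp only:)
  have "continuous_on UNIV (\<lambda>z. frechet_derivative \<psi> (at z) (b, 0) *\<^sub>R b)" if "b \<in> Basis" for b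
    by (rule continuous_on_scaleR[OF test_fun_derivative(2)[OF assms] continuous_on_const])
       (use that in \<open>auto simp: Basis_prod_def\<close>)
  then have "continuous_on UNIV (\<lambda>z. \<Sum>b\<in>Basis. frechet_derivative \<psi> (at z) (b, 0) *\<^sub>R b)"
    by (rule continuous_on_sum)
  moreover have "space_grad \<psi> = (\<lambda>z. \<Sum>b\<in>Basis. frechet_derivative \<psi> (at z) (b, 0) *\<^sub>R b)"
    using space_grad_eq[OF assms] by (rule ext)
  ultimately show "continuous_on UNIV (space_grad \<psi>)" by (simp only:)
qed

lemma test_fun_time_space_zero:
  fixes \<psi> :: "'a::euclidean_space \<times> real \<Rightarrow> real"
  assumes "test_fun D \<psi>" "z \<notin> D"
  shows "time_deriv \<psi> z = 0" "space_grad \<psi> z = 0"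
proof -
  note zero = test_fun_zero(2)[OF assms(1) test_fun_zero(3)[OF assms]]
  show "time_deriv \<psi> z = 0" unfolding time_deriv_eq[OF assms(1)] by (rule zero)
  show "space_grad \<psi> z = 0" unfolding space_grad_eq[OF assms(1)] by (simp only: zero) simp
qed

lemma test_fun_time_space_bounded:
  fixes \<psi> :: "'a::euclidean_space \<times> real \<Rightarrow> real"
  assumes "test_fun D \<psi>"
  shows "\<exists>B. \<forall>z. \<bar>time_deriv \<psi> z\<bar> \<le> B \<and> norm (space_grad \<psi> z) \<le> B"
proof -
  obtain B where B: "\<And>z b. b \<in> Basis \<Longrightarrow> \<bar>frechet_derivative \<psi> (at z) b\<bar> \<le> B"
    using test_fun_bounded[OF assms] by blast
  have B0: "0 \<le> B" using B[of "(0, 1)" undefined] by (force simp: Basis_prod_def)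
  have "norm (space_grad \<psi> z) \<le> (\<Sum>b\<in>(Basis::'a set). B)" for z
    unfolding space_grad_eq[OF assms]
    by (rule order_trans[OF norm_sum sum_mono]) (use B in \<open>auto simp: Basis_prod_def\<close>)
  moreover have "\<bar>time_deriv \<psi> z\<bar> \<le> B" for z
    unfolding time_deriv_eq[OF assms] by (rule B) (auto simp: Basis_prod_def)
  moreover have "B \<le> (\<Sum>b\<in>(Basis::'a set). B)"
    using B0 DIM_positive[where 'a='a] by (simp add: mult_le_cancel_right1)
  ultimately show ?thesis by (meson order_trans)
qed

section \<open>Weak equations and the scale derivative of averages\<close>

text \<open>
  The difference quotients are dominated by \<open>C |v|\<close>, by the mean value theorem, so that dominated
  convergence applies.
\<close>

lemma has_real_derivative_under_integral:
  fixes v :: "'a \<Rightarrow> real" and K :: "real \<Rightarrow> 'a \<Rightarrow> real"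
  assumes v: "integrable M v" and \<sigma>: "\<sigma> \<in> {l<..<u}"
    and K: "\<And>\<tau>. \<tau> \<in> {l<..<u} \<Longrightarrow> K \<tau> \<in> borel_measurable M"
    and Kb: "\<And>\<tau> z. \<tau> \<in> {l<..<u} \<Longrightarrow> \<bar>K \<tau> z\<bar> \<le> B"
    and K': "K' \<sigma> \<in> borel_measurable M"
    and der: "\<And>\<tau> z. \<tau> \<in> {l<..<u} \<Longrightarrow> ((\<lambda>\<tau>. K \<tau> z) has_real_derivative K' \<tau> z) (at \<tau>)"
    and K'b: "\<And>\<tau> z. \<tau> \<in> {l<..<u} \<Longrightarrow> \<bar>K' \<tau> z\<bar> \<le> C"
  shows "((\<lambda>\<tau>. LINT z|M. v z * K \<tau> z) has_real_derivative (LINT z|M. v z * K' \<sigma> z)) (at \<sigma>)"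
proof -
  have [measurable]: "v \<in> borel_measurable M" using v by auto
  have int: "integrable M (\<lambda>z. v z * K \<tau> z)" if "\<tau> \<in> {l<..<u}" for \<tau>
  proof (rule Bochner_Integration.integrable_bound[of _ "\<lambda>z. v z * B"])
    show "(\<lambda>z. v z * K \<tau> z) \<in> borel_measurable M" using K[OF that] by measurable
    show "AE z in M. norm (v z * K \<tau> z) \<le> norm (v z * B)"
    proof (intro AE_I2)
      fix z
      have "\<bar>K \<tau> z\<bar> \<le> \<bar>B\<bar>" using Kb[OF that, of z] by linarith
      then show "norm (v z * K \<tau> z) \<le> norm (v z * B)" by (simp add: abs_mult mult_left_mono)
    qed
  qed (use v in auto)
  have lip: "\<bar>K \<tau> z - K \<sigma> z\<bar> \<le> C * \<bar>\<tau> - \<sigma>\<bar>" if "\<tau> \<in> {l<..<u}" for \<tau> z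
  proof -
    have "norm (K \<tau> z - K \<sigma> z) \<le> C * norm (\<tau> - \<sigma>)"
    proof (rule field_differentiable_bound[of "{l<..<u}"])
      show "((\<lambda>\<tau>. K \<tau> z) has_real_derivative K' \<tau> z) (at \<tau> within {l<..<u})" if "\<tau> \<in> {l<..<u}" for \<tau>
        using der[OF that] by (rule DERIV_subset) simp
    qed (use K'b that \<sigma> in auto)
    then show ?thesis by simp
  qed
  have "((\<lambda>\<tau>. ((LINT z|M. v z * K \<tau> z) - (LINT z|M. v z * K \<sigma> z)) / (\<tau> - \<sigma>))
       \<longlongrightarrow> (LINT z|M. v z * K' \<sigma> z)) (at \<sigma> within {l<..<u})"
    unfolding tendsto_at_iff_sequentially comp_def
  proof (intro allI impI)
    fix X :: "nat \<Rightarrow> real"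
    assume X: "\<forall>i. X i \<in> {l<..<u} - {\<sigma>}" "X \<longlonglongrightarrow> \<sigma>"
    have eq: "((LINT z|M. v z * K (X i) z) - (LINT z|M. v z * K \<sigma> z)) / (X i - \<sigma>)
       = (LINT z|M. v z * ((K (X i) z - K \<sigma> z) / (X i - \<sigma>)))" for i
    proof -
      have Xi: "X i \<in> {l<..<u}" using X by blast
      have "((LINT z|M. v z * K (X i) z) - (LINT z|M. v z * K \<sigma> z)) / (X i - \<sigma>)
        = (LINT z|M. (v z * K (X i) z - v z * K \<sigma> z) / (X i - \<sigma>))"
        using int[OF Xi] int[OF \<sigma>] by simp
      then show ?thesis by (simp add: right_diff_distrib)
    qed
    show "(\<lambda>i. ((LINT z|M. v z * K (X i) z) - (LINT z|M. v z * K \<sigma> z)) / (X i - \<sigma>)) \<longlonglongrightarrow> (LINT z|M. v z * K' \<sigma> z)"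
      unfolding eq
    proof (rule integral_dominated_convergence[where w="\<lambda>z. \<bar>v z\<bar> * C"])
      show "(\<lambda>z. v z * K' \<sigma> z) \<in> borel_measurable M" using K' by measurable
      show "(\<lambda>z. v z * ((K (X i) z - K \<sigma> z) / (X i - \<sigma>))) \<in> borel_measurable M" for i
      proof -
        have Xi: "X i \<in> {l<..<u}" using X by blast
        show ?thesis using K[OF Xi] K[OF \<sigma>] by measurable
      qed
      show "integrable M (\<lambda>z. \<bar>v z\<bar> * C)" using v by auto
      show "AE z in M. (\<lambda>i. v z * ((K (X i) z - K \<sigma> z) / (X i - \<sigma>))) \<longlonglongrightarrow> v z * K' \<sigma> z"
      proof (intro AE_I2 tendsto_mult_left)
        fix z
        have "((\<lambda>\<tau>. (K \<tau> z - K \<sigma> z) / (\<tau> - \<sigma>)) \<longlongrightarrow> K' \<sigma> z) (at \<sigma> within {l<..<u})"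
          using has_field_derivative_at_within[OF der[OF \<sigma>, of z], of "{l<..<u}"] by (simp add: has_field_derivative_iff)
        then show "(\<lambda>i. (K (X i) z - K \<sigma> z) / (X i - \<sigma>)) \<longlonglongrightarrow> K' \<sigma> z"
          using X unfolding tendsto_at_iff_sequentially comp_def by blast
      qed
      show "AE z in M. norm (v z * ((K (X i) z - K \<sigma> z) / (X i - \<sigma>))) \<le> \<bar>v z\<bar> * C" for i
      proof (intro AE_I2)
        fix z
        have "X i \<in> {l<..<u}" "X i \<noteq> \<sigma>" using X by blast+
        then have "\<bar>(K (X i) z - K \<sigma> z) / (X i - \<sigma>)\<bar> \<le> C"
          using lip[of "X i" z] by (simp add: abs_divide divide_le_eq)
        then show "norm (v z * ((K (X i) z - K \<sigma> z) / (X i - \<sigma>))) \<le> \<bar>v z\<bar> * C"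
          by (simp only: real_norm_def abs_mult mult_left_mono abs_ge_zero)
      qed
    qed
  qed
  then show ?thesis
    using \<sigma> by (simp add: has_field_derivative_iff at_within_open[OF _ open_greaterThanLessThan])
qed

text \<open>
  \<open>G\<close> is the weak spatial gradient of \<open>v\<close>, tested against products \<open>\<phi>(x) \<beta>(t)\<close>. A function that has
  a weak gradient on almost every time slice admits every bounded continuous \<open>\<beta>\<close>, as slices are
  merely integrated in time.
\<close>

definition space_weak :: "'a::euclidean_space set \<Rightarrow> ('a \<times> real \<Rightarrow> real) \<Rightarrow> ('a \<times> real \<Rightarrow> 'a) \<Rightarrow> bool" where
  "space_weak U v G \<longleftrightarrow> (\<forall>\<phi> \<beta> b. test_fun U \<phi> \<and> b \<in> Basis \<and> continuous_on UNIV \<beta> \<and> bounded (range \<beta>) \<longrightarrow>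
     (LINT z|lborel. v z * (frechet_derivative \<phi> (at (fst z)) b * \<beta> (snd z)))
       = - (LINT z|lborel. (G z \<bullet> b) * (\<phi> (fst z) * \<beta> (snd z))))"

text \<open>
  The weak form of \<open>v_t = div H\<close>.
\<close>

definition time_weak :: "('a::euclidean_space \<times> real) set \<Rightarrow> ('a \<times> real \<Rightarrow> real) \<Rightarrow> ('a \<times> real \<Rightarrow> 'a) \<Rightarrow> bool" where
  "time_weak D v H \<longleftrightarrow> (\<forall>\<psi>. test_fun D \<psi> \<longrightarrow>
     (LINT z|lborel. v z * time_deriv \<psi> z) = (LINT z|lborel. H z \<bullet> space_grad \<psi> z))"

text \<open>
  Not normalised: the averages tend to \<open>kernel_mass \<cdot> v\<close>.
\<close>

definition avg :: "('a::euclidean_space \<times> real \<Rightarrow> real) \<Rightarrow> 'a \<Rightarrow> real \<Rightarrow> real \<Rightarrow> real \<Rightarrow> real" where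
  "avg v x t \<theta> r = (LINT z|lborel. v z * kernel x t \<theta> r z)"

lemma integrable_mult_bounded:
  fixes v K :: "'a \<Rightarrow> real"
  assumes v: "integrable M v" and "K \<in> borel_measurable M" "\<And>z. \<bar>K z\<bar> \<le> B"
  shows "integrable M (\<lambda>z. v z * K z)"
proof (rule Bochner_Integration.integrable_bound[of _ "\<lambda>z. v z * B"])
  show "(\<lambda>z. v z * K z) \<in> borel_measurable M" using assms by measurable
  show "AE z in M. norm (v z * K z) \<le> norm (v z * B)"
  proof (intro AE_I2)
    fix z
    have "\<bar>K z\<bar> \<le> \<bar>B\<bar>" using assms(3)[of z] by linarith
    then show "norm (v z * K z) \<le> norm (v z * B)" by (simp add: abs_mult mult_left_mono)
  qed
qed (use v in auto)

lemma bump_measurable: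
  assumes "0 < r"
  shows "(\<lambda>z::'a::euclidean_space \<times> real. sbump x r (fst z)) \<in> borel_measurable borel"
    "(\<lambda>z::'a::euclidean_space \<times> real. dsbump x r (fst z)) \<in> borel_measurable borel"
    "(\<lambda>z::'a::euclidean_space \<times> real. tbump t \<theta> r (snd z)) \<in> borel_measurable borel"
    "(\<lambda>z::'a::euclidean_space \<times> real. dtbump t \<theta> r (snd z)) \<in> borel_measurable borel"
  using assms
  by (auto intro!: borel_measurable_continuous_onI continuous_on_bumps continuous_on_tbumps continuous_intros)

lemma fst_snd_borel: "fst \<in> borel \<rightarrow>\<^sub>M (borel :: 'a::euclidean_space measure)"
  "snd \<in> (borel :: ('a \<times> real) measure) \<rightarrow>\<^sub>M (borel :: real measure)"
  by (auto intro!: borel_measurable_continuous_onI continuous_intros)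

lemma div_measurable:
  assumes "0 < r"
  shows "(\<lambda>z::'a::euclidean_space \<times> real. space_div x r (fst z)) \<in> borel_measurable borel"
    "(\<lambda>z::'a::euclidean_space \<times> real. time_div t \<theta> r (snd z)) \<in> borel_measurable borel"
    "(\<lambda>z::'a::euclidean_space \<times> real. kernel x t \<theta> r z) \<in> borel_measurable borel"
    "(\<lambda>z::'a::euclidean_space \<times> real. dkernel x t \<theta> r z) \<in> borel_measurable borel"
proof -
  note [measurable] = bump_measurable[OF assms] fst_snd_borel
  show [measurable]: "(\<lambda>z::'a::euclidean_space \<times> real. space_div x r (fst z)) \<in> borel_measurable borel"
    "(\<lambda>z::'a::euclidean_space \<times> real. time_div t \<theta> r (snd z)) \<in> borel_measurable borel"
    unfolding space_div_def time_div_def by measurable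
  show "(\<lambda>z::'a::euclidean_space \<times> real. kernel x t \<theta> r z) \<in> borel_measurable borel"
    "(\<lambda>z::'a::euclidean_space \<times> real. dkernel x t \<theta> r z) \<in> borel_measurable borel"
    unfolding kernel_def dkernel_def by measurable
qed

lemma avg_DERIV:
  fixes v :: "'a::euclidean_space \<times> real \<Rightarrow> real"
  assumes v: "integrable lborel v" and r: "0 < r" and \<theta>: "\<bar>\<theta>\<bar> \<le> 1"
  shows "((\<lambda>r. avg v x t \<theta> r) has_real_derivative (LINT z|lborel. v z * dkernel x t \<theta> r z)) (at r)"
  unfolding avg_def
proof (rule has_real_derivative_under_integral[where l="r/2" and u="2*r"])
  show "kernel x t \<theta> \<tau> \<in> borel_measurable lborel" if "\<tau> \<in> {r/2<..<2*r}" for \<tau>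
    using div_measurable(3)[of \<tau> x t \<theta>] that r by simp
  show "dkernel x t \<theta> r \<in> borel_measurable lborel" 
    using div_measurable(4)[of r x t \<theta>] r by simp
  show "\<bar>kernel x t \<theta> \<tau> z\<bar> \<le> 1 / (r / 2) ^ (DIM('a) + 2)" if "\<tau> \<in> {r/2<..<2*r}" for \<tau> z
  proof -
    have "1 / \<tau> ^ (DIM('a) + 2) \<le> 1 / (r / 2) ^ (DIM('a) + 2)"
      using that r by (intro divide_left_mono power_mono mult_pos_pos zero_less_power) auto
    then show ?thesis
      using kernel_bound[of \<tau> x t \<theta> z] that r by auto
  qed
  show "\<bar>dkernel x t \<theta> \<tau> z\<bar> \<le> (real DIM('a) + 22) / (r / 2) ^ (DIM('a) + 3)" if "\<tau> \<in> {r/2<..<2*r}" for \<tau> z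
  proof -
    have "(real DIM('a) + 22) / \<tau> ^ (DIM('a) + 3) \<le> (real DIM('a) + 22) / (r / 2) ^ (DIM('a) + 3)"
      using that r by (intro divide_left_mono power_mono mult_pos_pos zero_less_power) auto
    then show ?thesis
      using dkernel_bound[of \<tau> \<theta> x t z] that r \<theta> by auto
  qed
qed (use v r in \<open>auto intro!: kernel_DERIV\<close>)

definition cyl :: "'a::euclidean_space \<Rightarrow> real \<Rightarrow> real \<Rightarrow> real \<Rightarrow> ('a \<times> real) set" where
  "cyl x t \<theta> r = ball x r \<times> window t \<theta> r"

lemma cyl_measurable [measurable]: "cyl x t \<theta> r \<in> sets borel"
  unfolding cyl_def window_def by (intro borel_open open_Times) auto

lemma integrable_cyl:
  fixes h :: "'a::euclidean_space \<times> real \<Rightarrow> real"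
  shows "integrable lborel h \<Longrightarrow> integrable lborel (\<lambda>z. indicator (cyl x t \<theta> r) z * h z)"
  using integrable_mult_bounded[of lborel h "indicator (cyl x t \<theta> r)" 1]
  by (simp add: mult.commute indicator_def)

lemma integral_cyl_bound:
  fixes f h :: "'a::euclidean_space \<times> real \<Rightarrow> real"
  assumes h: "integrable lborel h" and f: "AE z in lborel. \<bar>f z\<bar> \<le> c * (indicator (cyl x t \<theta> r) z * h z)"
  shows "\<bar>LINT z|lborel. f z\<bar> \<le> c * (LINT z|lborel. indicator (cyl x t \<theta> r) z * h z)"
proof -
  have "\<bar>LINT z|lborel. f z\<bar> \<le> (LINT z|lborel. c * (indicator (cyl x t \<theta> r) z * h z))"
  proof (rule order_trans[OF integral_abs_bound], rule integral_mono_AE')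
    show "AE z in lborel. 0 \<le> c * (indicator (cyl x t \<theta> r) z * h z)"
      using f by eventually_elim (rule order_trans[OF abs_ge_zero])
  qed (use f integrable_cyl[OF h] in auto)
  then show ?thesis by simp
qed

text \<open>
  The divergence theorem for \<open>(y - x) K\<close> against \<open>v\<close>: sum over the basis of the weak partial
  derivatives, each tested with one component of the field.
\<close>

lemma space_weak_bump:
  fixes v :: "'a::euclidean_space \<times> real \<Rightarrow> real"
  assumes v: "integrable lborel v" and G: "integrable lborel G"
    and sw: "space_weak U v G" and r: "0 < r" and U: "cball x r \<subseteq> U"
  shows "(LINT z|lborel. v z * (space_div x r (fst z) * tbump t \<theta> r (snd z)))
    = - (LINT z|lborel. (G z \<bullet> (fst z - x)) * (sbump x r (fst z) * tbump t \<theta> r (snd z)))"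
proof -
  note [measurable] = bump_measurable[OF r] fst_snd_borel
  let ?\<phi> = "\<lambda>b y. ((y - x) \<bullet> b) * sbump x r y" and ?b = "\<lambda>z::'a \<times> real. tbump t \<theta> r (snd z)"
  let ?d = "\<lambda>b z. frechet_derivative (?\<phi> b) (at (fst z)) b"
  have test: "test_fun U (?\<phi> b)" for b by (rule test_fun_space[OF r U])
  have \<beta>: "continuous_on UNIV (tbump t \<theta> r)" "bounded (range (tbump t \<theta> r))"
    using continuous_on_tbumps(1)[of UNIV "\<lambda>_. t" "\<lambda>s. s" "\<lambda>_. r" "\<lambda>_. \<theta>"] r bump_bounds(5,6)[of t \<theta> r]
    by (auto intro!: boundedI[of _ 1])
  have each: "(LINT z|lborel. v z * (?d b z * ?b z)) = - (LINT z|lborel. (G z \<bullet> b) * (?\<phi> b (fst z) * ?b z))"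
    and int1: "integrable lborel (\<lambda>z. v z * (?d b z * ?b z))"
    and int2: "integrable lborel (\<lambda>z. (G z \<bullet> b) * (?\<phi> b (fst z) * ?b z))" if b: "b \<in> Basis" for b
  proof -
    obtain B where B: "\<And>y. \<bar>?\<phi> b y\<bar> \<le> B" "\<And>y. \<bar>frechet_derivative (?\<phi> b) (at y) b\<bar> \<le> B"
      using test_fun_bounded[OF test, of b] b by blast
    have b1: "\<bar>?b z\<bar> \<le> 1" for z using bump_bounds(5,6)[of t \<theta> r "snd z"] by simp
    have "\<bar>?d b z * ?b z\<bar> \<le> B * 1" "\<bar>?\<phi> b (fst z) * ?b z\<bar> \<le> B * 1" for z
      unfolding abs_mult[of _ "?b z"] using B[of "fst z"] b1[of z] by (fastforce intro: mult_mono)+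
    then show "integrable lborel (\<lambda>z. v z * (?d b z * ?b z))"
      "integrable lborel (\<lambda>z. (G z \<bullet> b) * (?\<phi> b (fst z) * ?b z))"
      unfolding space_test_derivative using v G
      by (auto intro!: integrable_mult_bounded[of _ _ _ "B * 1"])
    show "(LINT z|lborel. v z * (?d b z * ?b z)) = - (LINT z|lborel. (G z \<bullet> b) * (?\<phi> b (fst z) * ?b z))"
      using sw \<beta> b test[of b] unfolding space_weak_def by blast
  qed
  have "(LINT z|lborel. v z * (space_div x r (fst z) * ?b z)) = (LINT z|lborel. (\<Sum>b\<in>Basis. v z * (?d b z * ?b z)))"
    unfolding sum_distrib_left[symmetric] sum_distrib_right[symmetric] sum_space_test_derivative ..
  also have "\<dots> = - (LINT z|lborel. (\<Sum>b\<in>Basis. (G z \<bullet> b) * (?\<phi> b (fst z) * ?b z)))"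
    using int1 int2 each by (simp add: sum_negf)
  also have "(\<lambda>z. (\<Sum>b\<in>Basis. (G z \<bullet> b) * (?\<phi> b (fst z) * ?b z))) = (\<lambda>z. (G z \<bullet> (fst z - x)) * (sbump x r (fst z) * ?b z))"
    unfolding euclidean_inner[of "G _" "fst _ - x"] sum_distrib_right by (simp add: mult_ac)
  finally show ?thesis .
qed

lemma time_weak_bump:
  fixes v :: "'a::euclidean_space \<times> real \<Rightarrow> real"
  assumes tw: "time_weak (U \<times> J) v H" and r: "0 < r" and U: "cball x r \<subseteq> U" and J: "closed_window t \<theta> r \<subseteq> J"
  shows "(LINT z|lborel. v z * (sbump x r (fst z) * time_div t \<theta> r (snd z)))
    = (LINT z|lborel. H z \<bullet> (((snd z - t) * tbump t \<theta> r (snd z) * (- 2 / r\<^sup>2 * dsbump x r (fst z))) *\<^sub>R (fst z - x)))"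
proof -
  let ?\<psi> = "\<lambda>z. (snd z - t) * (sbump x r (fst z) * tbump t \<theta> r (snd z))"
  have "(LINT z|lborel. v z * time_deriv ?\<psi> z) = (LINT z|lborel. H z \<bullet> space_grad ?\<psi> z)"
    using tw test_fun_time[OF r U J] unfolding time_weak_def by blast
  moreover have "time_deriv ?\<psi> z = sbump x r (fst z) * time_div t \<theta> r (snd z)" for z
    using time_deriv_time_test[of t x r \<theta> "fst z" "snd z"] by simp
  moreover have "space_grad ?\<psi> z
     = ((snd z - t) * tbump t \<theta> r (snd z) * (- 2 / r\<^sup>2 * dsbump x r (fst z))) *\<^sub>R (fst z - x)" for z
    using space_grad_time_test[of t x r \<theta> "fst z" "snd z"] by simp
  ultimately show ?thesis by simp
qed

text \<open>
  By the divergence form of \<open>dkernel\<close>, the integral is \<open>G\<close> against \<open>(y - x) K\<close> plus twice \<open>H\<close> against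
  \<open>\<nabla>((s - t) K)\<close>, over \<open>r^(n+3)\<close>. On the support \<open>|y - x| \<le> r\<close> and \<open>|s - t| \<le> 2 r^2\<close>, so both vector
  fields are of size \<open>r\<close>. The constant \<open>16\<close> is \<open>2 \<cdot> 2 \<cdot> 2 \<cdot> 2\<close>: the weight \<open>2\<close> of the time part, the \<open>2\<close>
  from differentiating \<open>|y - x|^2\<close>, the bound \<open>2\<close> on \<open>dsbump\<close> and the bound \<open>2\<close> on \<open>|s - t| / r^2\<close>.
\<close>

lemma weak_derivative_bound:
  fixes v :: "'a::euclidean_space \<times> real \<Rightarrow> real"
  assumes v: "integrable lborel v" and G: "integrable lborel G" and H: "integrable lborel H"
    and h: "integrable lborel h" and Gh: "AE z in lborel. norm (G z) \<le> h z" and Hh: "AE z in lborel. norm (H z) \<le> \<Lambda> * h z"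
    and sw: "space_weak U v G" and tw: "time_weak (U \<times> J) v H" and \<Lambda>: "0 \<le> \<Lambda>"
    and r: "0 < r" and \<theta>: "\<bar>\<theta>\<bar> \<le> 1" and U: "cball x r \<subseteq> U" and J: "closed_window t \<theta> r \<subseteq> J"
  shows "\<bar>LINT z|lborel. v z * dkernel x t \<theta> r z\<bar>
     \<le> (1 + 16 * \<Lambda>) / r ^ (DIM('a) + 2) * (LINT z|lborel. indicator (cyl x t \<theta> r) z * h z)"
proof -
  note [measurable] = bump_measurable[OF r] fst_snd_borel div_measurable[OF r]
  let ?a = "\<lambda>z::'a \<times> real. sbump x r (fst z)" and ?a' = "\<lambda>z::'a \<times> real. dsbump x r (fst z)"
  let ?b = "\<lambda>z::'a \<times> real. tbump t \<theta> r (snd z)"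
  let ?S = "\<lambda>z::'a \<times> real. space_div x r (fst z)" and ?T = "\<lambda>z::'a \<times> real. time_div t \<theta> r (snd z)"
  let ?I = "LINT z|lborel. indicator (cyl x t \<theta> r) z * h z"
  have ab: "\<bar>?a z\<bar> \<le> 1" "\<bar>?a' z\<bar> \<le> 2" "\<bar>?b z\<bar> \<le> 1" for z
    using bump_bounds(1-4)[of x r "fst z"] bump_bounds(5,6)[of t \<theta> r "snd z"] by auto
  have intS: "integrable lborel (\<lambda>z. v z * (?S z * ?b z))"
  proof (rule integrable_mult_bounded[OF v, of _ "(real DIM('a) + 4) * 1"])
    show "\<bar>?S z * ?b z\<bar> \<le> (real DIM('a) + 4) * 1" for z
      unfolding abs_mult by (intro mult_mono space_div_bound r ab) auto
  qed measurable
  have intT: "integrable lborel (\<lambda>z. v z * (?a z * ?T z))"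
  proof (rule integrable_mult_bounded[OF v, of _ "1 * 9"])
    show "\<bar>?a z * ?T z\<bar> \<le> 1 * 9" for z
      unfolding abs_mult by (intro mult_mono time_div_bound r \<theta> ab) auto
  qed measurable
  have near: "norm (fst z - x) \<le> r" "\<bar>(snd z - t) / r\<^sup>2\<bar> \<le> 2" if "z \<in> cyl x t \<theta> r" for z
    using that window_dist[OF _ \<theta>, of "snd z" t r] r
    by (auto simp: cyl_def mem_Times_iff dist_norm norm_minus_commute abs_divide divide_le_eq)
  have off: "?a z * ?b z = 0 \<and> ?a' z * ?b z = 0" if "z \<notin> cyl x t \<theta> r" for z
    using that r by (auto simp: cyl_def mem_Times_iff sbump_zero dsbump_zero tbump_zero simp del: mem_ball)
  have 1: "\<bar>LINT z|lborel. (G z \<bullet> (fst z - x)) * (?a z * ?b z)\<bar> \<le> r * ?I"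
  proof (rule integral_cyl_bound[OF h])
    show "AE z in lborel. \<bar>(G z \<bullet> (fst z - x)) * (?a z * ?b z)\<bar> \<le> r * (indicator (cyl x t \<theta> r) z * h z)"
      using Gh
    proof eventually_elim
      case (elim z)
      show ?case
      proof (cases "z \<in> cyl x t \<theta> r")
        case True
        have "\<bar>G z \<bullet> (fst z - x)\<bar> \<le> h z * r"
          using elim r near(1)[OF True] by (intro order_trans[OF Cauchy_Schwarz_ineq2] mult_mono) (auto intro: order_trans[OF norm_ge_zero])
        moreover have "\<bar>?a z * ?b z\<bar> \<le> 1 * 1" unfolding abs_mult using ab by (intro mult_mono) auto
        ultimately have "\<bar>G z \<bullet> (fst z - x)\<bar> * \<bar>?a z * ?b z\<bar> \<le> (h z * r) * 1"
          by (intro mult_mono) auto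
        then show ?thesis using True by (simp add: abs_mult mult_ac)
      qed (simp add: off)
    qed
  qed
  have 2: "\<bar>LINT z|lborel. H z \<bullet> (((snd z - t) * ?b z * (- 2 / r\<^sup>2 * ?a' z)) *\<^sub>R (fst z - x))\<bar> \<le> (8 * \<Lambda> * r) * ?I"
  proof (rule integral_cyl_bound[OF h])
    show "AE z in lborel. \<bar>H z \<bullet> (((snd z - t) * ?b z * (- 2 / r\<^sup>2 * ?a' z)) *\<^sub>R (fst z - x))\<bar>
       \<le> (8 * \<Lambda> * r) * (indicator (cyl x t \<theta> r) z * h z)"
      using Hh
    proof eventually_elim
      case (elim z)
      have eq: "\<bar>H z \<bullet> (((snd z - t) * ?b z * (- 2 / r\<^sup>2 * ?a' z)) *\<^sub>R (fst z - x))\<bar>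
         = 2 * (\<bar>(snd z - t) / r\<^sup>2\<bar> * \<bar>?a' z * ?b z\<bar> * \<bar>H z \<bullet> (fst z - x)\<bar>)"
        by (simp add: abs_mult)
      show ?case
      proof (cases "z \<in> cyl x t \<theta> r")
        case True
        have "\<bar>H z \<bullet> (fst z - x)\<bar> \<le> (\<Lambda> * h z) * r"
          using elim r near(1)[OF True] by (intro order_trans[OF Cauchy_Schwarz_ineq2] mult_mono) (auto intro: order_trans[OF norm_ge_zero])
        moreover have "\<bar>?a' z * ?b z\<bar> \<le> 2 * 1" unfolding abs_mult using ab by (intro mult_mono) auto
        ultimately have "\<bar>(snd z - t) / r\<^sup>2\<bar> * \<bar>?a' z * ?b z\<bar> * \<bar>H z \<bullet> (fst z - x)\<bar> \<le> (2 * (2 * 1)) * ((\<Lambda> * h z) * r)"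
          using near(2)[OF True] by (intro mult_mono) auto
        then show ?thesis unfolding eq using True by (simp add: mult_ac)
      next
        case False
        have "?a' z * ?b z = 0" using off[OF False] by blast
        then have z0: "2 * (\<bar>(snd z - t) / r\<^sup>2\<bar> * \<bar>?a' z * ?b z\<bar> * \<bar>H z \<bullet> (fst z - x)\<bar>) = 0"
          by (simp only: abs_zero mult_zero_left mult_zero_right)
        show ?thesis unfolding eq z0 using False by simp
      qed
    qed
  qed
  have eq: "(LINT z|lborel. v z * dkernel x t \<theta> r z)
    = - ((LINT z|lborel. v z * (?S z * ?b z)) + 2 * (LINT z|lborel. v z * (?a z * ?T z))) / r ^ (DIM('a) + 3)"
  proof -
    have "(LINT z|lborel. v z * dkernel x t \<theta> r z)
      = (LINT z|lborel. - (v z * (?S z * ?b z) + 2 * (v z * (?a z * ?T z))) / r ^ (DIM('a) + 3))"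
      unfolding dkernel_def by (intro Bochner_Integration.integral_cong) (auto simp: field_simps)
    then show ?thesis using intS intT by simp
  qed
  have aux: "\<bar>- (- p + 2 * q) / R\<bar> \<le> (a + 2 * b) / R" if "\<bar>p\<bar> \<le> a" "\<bar>q\<bar> \<le> b" "0 < R" for p q a b R :: real
  proof -
    have "\<bar>- (- p + 2 * q)\<bar> \<le> a + 2 * b" using that by linarith
    then show ?thesis using that(3) by (simp only: abs_divide divide_right_mono abs_of_pos less_imp_le)
  qed
  have "0 < r ^ (DIM('a) + 3)" using r by simp
  from aux[OF 1 2 this] have "\<bar>LINT z|lborel. v z * dkernel x t \<theta> r z\<bar> \<le> (r * ?I + 2 * ((8 * \<Lambda> * r) * ?I)) / r ^ (DIM('a) + 3)"
    unfolding eq space_weak_bump[OF v G sw r U] time_weak_bump[OF tw r U J] .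
  also have "\<dots> = (1 + 16 * \<Lambda>) / r ^ (DIM('a) + 2) * ?I"
    using r by (simp add: field_simps power_add power2_eq_square power3_eq_cube)
  finally show ?thesis .
qed

lemma window_mono: "0 \<le> r \<Longrightarrow> r \<le> r' \<Longrightarrow> \<bar>\<theta>\<bar> \<le> 1 \<Longrightarrow> window t \<theta> r \<subseteq> window t \<theta> r'"
  and closed_window_mono: "0 \<le> r \<Longrightarrow> r \<le> r' \<Longrightarrow> \<bar>\<theta>\<bar> \<le> 1 \<Longrightarrow> closed_window t \<theta> r \<subseteq> closed_window t \<theta> r'"
proof -
  assume "0 \<le> r" "r \<le> r'" "\<bar>\<theta>\<bar> \<le> 1"
  then have "r\<^sup>2 \<le> r'\<^sup>2" by (intro power_mono)
  then have "r\<^sup>2 * (1 - \<theta>) \<le> r'\<^sup>2 * (1 - \<theta>)" "r\<^sup>2 * (\<theta> + 1) \<le> r'\<^sup>2 * (\<theta> + 1)"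
    using \<open>\<bar>\<theta>\<bar> \<le> 1\<close> by (intro mult_right_mono; simp)+
  then show "window t \<theta> r \<subseteq> window t \<theta> r'" "closed_window t \<theta> r \<subseteq> closed_window t \<theta> r'"
    by (auto simp: window_def closed_window_def algebra_simps)
qed

lemma cyl_mono: "0 \<le> r \<Longrightarrow> r \<le> r' \<Longrightarrow> \<bar>\<theta>\<bar> \<le> 1 \<Longrightarrow> cyl x t \<theta> r \<subseteq> cyl x t \<theta> r'"
  unfolding cyl_def by (intro Sigma_mono window_mono subset_ball) auto

lemma emeasure_cyl:
  fixes x :: "'a::euclidean_space"
  assumes "0 < r"
  shows "emeasure lborel (cyl x t \<theta> r) = ennreal (2 * unit_ball_vol DIM('a) * r ^ (DIM('a) + 2))"
proof -
  have "emeasure lborel (cyl x t \<theta> r) = emeasure lborel (ball x r) * emeasure lborel (window t \<theta> r)"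
    unfolding cyl_def by (subst lborel_prod[symmetric], subst lborel.emeasure_pair_measure_Times)
      (auto simp: window_def)
  also have "emeasure lborel (window t \<theta> r) = ennreal (2 * r\<^sup>2)"
    unfolding window_def using assms by (subst emeasure_lborel_Ioo) (auto simp: algebra_simps)
  also have "emeasure lborel (ball x r) = ennreal (unit_ball_vol DIM('a) * r ^ DIM('a))"
    using assms by (simp add: emeasure_ball)
  finally show ?thesis
    using assms by (simp add: ennreal_mult'[symmetric] power_add power2_eq_square mult_ac)
qed

text \<open>
  The mean value theorem between \<open>r/2\<close> and \<open>r\<close>, and monotonicity of the cylinders. With \<open>h\<close> averaged
  over the cylinder of volume about \<open>r^(n+2)\<close>, the right-hand side is of order \<open>r\<close> times a mean of
  \<open>h\<close>.
\<close>

lemma avg_step: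
  fixes v :: "'a::euclidean_space \<times> real \<Rightarrow> real"
  assumes v: "integrable lborel v" and G: "integrable lborel G" and H: "integrable lborel H"
    and h: "integrable lborel h" and Gh: "AE z in lborel. norm (G z) \<le> h z" and Hh: "AE z in lborel. norm (H z) \<le> \<Lambda> * h z"
    and sw: "space_weak U v G" and tw: "time_weak (U \<times> J) v H" and \<Lambda>: "0 \<le> \<Lambda>"
    and r: "0 < r" and \<theta>: "\<bar>\<theta>\<bar> \<le> 1" and U: "cball x r \<subseteq> U" and J: "closed_window t \<theta> r \<subseteq> J"
  shows "\<bar>avg v x t \<theta> r - avg v x t \<theta> (r / 2)\<bar>
     \<le> (1 + 16 * \<Lambda>) * 2 ^ (DIM('a) + 1) / r ^ (DIM('a) + 1) * (LINT z|lborel. indicator (cyl x t \<theta> r) z * h z)"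
proof -
  let ?I = "\<lambda>r. LINT z|lborel. indicator (cyl x t \<theta> r) z * h z"
  have "\<exists>\<tau>>r/2. \<tau> < r \<and> avg v x t \<theta> r - avg v x t \<theta> (r / 2)
      = (r - r / 2) * (LINT z|lborel. v z * dkernel x t \<theta> \<tau> z)"
    by (rule MVT2) (use r in \<open>auto intro!: avg_DERIV v \<theta>\<close>)
  then obtain \<tau> where \<tau>: "r / 2 < \<tau>" "\<tau> < r"
    "avg v x t \<theta> r - avg v x t \<theta> (r / 2) = r / 2 * (LINT z|lborel. v z * dkernel x t \<theta> \<tau> z)" by auto
  have hnn: "AE z in lborel. 0 \<le> h z" using Gh by eventually_elim (use norm_ge_zero order_trans in blast)
  note intI = integrable_cyl[OF h]
  have "\<bar>LINT z|lborel. v z * dkernel x t \<theta> \<tau> z\<bar> \<le> (1 + 16 * \<Lambda>) / \<tau> ^ (DIM('a) + 2) * ?I \<tau>"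
  proof (rule weak_derivative_bound[OF v G H h Gh Hh sw tw \<Lambda>])
    show "cball x \<tau> \<subseteq> U" using U \<tau> by (meson less_imp_le order_trans subset_cball)
    show "closed_window t \<theta> \<tau> \<subseteq> J" using J closed_window_mono[of \<tau> r \<theta> t] \<tau> r \<theta> by auto
  qed (use r \<tau> \<theta> in auto)
  also have "\<dots> \<le> (1 + 16 * \<Lambda>) / (r / 2) ^ (DIM('a) + 2) * ?I r"
  proof (intro mult_mono divide_left_mono power_mono)
    show "?I \<tau> \<le> ?I r"
    proof (rule integral_mono_AE[OF intI intI])
      show "AE z in lborel. indicator (cyl x t \<theta> \<tau>) z * h z \<le> indicator (cyl x t \<theta> r) z * h z"
        using hnn by eventually_elim (use cyl_mono[of \<tau> r \<theta> x t] \<tau> r \<theta> in \<open>auto simp: indicator_def\<close>)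
    qed
    show "0 \<le> ?I \<tau>" using hnn by (intro integral_nonneg_AE) (auto elim!: eventually_mono)
  qed (use r \<tau> \<Lambda> in auto)
  finally have "r / 2 * \<bar>LINT z|lborel. v z * dkernel x t \<theta> \<tau> z\<bar> \<le> r / 2 * ((1 + 16 * \<Lambda>) / (r / 2) ^ (DIM('a) + 2) * ?I r)"
    using r by (intro mult_left_mono) auto
  also have "\<dots> = (1 + 16 * \<Lambda>) * 2 ^ (DIM('a) + 1) / r ^ (DIM('a) + 1) * ?I r"
    using r by (simp add: field_simps power_divide)
  finally show ?thesis
    using r unfolding \<tau>(3) abs_mult by simp
qed

section \<open>Continuous functions are dense in \<open>L^1\<close>\<close>

text \<open>
  Regularity of Lebesgue measure encloses \<open>A\<close> between a closed and an open set, and Urysohn's lemma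
  interpolates; the error lives on the difference of these two sets.
\<close>

lemma indicator_continuous_approx:
  fixes A :: "'b::euclidean_space set"
  assumes A: "A \<in> sets borel" and e: "0 < e"
  shows "\<exists>w::'b \<Rightarrow> real. continuous_on UNIV w \<and> (\<integral>\<^sup>+z. ennreal \<bar>indicator A z - w z\<bar> \<partial>lborel) < ennreal e"
proof -
  have Ale: "A \<in> sets lebesgue" using A by auto
  obtain C where C: "closed C" "C \<subseteq> A" "emeasure lebesgue (A - C) < ennreal (e/2)"
    by (rule sets_lebesgue_inner_closed[OF Ale half_gt_zero[OF e]])
  obtain U where U: "open U" "A \<subseteq> U" "emeasure lebesgue (U - A) < ennreal (e/2)"
    by (rule sets_lebesgue_outer_open[OF Ale half_gt_zero[OF e]])
  obtain w :: "'b \<Rightarrow> real" where w: "continuous_on UNIV w" "\<And>z. w z \<in> closed_segment 1 0"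
    "\<And>z. z \<in> C \<Longrightarrow> w z = 1" "\<And>z. z \<in> - U \<Longrightarrow> w z = 0"
    by (rule Urysohn_local[of UNIV C "- U" "1::real" 0]) (use C U in \<open>auto simp: closed_def\<close>)
  have w01: "0 \<le> w z" "w z \<le> 1" for z
    using w(2)[of z] by (auto simp: closed_segment_eq_real_ivl)
  have [measurable]: "A \<in> sets borel" "C \<in> sets borel" "U \<in> sets borel"
    using A C U by auto
  have "(\<integral>\<^sup>+z. ennreal \<bar>indicator A z - w z\<bar> \<partial>lborel)
     \<le> (\<integral>\<^sup>+z. indicator (A - C) z + indicator (U - A) z \<partial>lborel)"
  proof (rule nn_integral_mono)
    fix z
    show "ennreal \<bar>indicator A z - w z\<bar> \<le> indicator (A - C) z + indicator (U - A) z"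
      using w(3,4)[of z] w01[of z] C U by (auto simp: indicator_def ennreal_le_1)
  qed
  also have "\<dots> = emeasure lborel (A - C) + emeasure lborel (U - A)"
    by (subst nn_integral_add) auto
  also have "\<dots> < ennreal (e/2) + ennreal (e/2)"
    using C(3) U(3) by (intro add_strict_mono) auto
  also have "\<dots> = ennreal e" using e by (simp flip: ennreal_plus)
  finally show ?thesis using w(1) by blast
qed

text \<open>
  Induction over the construction of integrable functions. The approximation error is a
  nonnegative integral, which makes sense for an arbitrary continuous function.
\<close>

lemma continuous_L1_dense:
  fixes f :: "'b::euclidean_space \<Rightarrow> real"
  assumes f: "integrable lborel f"
  shows "\<forall>e>0. \<exists>w. continuous_on UNIV w \<and> (\<integral>\<^sup>+z. ennreal \<bar>f z - w z\<bar> \<partial>lborel) < ennreal e"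
  using f
proof induction
  case (base A c)
  show ?case
  proof (intro allI impI)
    fix e :: real assume e: "0 < e"
    \<comment> \<open>the summand \<open>1\<close> only avoids division by \<open>c = 0\<close>\<close>
    have "0 < e / (\<bar>c\<bar> + 1)" using e by simp
    then obtain w :: "'b \<Rightarrow> real" where w: "continuous_on UNIV w"
       "(\<integral>\<^sup>+z. ennreal \<bar>indicator A z - w z\<bar> \<partial>lborel) < ennreal (e / (\<bar>c\<bar> + 1))"
      using indicator_continuous_approx[of A "e / (\<bar>c\<bar> + 1)"] base(1) unfolding sets_lborel by blast
    have [measurable]: "A \<in> sets borel" "w \<in> borel_measurable borel"
      using base w by (auto intro: borel_measurable_continuous_onI)
    have "(\<integral>\<^sup>+z. ennreal \<bar>indicator A z *\<^sub>R c - w z * c\<bar> \<partial>lborel)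
       = (\<integral>\<^sup>+z. ennreal \<bar>c\<bar> * ennreal \<bar>indicator A z - w z\<bar> \<partial>lborel)"
      by (intro nn_integral_cong) (simp add: left_diff_distrib[symmetric] abs_mult ennreal_mult'[symmetric] mult.commute[of "ennreal \<bar>c\<bar>"])
    also have "\<dots> = ennreal \<bar>c\<bar> * (\<integral>\<^sup>+z. ennreal \<bar>indicator A z - w z\<bar> \<partial>lborel)"
      by (rule nn_integral_cmult) measurable
    also have "\<dots> \<le> ennreal \<bar>c\<bar> * ennreal (e / (\<bar>c\<bar> + 1))"
      using w by (intro mult_left_mono) auto
    also have "\<dots> < ennreal e"
      using e by (simp add: ennreal_mult'[symmetric] ennreal_less_iff divide_less_eq)
    finally show "\<exists>w. continuous_on UNIV w \<and> (\<integral>\<^sup>+z. ennreal \<bar>indicator A z *\<^sub>R c - w z\<bar> \<partial>lborel) < ennreal e"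
      using w(1) by (intro exI[of _ "\<lambda>z. w z * c"]) (auto intro!: continuous_intros)
  qed
next
  case (add f g)
  show ?case
  proof (intro allI impI)
    fix e :: real assume e: "0 < e"
    then have "0 < e/2" by simp
    obtain w1 where w1: "continuous_on UNIV w1" "(\<integral>\<^sup>+z. ennreal \<bar>f z - w1 z\<bar> \<partial>lborel) < ennreal (e/2)"
      using add.IH(1) \<open>0 < e/2\<close> by blast
    obtain w2 where w2: "continuous_on UNIV w2" "(\<integral>\<^sup>+z. ennreal \<bar>g z - w2 z\<bar> \<partial>lborel) < ennreal (e/2)"
      using add.IH(2) \<open>0 < e/2\<close> by blast
    note w = w1 w2
    have [measurable]: "w1 \<in> borel_measurable borel" "w2 \<in> borel_measurable borel"
       "f \<in> borel_measurable borel" "g \<in> borel_measurable borel"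
      using add.hyps w by (auto intro: borel_measurable_continuous_onI dest: borel_measurable_integrable)
    have "(\<integral>\<^sup>+z. ennreal \<bar>f z + g z - (w1 z + w2 z)\<bar> \<partial>lborel)
       \<le> (\<integral>\<^sup>+z. ennreal \<bar>f z - w1 z\<bar> + ennreal \<bar>g z - w2 z\<bar> \<partial>lborel)"
      by (intro nn_integral_mono) (simp flip: ennreal_plus)
    also have "\<dots> = (\<integral>\<^sup>+z. ennreal \<bar>f z - w1 z\<bar> \<partial>lborel) + (\<integral>\<^sup>+z. ennreal \<bar>g z - w2 z\<bar> \<partial>lborel)"
      by (rule nn_integral_add) measurable
    also have "\<dots> < ennreal (e/2) + ennreal (e/2)"
      using w by (intro add_strict_mono) auto
    also have "\<dots> = ennreal e" using e by (simp flip: ennreal_plus)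
    finally show "\<exists>w. continuous_on UNIV w \<and> (\<integral>\<^sup>+z. ennreal \<bar>f z + g z - w z\<bar> \<partial>lborel) < ennreal e"
      using w by (intro exI[of _ "\<lambda>z. w1 z + w2 z"]) (auto intro!: continuous_intros)
  qed
next
  case (lim f s)
  show ?case
  proof (intro allI impI)
    fix e :: real assume e: "0 < e"
    have [measurable]: "f \<in> borel_measurable borel" "s i \<in> borel_measurable borel" for i
      using lim.hyps by (auto dest: borel_measurable_integrable)
    have "(\<lambda>i. \<integral>\<^sup>+ x. ennreal (norm (f x - s i x)) \<partial>lborel) \<longlonglongrightarrow> 0"
    proof (rule nn_integral_dominated_convergence_norm[where w="\<lambda>x. 2 * norm (f x)"])
      show "(\<integral>\<^sup>+ x. ennreal (2 * norm (f x)) \<partial>lborel) < \<infinity>"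
        using integrable_norm[OF lim.hyps(4)] 
        by (subst nn_integral_eq_integral) auto
    qed (use lim.hyps in auto)
    then have "eventually (\<lambda>i. (\<integral>\<^sup>+ x. ennreal (norm (f x - s i x)) \<partial>lborel) < ennreal (e/2)) sequentially"
      using e by (intro order_tendstoD(2)) auto
    then obtain i where i: "(\<integral>\<^sup>+ x. ennreal \<bar>f x - s i x\<bar> \<partial>lborel) < ennreal (e/2)"
      unfolding eventually_sequentially by auto
    obtain w where w: "continuous_on UNIV w" "(\<integral>\<^sup>+z. ennreal \<bar>s i z - w z\<bar> \<partial>lborel) < ennreal (e/2)"
      using lim.IH[of i, rule_format, of "e/2"] e by auto
    have [measurable]: "w \<in> borel_measurable borel" 
      using w by (auto intro: borel_measurable_continuous_onI)
    have "(\<integral>\<^sup>+z. ennreal \<bar>f z - w z\<bar> \<partial>lborel)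
       \<le> (\<integral>\<^sup>+z. ennreal \<bar>f z - s i z\<bar> + ennreal \<bar>s i z - w z\<bar> \<partial>lborel)"
      by (intro nn_integral_mono) (simp flip: ennreal_plus)
    also have "\<dots> = (\<integral>\<^sup>+z. ennreal \<bar>f z - s i z\<bar> \<partial>lborel) + (\<integral>\<^sup>+z. ennreal \<bar>s i z - w z\<bar> \<partial>lborel)"
      by (rule nn_integral_add) measurable
    also have "\<dots> < ennreal (e/2) + ennreal (e/2)"
      using w i by (intro add_strict_mono) auto
    also have "\<dots> = ennreal e" using e by (simp flip: ennreal_plus)
    finally show "\<exists>w. continuous_on UNIV w \<and> (\<integral>\<^sup>+z. ennreal \<bar>f z - w z\<bar> \<partial>lborel) < ennreal e"
      using w by blast
  qed
qed

section \<open>The mass of the kernel\<close>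

lemma flat_measurable [measurable]: "flat \<in> borel_measurable borel" "dflat \<in> borel_measurable borel"
  using continuous_on_flat continuous_on_dflat by (auto intro: borel_measurable_continuous_onI)

lemma nn_integral_affine:
  fixes f :: "'a::euclidean_space \<Rightarrow> ennreal"
  assumes [measurable]: "f \<in> borel_measurable borel" and r: "0 < r"
  shows "(\<integral>\<^sup>+y. f y \<partial>lborel) = ennreal (r ^ DIM('a)) * (\<integral>\<^sup>+y. f (x + r *\<^sub>R y) \<partial>lborel)"
  using r by (subst lborel_affine[of r x]) (simp_all add: nn_integral_density nn_integral_distr nn_integral_cmult)

text \<open>
  The mass of the kernel at unit scale; \<open>kernel_integral\<close> shows that it is the same at every scale.
\<close>

definition kernel_mass :: "'a::euclidean_space itself \<Rightarrow> real" where
  "kernel_mass _ = enn2real (\<integral>\<^sup>+z. ennreal (kernel (0::'a) 0 0 1 z) \<partial>lborel)"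

lemma kernel_measurable [measurable]: "0 < r \<Longrightarrow> (\<lambda>z. kernel x t \<theta> r z) \<in> borel_measurable borel"
  using div_measurable(3) .

text \<open>
  Fubini separates space from time, and the affine substitutions \<open>y = x + r y'\<close> and
  \<open>s = t + r^2 \<theta> + r^2 s'\<close> cancel the normalising power of \<open>r\<close>.
\<close>

lemma kernel_nn_integral_eq:
  assumes r: "0 < r"
  shows "(\<integral>\<^sup>+z. ennreal (kernel (x::'a::euclidean_space) t \<theta> r z) \<partial>lborel)
    = (\<integral>\<^sup>+y. ennreal (sbump (0::'a) 1 y) \<partial>lborel) * (\<integral>\<^sup>+s. ennreal (tbump 0 0 1 s) \<partial>lborel)"
proof -
  have [measurable]: "sbump x r \<in> borel_measurable borel" "tbump t \<theta> r \<in> borel_measurable borel" for x :: 'a and t \<theta> r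
    unfolding sbump_def[abs_def] tbump_def[abs_def] by measurable
  have c: "0 \<le> 1 / r ^ (DIM('a) + 2)" using r by simp
  have "(\<integral>\<^sup>+z. ennreal (kernel x t \<theta> r z) \<partial>lborel)
    = (\<integral>\<^sup>+z. ennreal (1 / r ^ (DIM('a) + 2)) * (ennreal (sbump x r (fst z)) * ennreal (tbump t \<theta> r (snd z))) \<partial>(lborel \<Otimes>\<^sub>M lborel))"
    unfolding lborel_prod kernel_def
    using c by (intro nn_integral_cong) (simp add: ennreal_mult'[symmetric] bump_bounds)
  also have "\<dots> = (\<integral>\<^sup>+y. \<integral>\<^sup>+s. ennreal (1 / r ^ (DIM('a) + 2)) * (ennreal (sbump x r y) * ennreal (tbump t \<theta> r s)) \<partial>lborel \<partial>lborel)"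
    by (subst lborel.nn_integral_fst[symmetric]) auto
  also have "\<dots> = ennreal (1 / r ^ (DIM('a) + 2)) * ((\<integral>\<^sup>+y. ennreal (sbump x r y) \<partial>lborel) * (\<integral>\<^sup>+s. ennreal (tbump t \<theta> r s) \<partial>lborel))"
    by (simp add: nn_integral_cmult nn_integral_multc)
  also have "(\<integral>\<^sup>+y. ennreal (sbump x r y) \<partial>lborel) = ennreal (r ^ DIM('a)) * (\<integral>\<^sup>+y. ennreal (sbump (0::'a) 1 y) \<partial>lborel)"
    using r by (subst nn_integral_affine[of _ r x]) (auto simp: sbump_def power2_eq_square)
  also have "(\<integral>\<^sup>+s. ennreal (tbump t \<theta> r s) \<partial>lborel) = ennreal (r\<^sup>2) * (\<integral>\<^sup>+s. ennreal (tbump 0 0 1 s) \<partial>lborel)"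
    using r by (subst nn_integral_real_affine[of _ "r\<^sup>2" "t + r\<^sup>2 * \<theta>"]) (auto simp: tbump_def field_simps)
  finally have "(\<integral>\<^sup>+z. ennreal (kernel x t \<theta> r z) \<partial>lborel) =
    (ennreal (1 / r ^ (DIM('a) + 2)) * ennreal (r ^ DIM('a)) * ennreal (r\<^sup>2)) * ((\<integral>\<^sup>+y. ennreal (sbump (0::'a) 1 y) \<partial>lborel) * (\<integral>\<^sup>+s. ennreal (tbump 0 0 1 s) \<partial>lborel))"
    by (simp add: mult_ac)
  also have "ennreal (1 / r ^ (DIM('a) + 2)) * ennreal (r ^ DIM('a)) * ennreal (r\<^sup>2) = 1"
    using r by (simp add: ennreal_mult'[symmetric] power_add power2_eq_square)
  finally show ?thesis by simp
qed

lemma kernel_pos: "0 < r \<Longrightarrow> z \<in> cyl x t \<theta> r \<Longrightarrow> 0 < kernel x t \<theta> r z"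
  unfolding kernel_def cyl_def
  by (intro divide_pos_pos mult_pos_pos sbump_pos tbump_pos) (auto simp: mem_Times_iff)

lemma kernel_mass_finite: "(\<integral>\<^sup>+z. ennreal (kernel (0::'a::euclidean_space) 0 0 1 z) \<partial>lborel) < top"
proof -
  have le: "ennreal (kernel (0::'a) 0 0 1 z) \<le> indicator (cyl 0 0 0 1) z" for z
    using kernel_bound(2)[of 1 "0::'a" 0 0 z] kernel_zero[of 1 z "0::'a" 0 0]
    by (auto simp: indicator_def cyl_def ennreal_le_1)
  have "(\<integral>\<^sup>+z. ennreal (kernel (0::'a) 0 0 1 z) \<partial>lborel) \<le> (\<integral>\<^sup>+z. indicator (cyl (0::'a) 0 0 1) z \<partial>lborel)"
    by (intro nn_integral_mono le)
  also have "\<dots> = ennreal (2 * unit_ball_vol DIM('a))"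
    using emeasure_cyl[of 1 "0::'a" 0 0] by simp
  finally show ?thesis
    by (rule le_less_trans) simp
qed

lemma kernel_mass_pos: "0 < kernel_mass TYPE('a::euclidean_space)"
proof -
  have "(\<integral>\<^sup>+z. ennreal (kernel (0::'a) 0 0 1 z) \<partial>lborel) \<noteq> 0"
  proof
    assume "(\<integral>\<^sup>+z. ennreal (kernel (0::'a) 0 0 1 z) \<partial>lborel) = 0"
    then have "AE z in lborel. ennreal (kernel (0::'a) 0 0 1 z) = 0"
      by (subst (asm) nn_integral_0_iff_AE) auto
    then have "AE z in lborel. z \<notin> cyl (0::'a) 0 0 1"
    proof eventually_elim
      case (elim z)
      then show ?case
        using kernel_pos[of 1 z "0::'a" 0 0] by (auto simp: ennreal_eq_0_iff)
    qed
    then have "emeasure lborel (cyl (0::'a) 0 0 1) = 0"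
      by (subst (asm) AE_iff_null_sets[symmetric]) auto
    then show False
      using emeasure_cyl[of 1 "0::'a" 0 0] unit_ball_vol_pos[OF of_nat_0_le_iff, of "DIM('a)"]
      by (auto simp: ennreal_eq_0_iff not_le[symmetric])
  qed
  then show ?thesis using kernel_mass_finite[where 'a='a] unfolding kernel_mass_def
    by (simp add: enn2real_positive_iff zero_less_iff_neq_zero)
qed

lemma kernel_nn_integral:
  assumes r: "0 < r"
  shows "(\<integral>\<^sup>+z. ennreal (kernel (x::'a::euclidean_space) t \<theta> r z) \<partial>lborel) = ennreal (kernel_mass TYPE('a))"
proof -
  have "(\<integral>\<^sup>+z. ennreal (kernel x t \<theta> r z) \<partial>lborel) = (\<integral>\<^sup>+z. ennreal (kernel (0::'a) 0 0 1 z) \<partial>lborel)"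
    unfolding kernel_nn_integral_eq[OF r] kernel_nn_integral_eq[OF zero_less_one] ..
  then show ?thesis using kernel_mass_finite[where 'a='a] unfolding kernel_mass_def by simp
qed

lemma kernel_integral:
  assumes r: "0 < r"
  shows "integrable lborel (kernel (x::'a::euclidean_space) t \<theta> r)"
    "(LINT z|lborel. kernel x t \<theta> r z) = kernel_mass TYPE('a)"
proof -
  have "has_bochner_integral lborel (kernel x t \<theta> r) (kernel_mass TYPE('a))"
    using kernel_nn_integral[OF r, of x t \<theta>] kernel_mass_pos[where 'a='a] r
    by (intro has_bochner_integral_nn_integral) (auto simp: kernel_bound less_imp_le)
  then show "integrable lborel (kernel x t \<theta> r)" "(LINT z|lborel. kernel x t \<theta> r z) = kernel_mass TYPE('a)"
    by (auto simp: has_bochner_integral_iff)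
qed

section \<open>Convergence of the averages at small scales\<close>

lemma kernel_dist:
  assumes r: "0 < r" and \<theta>: "\<bar>\<theta>\<bar> \<le> 1" and nz: "kernel x t \<theta> r \<zeta> \<noteq> 0"
  shows "dist \<zeta> (x, t) \<le> r + 2 * r\<^sup>2" "x \<in> ball (fst \<zeta>) r" "\<bar>snd \<zeta> - t\<bar> \<le> 2 * r\<^sup>2"
proof -
  have "fst \<zeta> \<in> ball x r" "snd \<zeta> \<in> window t \<theta> r"
    using kernel_zero[OF r, of \<zeta> x t \<theta>] nz by (auto simp: mem_Times_iff simp del: mem_ball)
  then show *: "x \<in> ball (fst \<zeta>) r" "\<bar>snd \<zeta> - t\<bar> \<le> 2 * r\<^sup>2"
    using window_dist[OF _ \<theta>] by (auto simp: dist_commute)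
  have "dist \<zeta> (x, t) \<le> dist (fst \<zeta>) x + dist (snd \<zeta>) t"
    unfolding dist_prod_def by (simp add: sqrt_sum_squares_le_sum)
  also have "\<dots> \<le> r + 2 * r\<^sup>2" using * by (intro add_mono) (auto simp: dist_real_def)
  finally show "dist \<zeta> (x, t) \<le> r + 2 * r\<^sup>2" .
qed

text \<open>
  Here the base point \<open>z\<close> is integrated and \<open>\<zeta>\<close> is fixed. As \<open>\<theta>\<close> varies with the base point, there is
  no substitution that would give the exact mass; the bound is supremum times measure of the set of
  base points that reach \<open>\<zeta>\<close>.
\<close>

lemma kernel_dual_nn_integral:
  fixes \<theta> :: "real \<Rightarrow> real" and \<zeta> :: "'a::euclidean_space \<times> real"
  assumes r: "0 < r" and \<theta>: "\<And>t. \<bar>\<theta> t\<bar> \<le> 1"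
  shows "(\<integral>\<^sup>+z. ennreal (kernel (fst z) (snd z) (\<theta> (snd z)) r \<zeta>) \<partial>lborel) \<le> ennreal (4 * unit_ball_vol DIM('a))"
proof -
  let ?S = "ball (fst \<zeta>) r \<times> cball (snd \<zeta>) (2 * r\<^sup>2)"
  have [measurable]: "?S \<in> sets borel" by (intro borel_Times) auto
  have "(\<integral>\<^sup>+z. ennreal (kernel (fst z) (snd z) (\<theta> (snd z)) r \<zeta>) \<partial>lborel)
    \<le> (\<integral>\<^sup>+z. ennreal (1 / r ^ (DIM('a) + 2)) * indicator ?S z \<partial>lborel)"
  proof (rule nn_integral_mono)
    fix z :: "'a \<times> real"
    show "ennreal (kernel (fst z) (snd z) (\<theta> (snd z)) r \<zeta>) \<le> ennreal (1 / r ^ (DIM('a) + 2)) * indicator ?S z"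
    proof (cases "kernel (fst z) (snd z) (\<theta> (snd z)) r \<zeta> = 0")
      case False
      then have "z \<in> ?S" using kernel_dist(2,3)[OF r \<theta> False] by (auto simp: mem_Times_iff dist_real_def)
      then show ?thesis using kernel_bound(2)[OF r, of "fst z" "snd z" "\<theta> (snd z)" \<zeta>] by (simp add: ennreal_leI)
    qed simp
  qed
  also have "\<dots> = ennreal (1 / r ^ (DIM('a) + 2)) * emeasure lborel ?S"
    by (rule nn_integral_cmult_indicator) simp
  also have "emeasure lborel ?S = emeasure lborel (ball (fst \<zeta>) r) * emeasure lborel (cball (snd \<zeta>) (2 * r\<^sup>2))"
    by (subst lborel_prod[symmetric], subst lborel.emeasure_pair_measure_Times) auto
  also have "\<dots> = ennreal (unit_ball_vol DIM('a) * r ^ DIM('a)) * ennreal (4 * r\<^sup>2)"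
    using r by (simp add: emeasure_ball cball_eq_atLeastAtMost)
  finally show ?thesis
    using r by (simp add: ennreal_mult'[symmetric] power_add power2_eq_square field_simps)
qed

lemma ennreal_tendsto_0I:
  fixes f :: "'b \<Rightarrow> ennreal"
  assumes "\<And>e::real. 0 < e \<Longrightarrow> eventually (\<lambda>k. f k \<le> ennreal e) F"
  shows "(f \<longlongrightarrow> 0) F"
proof (rule order_tendstoI)
  fix a :: ennreal assume "0 < a"
  then obtain e where e: "0 < e" "e < a" using dense by blast
  then obtain e' where "e = ennreal e'" "0 \<le> e'" by (cases e) auto
  with e have "eventually (\<lambda>k. f k \<le> ennreal e') F" by (intro assms) (auto simp: ennreal_less_zero_iff)
  then show "eventually (\<lambda>k. f k < a) F"
    by eventually_elim (use e \<open>e = ennreal e'\<close> in auto)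
qed auto

lemma kernel_joint_measurable:
  assumes [measurable]: "\<theta> \<in> borel_measurable borel"
  shows "(\<lambda>p::('a::euclidean_space \<times> real) \<times> ('a \<times> real).
      kernel (fst (fst p)) (snd (fst p)) (\<theta> (snd (fst p))) r (snd p)) \<in> borel_measurable (lborel \<Otimes>\<^sub>M lborel)"
proof -
  note [measurable] = fst_snd_borel
  show ?thesis unfolding kernel_def sbump_def tbump_def by measurable
qed

lemma kernel_joint_measurable':
  assumes [measurable]: "\<theta> \<in> borel_measurable borel"
  shows "(\<lambda>p::('a::euclidean_space \<times> real) \<times> ('a \<times> real).
      kernel (fst (snd p)) (snd (snd p)) (\<theta> (snd (snd p))) r (fst p)) \<in> borel_measurable (lborel \<Otimes>\<^sub>M lborel)"
proof -
  note [measurable] = fst_snd_borel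
  show ?thesis unfolding kernel_def sbump_def tbump_def by measurable
qed

lemma avg_measurable:
  assumes [measurable]: "\<theta> \<in> borel_measurable borel" "v \<in> borel_measurable borel"
  shows "(\<lambda>z::'a::euclidean_space \<times> real. avg v (fst z) (snd z) (\<theta> (snd z)) r) \<in> borel_measurable borel"
proof -
  note [measurable] = kernel_joint_measurable
  have "(\<lambda>z::'a \<times> real. LINT \<zeta>|lborel. v \<zeta> * kernel (fst z) (snd z) (\<theta> (snd z)) r \<zeta>) \<in> borel_measurable lborel"
    by (rule lborel.borel_measurable_lebesgue_integral) (simp add: case_prod_beta)
  then show ?thesis by (simp add: avg_def)
qed

text \<open>
  The operator \<open>v \<mapsto> avg v - kernel_mass \<cdot> v\<close> is bounded on \<open>L^1\<close> by \<open>kernel_dual_nn_integral\<close>, and on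
  the continuous function \<open>w\<close> it is small where \<open>w\<close> oscillates little at the scale \<open>r\<close>. The two
  summands are the contributions of \<open>v - w\<close> and of \<open>w\<close>.
\<close>

lemma avg_L1_bound:
  fixes v w :: "'a::euclidean_space \<times> real \<Rightarrow> real"
  assumes v: "integrable lborel v" and w: "continuous_on UNIV w"
    and \<theta>: "\<theta> \<in> borel_measurable borel" "\<And>t. \<bar>\<theta> t\<bar> \<le> 1" and Q: "Q \<in> sets borel" and r: "0 < r"
    and \<eta>: "\<And>z \<zeta>. z \<in> Q \<Longrightarrow> dist \<zeta> z \<le> r + 2 * r\<^sup>2 \<Longrightarrow> \<bar>w \<zeta> - w z\<bar> \<le> \<eta>"
  shows "(\<integral>\<^sup>+z\<in>Q. ennreal \<bar>avg v (fst z) (snd z) (\<theta> (snd z)) r - kernel_mass TYPE('a) * v z\<bar> \<partial>lborel)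
    \<le> ennreal (4 * unit_ball_vol DIM('a) + kernel_mass TYPE('a)) * (\<integral>\<^sup>+z. ennreal \<bar>v z - w z\<bar> \<partial>lborel)
        + ennreal \<eta> * ennreal (kernel_mass TYPE('a)) * emeasure lborel Q"
proof -
  let ?K = "\<lambda>z \<zeta>. kernel (fst z) (snd z) (\<theta> (snd z)) r \<zeta>"
  let ?kernel_mass = "kernel_mass TYPE('a)"
  let ?n = "\<integral>\<^sup>+z. ennreal \<bar>v z - w z\<bar> \<partial>lborel"
  note [measurable] = kernel_joint_measurable[OF \<theta>(1)] kernel_joint_measurable'[OF \<theta>(1)] kernel_measurable[OF r] Q
  have [measurable]: "v \<in> borel_measurable borel" "w \<in> borel_measurable borel"
    using v w by (auto dest: borel_measurable_integrable intro: borel_measurable_continuous_onI)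
  have K0: "0 \<le> ?K z \<zeta>" for z \<zeta> :: "'a \<times> real" using kernel_bound(1)[OF r] .
  have pw: "ennreal \<bar>avg v (fst z) (snd z) (\<theta> (snd z)) r - ?kernel_mass * v z\<bar>
     \<le> (\<integral>\<^sup>+\<zeta>. ennreal (\<bar>v \<zeta> - w \<zeta>\<bar> * ?K z \<zeta>) \<partial>lborel) + (ennreal \<eta> * ennreal ?kernel_mass + ennreal (?kernel_mass * \<bar>v z - w z\<bar>))"
    if z: "z \<in> Q" for z
  proof -
    have i1: "integrable lborel (\<lambda>\<zeta>. v \<zeta> * ?K z \<zeta>)"
    proof (rule integrable_mult_bounded[OF v, of _ "1 / r ^ (DIM('a) + 2)"])
      show "\<bar>?K z \<zeta>\<bar> \<le> 1 / r ^ (DIM('a) + 2)" for \<zeta>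
        using kernel_bound(2)[OF r, of "fst z" "snd z" "\<theta> (snd z)" \<zeta>] K0[of z \<zeta>] by simp
    qed measurable
    have i2: "integrable lborel (\<lambda>\<zeta>. v z * ?K z \<zeta>)"
      by (rule integrable_mult_right) (rule kernel_integral(1)[OF r])
    have "avg v (fst z) (snd z) (\<theta> (snd z)) r - ?kernel_mass * v z = (LINT \<zeta>|lborel. v \<zeta> * ?K z \<zeta> - v z * ?K z \<zeta>)"
      using i1 i2 kernel_integral(2)[OF r, of "fst z" "snd z" "\<theta> (snd z)"] by (simp add: avg_def mult.commute)
    then have "ennreal \<bar>avg v (fst z) (snd z) (\<theta> (snd z)) r - ?kernel_mass * v z\<bar>
       \<le> (\<integral>\<^sup>+\<zeta>. ennreal (norm (v \<zeta> * ?K z \<zeta> - v z * ?K z \<zeta>)) \<partial>lborel)"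
      using integral_norm_bound_ennreal[of lborel "\<lambda>\<zeta>. v \<zeta> * ?K z \<zeta> - v z * ?K z \<zeta>"] i1 i2 by auto
    also have "\<dots> \<le> (\<integral>\<^sup>+\<zeta>. ennreal (\<bar>v \<zeta> - w \<zeta>\<bar> * ?K z \<zeta>) + ennreal (\<eta> + \<bar>v z - w z\<bar>) * ennreal (?K z \<zeta>) \<partial>lborel)"
    proof (rule nn_integral_mono)
      fix \<zeta> :: "'a \<times> real"
      show "ennreal (norm (v \<zeta> * ?K z \<zeta> - v z * ?K z \<zeta>))
         \<le> ennreal (\<bar>v \<zeta> - w \<zeta>\<bar> * ?K z \<zeta>) + ennreal (\<eta> + \<bar>v z - w z\<bar>) * ennreal (?K z \<zeta>)"
      proof (cases "?K z \<zeta> = 0")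
        case False
        have "\<bar>w \<zeta> - w z\<bar> \<le> \<eta>"
          using \<eta>[OF z] kernel_dist(1)[OF r \<theta>(2) False] by simp
        then have "\<bar>v \<zeta> - v z\<bar> \<le> \<bar>v \<zeta> - w \<zeta>\<bar> + (\<eta> + \<bar>v z - w z\<bar>)" and "0 \<le> \<eta>" by linarith+
        then have "\<bar>v \<zeta> - v z\<bar> * ?K z \<zeta> \<le> \<bar>v \<zeta> - w \<zeta>\<bar> * ?K z \<zeta> + (\<eta> + \<bar>v z - w z\<bar>) * ?K z \<zeta>"
          using K0[of z \<zeta>] mult_right_mono[of "\<bar>v \<zeta> - v z\<bar>" _ "?K z \<zeta>"] by (simp add: distrib_right[symmetric])
        moreover have "norm (v \<zeta> * ?K z \<zeta> - v z * ?K z \<zeta>) = \<bar>v \<zeta> - v z\<bar> * ?K z \<zeta>"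
          using K0[of z \<zeta>] by (simp add: left_diff_distrib[symmetric] abs_mult)
        ultimately show ?thesis
          using K0[of z \<zeta>] \<open>0 \<le> \<eta>\<close> by (simp add: ennreal_mult'[symmetric] ennreal_plus[symmetric] del: ennreal_plus)
      qed simp
    qed
    also have "\<dots> = (\<integral>\<^sup>+\<zeta>. ennreal (\<bar>v \<zeta> - w \<zeta>\<bar> * ?K z \<zeta>) \<partial>lborel) + ennreal (\<eta> + \<bar>v z - w z\<bar>) * ennreal ?kernel_mass"
      by (simp add: nn_integral_add nn_integral_cmult kernel_nn_integral[OF r])
    also have "\<dots> \<le> (\<integral>\<^sup>+\<zeta>. ennreal (\<bar>v \<zeta> - w \<zeta>\<bar> * ?K z \<zeta>) \<partial>lborel) + (ennreal \<eta> * ennreal ?kernel_mass + ennreal (?kernel_mass * \<bar>v z - w z\<bar>))"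
    proof -
      have "0 \<le> \<eta>" using \<eta>[OF z, of z] r by simp
      then show ?thesis using kernel_mass_pos[where 'a='a]
        by (simp add: ennreal_mult'[symmetric] ennreal_plus[symmetric] algebra_simps del: ennreal_plus)
    qed
    finally show ?thesis .
  qed
  have "(\<integral>\<^sup>+z\<in>Q. ennreal \<bar>avg v (fst z) (snd z) (\<theta> (snd z)) r - ?kernel_mass * v z\<bar> \<partial>lborel)
    \<le> (\<integral>\<^sup>+z. (\<integral>\<^sup>+\<zeta>. ennreal (\<bar>v \<zeta> - w \<zeta>\<bar> * ?K z \<zeta>) \<partial>lborel) + (ennreal \<eta> * ennreal ?kernel_mass * indicator Q z + ennreal ?kernel_mass * ennreal \<bar>v z - w z\<bar>) \<partial>lborel)"
  proof (rule nn_integral_mono)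
    fix z :: "'a \<times> real"
    show "ennreal \<bar>avg v (fst z) (snd z) (\<theta> (snd z)) r - ?kernel_mass * v z\<bar> * indicator Q z
      \<le> (\<integral>\<^sup>+\<zeta>. ennreal (\<bar>v \<zeta> - w \<zeta>\<bar> * ?K z \<zeta>) \<partial>lborel) + (ennreal \<eta> * ennreal ?kernel_mass * indicator Q z + ennreal ?kernel_mass * ennreal \<bar>v z - w z\<bar>)"
      using pw[of z] kernel_mass_pos[where 'a='a] by (cases "z \<in> Q") (auto simp: ennreal_mult')
  qed
  also have "\<dots> = (\<integral>\<^sup>+z. (\<integral>\<^sup>+\<zeta>. ennreal (\<bar>v \<zeta> - w \<zeta>\<bar> * ?K z \<zeta>) \<partial>lborel) \<partial>lborel)
      + (ennreal \<eta> * ennreal ?kernel_mass * emeasure lborel Q + ennreal ?kernel_mass * ?n)"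
  proof -
    have [measurable]: "(\<lambda>z. \<integral>\<^sup>+\<zeta>. ennreal (\<bar>v \<zeta> - w \<zeta>\<bar> * ?K z \<zeta>) \<partial>lborel) \<in> borel_measurable lborel"
      by (rule lborel.borel_measurable_nn_integral) (simp add: case_prod_beta)
    show ?thesis
      by (simp add: nn_integral_add nn_integral_cmult nn_integral_cmult_indicator)
  qed
  also have "(\<integral>\<^sup>+z. (\<integral>\<^sup>+\<zeta>. ennreal (\<bar>v \<zeta> - w \<zeta>\<bar> * ?K z \<zeta>) \<partial>lborel) \<partial>lborel)
     = (\<integral>\<^sup>+\<zeta>. (\<integral>\<^sup>+z. ennreal (\<bar>v \<zeta> - w \<zeta>\<bar> * ?K z \<zeta>) \<partial>lborel) \<partial>lborel)"
    by (rule lborel_pair.Fubini') (simp add: case_prod_beta)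
  also have "\<dots> \<le> (\<integral>\<^sup>+\<zeta>. ennreal \<bar>v \<zeta> - w \<zeta>\<bar> * ennreal (4 * unit_ball_vol DIM('a)) \<partial>lborel)"
  proof (rule nn_integral_mono)
    fix \<zeta> :: "'a \<times> real"
    have [measurable]: "(\<lambda>z. ?K z \<zeta>) \<in> borel_measurable lborel"
    proof -
      note [measurable] = fst_snd_borel \<theta>(1)
      show ?thesis unfolding kernel_def sbump_def tbump_def by measurable
    qed
    have "(\<integral>\<^sup>+z. ennreal (\<bar>v \<zeta> - w \<zeta>\<bar> * ?K z \<zeta>) \<partial>lborel) = ennreal \<bar>v \<zeta> - w \<zeta>\<bar> * (\<integral>\<^sup>+z. ennreal (?K z \<zeta>) \<partial>lborel)"
      by (subst nn_integral_cmult[symmetric]) (auto simp: ennreal_mult' intro!: nn_integral_cong)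
    also have "\<dots> \<le> ennreal \<bar>v \<zeta> - w \<zeta>\<bar> * ennreal (4 * unit_ball_vol DIM('a))"
      by (intro mult_left_mono kernel_dual_nn_integral r \<theta>) simp
    finally show "(\<integral>\<^sup>+z. ennreal (\<bar>v \<zeta> - w \<zeta>\<bar> * ?K z \<zeta>) \<partial>lborel) \<le> ennreal \<bar>v \<zeta> - w \<zeta>\<bar> * ennreal (4 * unit_ball_vol DIM('a))" .
  qed
  also have "\<dots> = ennreal (4 * unit_ball_vol DIM('a)) * ?n"
    by (subst nn_integral_multc) (auto simp: mult.commute)
  finally show ?thesis
    using kernel_mass_pos[where 'a='a] by (simp add: distrib_right add_ac)
qed

text \<open>
  The density argument: choose \<open>w\<close> first, then \<open>r\<close> so small that the uniform continuity of \<open>w\<close> on a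
  neighbourhood of \<open>Q\<close> takes over.
\<close>

lemma avg_L1_tendsto:
  fixes v :: "'a::euclidean_space \<times> real \<Rightarrow> real"
  assumes v: "integrable lborel v" and \<theta>: "\<theta> \<in> borel_measurable borel" "\<And>t. \<bar>\<theta> t\<bar> \<le> 1"
    and Q: "Q \<in> sets borel" "bounded Q" and r: "\<And>k. 0 < r k" "r \<longlonglongrightarrow> 0"
  shows "(\<lambda>k. \<integral>\<^sup>+z\<in>Q. ennreal \<bar>avg v (fst z) (snd z) (\<theta> (snd z)) (r k) - kernel_mass TYPE('a) * v z\<bar> \<partial>lborel) \<longlonglongrightarrow> 0"
proof (rule ennreal_tendsto_0I)
  fix e :: real assume e: "0 < e"
  define C where "C = 4 * unit_ball_vol DIM('a) + kernel_mass TYPE('a)"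
  have C: "0 < C" unfolding C_def using kernel_mass_pos[where 'a='a] by (simp add: add_nonneg_pos)
  define m where "m = measure lborel Q"
  have m: "emeasure lborel Q = ennreal m" "0 \<le> m"
    using emeasure_bounded_finite[OF Q(2)] Q unfolding m_def by (auto simp: emeasure_eq_ennreal_measure)
  have "0 < e / (2 * C)" using e C by simp
  then obtain w where w: "continuous_on UNIV w" "(\<integral>\<^sup>+z. ennreal \<bar>v z - w z\<bar> \<partial>lborel) < ennreal (e / (2 * C))"
    using continuous_L1_dense[OF v] by blast
  \<comment> \<open>the summand \<open>1\<close> keeps the denominator positive when \<open>Q\<close> is a null set\<close>
  define \<eta> where "\<eta> = e / (2 * (kernel_mass TYPE('a) * m + 1))"
  have km: "0 < kernel_mass TYPE('a) * m + 1" using kernel_mass_pos[where 'a='a] m by (simp add: add_nonneg_pos)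
  have \<eta>: "0 < \<eta>" unfolding \<eta>_def using km e by simp
  \<comment> \<open>radius \<open>R + 1\<close> below: cylinders based in \<open>Q\<close> leave \<open>Q\<close> by less than \<open>1\<close> at small scales\<close>
  obtain R where R: "Q \<subseteq> cball 0 R" using Q(2) by (auto simp: bounded_iff subset_iff)
  have "uniformly_continuous_on (cball 0 (R + 1)) w"
    by (rule compact_uniformly_continuous[OF continuous_on_subset[OF w(1)]]) auto
  then obtain \<delta> where \<delta>: "0 < \<delta>" "\<And>z \<zeta>. z \<in> cball 0 (R + 1) \<Longrightarrow> \<zeta> \<in> cball 0 (R + 1) \<Longrightarrow> dist \<zeta> z < \<delta> \<Longrightarrow> dist (w \<zeta>) (w z) < \<eta>"
    unfolding uniformly_continuous_on_def using \<eta> by metis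
  have "(\<lambda>k. r k + 2 * (r k)\<^sup>2) \<longlonglongrightarrow> 0 + 2 * 0\<^sup>2" by (intro tendsto_intros r)
  then have "eventually (\<lambda>k. r k + 2 * (r k)\<^sup>2 < min \<delta> 1) sequentially"
    using \<delta>(1) by (intro order_tendstoD(2)) auto
  then show "eventually (\<lambda>k. (\<integral>\<^sup>+z\<in>Q. ennreal \<bar>avg v (fst z) (snd z) (\<theta> (snd z)) (r k) - kernel_mass TYPE('a) * v z\<bar> \<partial>lborel) \<le> ennreal e) sequentially"
  proof eventually_elim
    case (elim k)
    have "(\<integral>\<^sup>+z\<in>Q. ennreal \<bar>avg v (fst z) (snd z) (\<theta> (snd z)) (r k) - kernel_mass TYPE('a) * v z\<bar> \<partial>lborel)
      \<le> ennreal C * (\<integral>\<^sup>+z. ennreal \<bar>v z - w z\<bar> \<partial>lborel) + ennreal \<eta> * ennreal (kernel_mass TYPE('a)) * emeasure lborel Q"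
      unfolding C_def
    proof (rule avg_L1_bound[OF v w(1) \<theta> Q(1) r(1)])
      fix z \<zeta> assume z: "z \<in> Q" "dist \<zeta> z \<le> r k + 2 * (r k)\<^sup>2"
      have "norm z \<le> R" using R z by auto
      moreover have "norm \<zeta> \<le> norm z + dist \<zeta> z" by (metis dist_norm norm_triangle_sub add.commute)
      ultimately have "dist (w \<zeta>) (w z) < \<eta>" using z elim by (intro \<delta>) auto
      then show "\<bar>w \<zeta> - w z\<bar> \<le> \<eta>" by (simp add: dist_real_def)
    qed
    also have "\<dots> \<le> ennreal C * ennreal (e / (2 * C)) + ennreal \<eta> * ennreal (kernel_mass TYPE('a)) * ennreal m"
      using w(2) m by (intro add_mono mult_left_mono) auto
    also have "\<dots> = ennreal (C * (e / (2 * C)) + \<eta> * (kernel_mass TYPE('a) * m))"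
      using C e \<eta> m kernel_mass_pos[where 'a='a] by (simp add: ennreal_mult'[symmetric] ennreal_plus[symmetric] mult_ac del: ennreal_plus)
    also have "\<dots> \<le> ennreal e"
    proof (rule ennreal_leI)
      have "\<eta> * (kernel_mass TYPE('a) * m) \<le> \<eta> * (kernel_mass TYPE('a) * m + 1)" using \<eta> by (intro mult_left_mono) auto
      also have "\<dots> = e / 2" unfolding \<eta>_def using km by (simp add: field_simps)
      finally show "C * (e / (2 * C)) + \<eta> * (kernel_mass TYPE('a) * m) \<le> e" using C by simp
    qed
    finally show ?case .
  qed
qed

text \<open>
  Convergence in \<open>L^1\<close> gives convergence almost everywhere along a subsequence. Summing the errors of
  the components first produces one subsequence for all of them, as the telescoping argument below
  treats the components together.
\<close>

lemma avg_AE_subseq: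
  fixes v :: "nat \<Rightarrow> 'a::euclidean_space \<times> real \<Rightarrow> real"
  assumes v: "\<And>i. i < N \<Longrightarrow> integrable lborel (v i)" and \<theta>: "\<theta> \<in> borel_measurable borel" "\<And>t. \<bar>\<theta> t\<bar> \<le> 1"
    and Q: "Q \<in> sets borel" "bounded Q" and r: "\<And>k. 0 < r k" "r \<longlonglongrightarrow> 0"
  shows "\<exists>s. strict_mono s \<and> (AE z in lborel. z \<in> Q \<longrightarrow> (\<forall>i<N.
     (\<lambda>k. avg (v i) (fst z) (snd z) (\<theta> (snd z)) (r (s k))) \<longlonglongrightarrow> kernel_mass TYPE('a) * v i z))"
proof -
  let ?e = "\<lambda>i k z. \<bar>avg (v i) (fst z) (snd z) (\<theta> (snd z)) (r k) - kernel_mass TYPE('a) * v i z\<bar>"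
  let ?d = "\<lambda>k z. \<Sum>i<N. ?e i k z * indicator Q z"
  have em: "?e i k \<in> borel_measurable lborel" if "i < N" for i k
    using avg_measurable[OF \<theta>(1), of "v i" "r k"] v[OF that] by (auto dest: borel_measurable_integrable)
  have msum: "?d k \<in> borel_measurable lborel" for k
    by (intro borel_measurable_sum borel_measurable_times borel_measurable_indicator em) (use Q in auto)
  have nn: "0 \<le> ?d k z" for k z by (intro sum_nonneg) auto
  have lim: "(\<lambda>k. \<integral>\<^sup>+z. ennreal (?d k z) \<partial>lborel) \<longlonglongrightarrow> 0"
  proof -
    have "(\<integral>\<^sup>+z. ennreal (?d k z) \<partial>lborel) = (\<Sum>i<N. \<integral>\<^sup>+z\<in>Q. ennreal (?e i k z) \<partial>lborel)" for k
    proof -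
      have "(\<integral>\<^sup>+z. ennreal (?d k z) \<partial>lborel) = (\<integral>\<^sup>+z. (\<Sum>i<N. ennreal (?e i k z) * indicator Q z) \<partial>lborel)"
        by (intro nn_integral_cong, subst sum_ennreal[symmetric]) (auto simp: indicator_def)
      also have "\<dots> = (\<Sum>i<N. \<integral>\<^sup>+z\<in>Q. ennreal (?e i k z) \<partial>lborel)"
        by (rule nn_integral_sum) (use em Q in auto)
      finally show ?thesis .
    qed
    moreover have "(\<lambda>k. \<Sum>i<N. \<integral>\<^sup>+z\<in>Q. ennreal (?e i k z) \<partial>lborel) \<longlonglongrightarrow> (\<Sum>i<N. 0)"
      by (intro tendsto_sum avg_L1_tendsto v \<theta> Q r) auto
    ultimately show ?thesis by simp
  qed
  \<comment> \<open>the errors are integrable only from some index \<open>k0\<close> on, as \<open>avg\<close> is not known to be integrable\<close>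
  then have "eventually (\<lambda>k. (\<integral>\<^sup>+z. ennreal (?d k z) \<partial>lborel) < 1) sequentially"
    by (rule order_tendstoD) simp
  then obtain k0 where k0: "\<And>k. k0 \<le> k \<Longrightarrow> (\<integral>\<^sup>+z. ennreal (?d k z) \<partial>lborel) < 1"
    by (auto simp: eventually_sequentially)
  have int: "integrable lborel (?d (k + k0))" for k
    by (rule integrableI_nonneg[OF msum]) (use nn k0[of "k + k0"] less_trans[OF _ ennreal_one_less_top] in auto)
  have "(\<lambda>k. LINT z|lborel. norm (?d (k + k0) z)) \<longlonglongrightarrow> 0"
  proof -
    have "ennreal (LINT z|lborel. norm (?d (k + k0) z)) = (\<integral>\<^sup>+z. ennreal (?d (k + k0) z) \<partial>lborel)" for k
      by (subst nn_integral_eq_integral[OF int]) (simp_all only: real_norm_def abs_of_nonneg[OF nn] nn AE_I2)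
    then have "(\<lambda>k. ennreal (LINT z|lborel. norm (?d (k + k0) z))) \<longlonglongrightarrow> ennreal 0"
      using LIMSEQ_ignore_initial_segment[OF lim, of k0] by simp
    then show ?thesis by (subst (asm) tendsto_ennreal_iff) auto
  qed
  from tendsto_L1_AE_subseq[OF int this] obtain s where s: "strict_mono s"
    "AE z in lborel. (\<lambda>k. ?d (s k + k0) z) \<longlonglongrightarrow> 0" by blast
  have "AE z in lborel. z \<in> Q \<longrightarrow> (\<forall>i<N.
     (\<lambda>k. avg (v i) (fst z) (snd z) (\<theta> (snd z)) (r (s k + k0))) \<longlonglongrightarrow> kernel_mass TYPE('a) * v i z)"
    using s(2)
  proof eventually_elim
    case (elim z)
    show ?case
    proof (intro impI allI)
      fix i assume z: "z \<in> Q" and i: "i < N"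
      have "(\<lambda>k. ?e i (s k + k0) z) \<longlonglongrightarrow> 0"
      proof (rule tendsto_sandwich[OF _ _ tendsto_const elim])
        have "?e i (s k + k0) z * indicator Q z \<le> ?d (s k + k0) z" for k
          using i by (intro member_le_sum) auto
        then show "eventually (\<lambda>k. ?e i (s k + k0) z \<le> ?d (s k + k0) z) sequentially"
          using z by simp
      qed auto
      then show "(\<lambda>k. avg (v i) (fst z) (snd z) (\<theta> (snd z)) (r (s k + k0))) \<longlonglongrightarrow> kernel_mass TYPE('a) * v i z"
        using tendsto_rabs_zero_iff LIM_zero_iff by blast
    qed
  qed
  moreover have "strict_mono (\<lambda>k. s k + k0)" using s(1) by (auto simp: strict_mono_def)
  ultimately show ?thesis by blast
qed

section \<open>Linear combinations of weak equations\<close>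

lemma space_weak_sum:
  fixes v :: "nat \<Rightarrow> 'a::euclidean_space \<times> real \<Rightarrow> real"
  assumes v: "\<And>i. i < N \<Longrightarrow> integrable lborel (v i)" and G: "\<And>i. i < N \<Longrightarrow> integrable lborel (G i)"
    and sw: "\<And>i. i < N \<Longrightarrow> space_weak U (v i) (G i)"
  shows "space_weak U (\<lambda>z. \<Sum>i<N. e i * v i z) (\<lambda>z. \<Sum>i<N. e i *\<^sub>R G i z)"
  unfolding space_weak_def
proof (intro allI impI)
  fix \<phi> :: "'a \<Rightarrow> real" and \<beta> :: "real \<Rightarrow> real" and b :: 'a
  assume *: "test_fun U \<phi> \<and> b \<in> Basis \<and> continuous_on UNIV \<beta> \<and> bounded (range \<beta>)"
  obtain B where B: "\<And>x. \<bar>\<phi> x\<bar> \<le> B" "\<And>x. \<bar>frechet_derivative \<phi> (at x) b\<bar> \<le> B"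
    using test_fun_bounded[of U \<phi>] * by blast
  obtain B' where B': "\<And>x. \<bar>\<beta> x\<bar> \<le> B'" using * by (auto simp: bounded_iff)
  note [measurable] = fst_snd_borel
  have [measurable]: "\<phi> \<in> borel_measurable borel" "\<beta> \<in> borel_measurable borel"
    "(\<lambda>x. frechet_derivative \<phi> (at x) b) \<in> borel_measurable borel"
    using test_fun_derivative(2,3)[of U \<phi>] * by (blast intro: borel_measurable_continuous_onI)+
  have c: "(\<lambda>z::'a \<times> real. \<phi> (fst z) * \<beta> (snd z)) \<in> borel_measurable lborel"
    "(\<lambda>z::'a \<times> real. frechet_derivative \<phi> (at (fst z)) b * \<beta> (snd z)) \<in> borel_measurable lborel"
    by measurable
  have b: "\<bar>\<phi> (fst z) * \<beta> (snd z)\<bar> \<le> B * B'" "\<bar>frechet_derivative \<phi> (at (fst z)) b * \<beta> (snd z)\<bar> \<le> B * B'" for z :: "'a \<times> real"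
    unfolding abs_mult using B[of "fst z"] B'[of "snd z"] by (auto intro!: mult_mono)
  have i1: "integrable lborel (\<lambda>z. v i z * (frechet_derivative \<phi> (at (fst z)) b * \<beta> (snd z)))" if "i < N" for i
    by (rule integrable_mult_bounded[OF v[OF that] c(2) b(2)])
  have i2: "integrable lborel (\<lambda>z. (G i z \<bullet> b) * (\<phi> (fst z) * \<beta> (snd z)))" if "i < N" for i
    by (rule integrable_mult_bounded[OF integrable_inner_left c(1) b(1)]) (use G[OF that] in simp)
  have "(LINT z|lborel. (\<Sum>i<N. e i * v i z) * (frechet_derivative \<phi> (at (fst z)) b * \<beta> (snd z)))
    = (LINT z|lborel. (\<Sum>i<N. e i * (v i z * (frechet_derivative \<phi> (at (fst z)) b * \<beta> (snd z)))))"
    by (simp add: sum_distrib_right mult.assoc)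
  also have "\<dots> = (\<Sum>i<N. e i * (LINT z|lborel. v i z * (frechet_derivative \<phi> (at (fst z)) b * \<beta> (snd z))))"
    using i1 by (subst Bochner_Integration.integral_sum) auto
  also have "\<dots> = (\<Sum>i<N. e i * - (LINT z|lborel. (G i z \<bullet> b) * (\<phi> (fst z) * \<beta> (snd z))))"
    using sw * unfolding space_weak_def by (intro sum.cong refl arg_cong2[of _ _ _ _ "(*)"]) auto
  also have "\<dots> = - (LINT z|lborel. (\<Sum>i<N. e i * ((G i z \<bullet> b) * (\<phi> (fst z) * \<beta> (snd z)))))"
    using i2 by (subst Bochner_Integration.integral_sum) (auto simp: sum_negf)
  also have "\<dots> = - (LINT z|lborel. ((\<Sum>i<N. e i *\<^sub>R G i z) \<bullet> b) * (\<phi> (fst z) * \<beta> (snd z)))"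
    by (simp add: sum_distrib_right mult.assoc inner_sum_left)
  finally show "(LINT z|lborel. (\<Sum>i<N. e i * v i z) * (frechet_derivative \<phi> (at (fst z)) b * \<beta> (snd z)))
    = - (LINT z|lborel. ((\<Sum>i<N. e i *\<^sub>R G i z) \<bullet> b) * (\<phi> (fst z) * \<beta> (snd z)))" .
qed

lemma integrable_inner_bounded:
  fixes H :: "'b \<Rightarrow> 'a::euclidean_space"
  assumes H: "integrable M H" and k: "k \<in> borel_measurable M" "\<And>z. norm (k z) \<le> B"
  shows "integrable M (\<lambda>z. H z \<bullet> k z)"
proof (rule Bochner_Integration.integrable_bound[of _ "\<lambda>z. norm (H z) * B"])
  show "(\<lambda>z. H z \<bullet> k z) \<in> borel_measurable M"
    using H k by (intro borel_measurable_inner) auto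
  show "AE z in M. norm (H z \<bullet> k z) \<le> norm (norm (H z) * B)"
  proof (intro AE_I2)
    fix z
    have "norm (H z \<bullet> k z) \<le> norm (H z) * norm (k z)" by (simp add: Cauchy_Schwarz_ineq2)
    also have "\<dots> \<le> norm (H z) * B" by (intro mult_left_mono k) auto
    finally show "norm (H z \<bullet> k z) \<le> norm (norm (H z) * B)" by simp
  qed
qed (use H in auto)

lemma time_weak_sum:
  fixes v :: "nat \<Rightarrow> 'a::euclidean_space \<times> real \<Rightarrow> real"
  assumes v: "\<And>i. i < N \<Longrightarrow> integrable lborel (v i)" and H: "\<And>i. i < N \<Longrightarrow> integrable lborel (H i)"
    and tw: "\<And>i. i < N \<Longrightarrow> time_weak D (v i) (H i)"
  shows "time_weak D (\<lambda>z. \<Sum>i<N. e i * v i z) (\<lambda>z. \<Sum>i<N. e i *\<^sub>R H i z)"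
  unfolding time_weak_def
proof (intro allI impI)
  fix \<psi> :: "'a \<times> real \<Rightarrow> real" assume \<psi>: "test_fun D \<psi>"
  obtain B where B: "\<And>z. \<bar>time_deriv \<psi> z\<bar> \<le> B" "\<And>z. norm (space_grad \<psi> z) \<le> B"
    using test_fun_time_space_bounded[OF \<psi>] by blast
  have c: "time_deriv \<psi> \<in> borel_measurable lborel" "space_grad \<psi> \<in> borel_measurable lborel"
    using test_fun_time_space_continuous[OF \<psi>] by (auto intro: borel_measurable_continuous_onI)
  have i1: "integrable lborel (\<lambda>z. v i z * time_deriv \<psi> z)" if "i < N" for i
    by (rule integrable_mult_bounded[OF v[OF that] c(1) B(1)])
  have i2: "integrable lborel (\<lambda>z. H i z \<bullet> space_grad \<psi> z)" if "i < N" for i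
    by (rule integrable_inner_bounded[OF H[OF that] c(2) B(2)])
  have "(LINT z|lborel. (\<Sum>i<N. e i * v i z) * time_deriv \<psi> z) = (LINT z|lborel. (\<Sum>i<N. e i * (v i z * time_deriv \<psi> z)))"
    by (simp add: sum_distrib_right mult.assoc)
  also have "\<dots> = (\<Sum>i<N. e i * (LINT z|lborel. v i z * time_deriv \<psi> z))"
    using i1 by (subst Bochner_Integration.integral_sum) auto
  also have "\<dots> = (\<Sum>i<N. e i * (LINT z|lborel. H i z \<bullet> space_grad \<psi> z))"
    using tw \<psi> unfolding time_weak_def by (intro sum.cong refl arg_cong2[of _ _ _ _ "(*)"]) auto
  also have "\<dots> = (LINT z|lborel. (\<Sum>i<N. e i * (H i z \<bullet> space_grad \<psi> z)))"
    using i2 by (subst Bochner_Integration.integral_sum) auto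
  also have "\<dots> = (LINT z|lborel. (\<Sum>i<N. e i *\<^sub>R H i z) \<bullet> space_grad \<psi> z)"
    by (simp add: inner_sum_left)
  finally show "(LINT z|lborel. (\<Sum>i<N. e i * v i z) * time_deriv \<psi> z) = (LINT z|lborel. (\<Sum>i<N. e i *\<^sub>R H i z) \<bullet> space_grad \<psi> z)" .
qed

section \<open>Vector norms and duality\<close>

lemma vnorm_L2: "vnorm N v = L2_set (\<lambda>i. norm (v i)) {..<N}"
  by (simp add: vnorm_def vinner_def L2_set_def dot_square_norm)

lemma vnorm_nonneg: "0 \<le> vnorm N v"
  by (simp add: vnorm_L2)

lemma norm_comp_le_vnorm: "i < N \<Longrightarrow> norm (v i) \<le> vnorm N v"
  unfolding vnorm_L2 using member_le_L2_set[of "{..<N}" i "\<lambda>i. norm (v i)"] by simp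

text \<open>
  One half of the duality that transfers estimates between systems and scalar functions: the linear
  combination with a vector \<open>e\<close> in the unit ball of \<open>R^N\<close> inherits the bounds on the whole system.
\<close>

lemma norm_sum_le_vnorm:
  assumes "(\<Sum>i<N. (e i)\<^sup>2) \<le> 1"
  shows "norm (\<Sum>i<N. e i *\<^sub>R G i) \<le> vnorm N G"
proof -
  have "norm (\<Sum>i<N. e i *\<^sub>R G i) \<le> (\<Sum>i<N. \<bar>e i\<bar> * \<bar>norm (G i)\<bar>)"
    by (rule order_trans[OF norm_sum]) simp
  also have "\<dots> \<le> L2_set e {..<N} * L2_set (\<lambda>i. norm (G i)) {..<N}"
    by (rule L2_set_mult_ineq)
  also have "\<dots> \<le> 1 * vnorm N G"
    unfolding vnorm_L2 using assms by (intro mult_right_mono[OF _ L2_set_nonneg]) (auto simp: L2_set_def)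
  finally show ?thesis by simp
qed

text \<open>
  The other half: it is enough to bound the components along unit vectors \<open>e\<close>, the extremal one being
  \<open>d / |d|\<close>.
\<close>

lemma vnorm_le_dual:
  fixes d :: "nat \<Rightarrow> real"
  assumes "\<And>e. (\<Sum>i<N. (e i)\<^sup>2) \<le> 1 \<Longrightarrow> (\<Sum>i<N. e i * d i) \<le> B"
  shows "vnorm N d \<le> B"
proof (cases "vnorm N d = 0")
  case True
  then show ?thesis using assms[of "\<lambda>_. 0"] by simp
next
  case False
  have sq: "(vnorm N d)\<^sup>2 = (\<Sum>i<N. (d i)\<^sup>2)"
    by (simp add: vnorm_L2 L2_set_def sum_nonneg)
  have "(\<Sum>i<N. (d i / vnorm N d)\<^sup>2) = (\<Sum>i<N. (d i)\<^sup>2) / (vnorm N d)\<^sup>2"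
    by (simp add: power_divide sum_divide_distrib)
  also have "\<dots> = 1" using False by (simp add: sq[symmetric])
  finally have "(\<Sum>i<N. d i / vnorm N d * d i) \<le> B" by (intro assms) simp
  also have "(\<Sum>i<N. d i / vnorm N d * d i) = (\<Sum>i<N. (d i)\<^sup>2) / vnorm N d"
    by (simp add: sum_divide_distrib power2_eq_square)
  also have "\<dots> = vnorm N d" unfolding sq[symmetric] using False by (simp add: power2_eq_square)
  finally show ?thesis .
qed

lemma vnorm_triangle: "vnorm N (\<lambda>i. v i + w i) \<le> vnorm N v + vnorm N (w :: nat \<Rightarrow> real)"
proof -
  have "vnorm N (\<lambda>i. v i + w i) = L2_set (\<lambda>i. v i + w i) {..<N}" "vnorm N v = L2_set v {..<N}"
    "vnorm N w = L2_set w {..<N}"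
    by (auto simp: vnorm_L2 L2_set_def)
  then show ?thesis by (simp add: L2_set_triangle_ineq)
qed

lemma vnorm_cong: "(\<And>i. i < N \<Longrightarrow> v i = w i) \<Longrightarrow> vnorm N v = vnorm N w"
  by (simp add: vnorm_def vinner_def)

lemma vnorm_scaleR: "vnorm N (\<lambda>i. c *\<^sub>R v i) = \<bar>c\<bar> * vnorm N v"
  by (simp add: vnorm_L2 L2_set_right_distrib)

lemma vnorm_diff_le: "vnorm N (\<lambda>i. v i - w i) \<le> vnorm N v + vnorm N w"
proof -
  have "vnorm N (\<lambda>i. v i - w i) \<le> L2_set (\<lambda>i. norm (v i) + norm (w i)) {..<N}"
    unfolding vnorm_L2 by (intro L2_set_mono norm_triangle_ineq4) auto
  also have "\<dots> \<le> vnorm N v + vnorm N w" unfolding vnorm_L2 by (rule L2_set_triangle_ineq)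
  finally show ?thesis .
qed

lemma vnorm_measurable:
  assumes "\<And>i. i < N \<Longrightarrow> (\<lambda>z. f z i) \<in> borel_measurable M"
  shows "(\<lambda>z. vnorm N (f z)) \<in> borel_measurable M"
  unfolding vnorm_def vinner_def
  by (intro measurable_compose[OF _ borel_measurable_sqrt] borel_measurable_sum borel_measurable_inner) (use assms in auto)

lemma vnorm_scale: "vnorm N (\<lambda>i. c * v i) = \<bar>c\<bar> * vnorm N (v :: nat \<Rightarrow> real)"
  using vnorm_scaleR[of N c v] by simp

section \<open>The strong maximal function\<close>

lemma lebesgue_mean_eq:
  assumes [measurable]: "S \<in> sets borel"
  shows "mean_on S f = (\<integral>\<^sup>+z\<in>S. f z \<partial>lborel) / emeasure lborel S"
  unfolding mean_on_def by (simp add: nn_integral_completion)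

lemma strong_maximal_ge:
  assumes "0 < r" "a < b" "z \<in> ball y r \<times> {a<..<b}"
  shows "mean_on (ball y r \<times> {a<..<b}) (\<lambda>\<zeta>. ennreal \<bar>f \<zeta>\<bar>) \<le> strong_maximal f z"
  unfolding strong_maximal_def by (rule SUP_upper2[of "(y, r, a, b)"]) (use assms in auto)

text \<open>
  The maximal function is lower semicontinuous, because a cylinder that is admissible for \<open>z\<close> is
  admissible for every other point in it.
\<close>

lemma strong_maximal_measurable [measurable]: "strong_maximal f \<in> borel_measurable borel"
proof (rule borel_measurableI_greater)
  fix c
  have "open {z. c < strong_maximal f z}"
  proof (subst open_subopen, intro ballI)
    fix z assume "z \<in> {z. c < strong_maximal f z}"
    then obtain y r a b where *: "0 < r" "a < b" "z \<in> ball y r \<times> {a<..<b}"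
       "c < mean_on (ball y r \<times> {a<..<b}) (\<lambda>\<zeta>. ennreal \<bar>f \<zeta>\<bar>)"
      unfolding strong_maximal_def by (auto simp: less_SUP_iff)
    then show "\<exists>T. open T \<and> z \<in> T \<and> T \<subseteq> {z. c < strong_maximal f z}"
    proof (intro exI conjI)
      show "open (ball y r \<times> {a<..<b})" by (intro open_Times) auto
      show "z \<in> ball y r \<times> {a<..<b}" by fact
      show "ball y r \<times> {a<..<b} \<subseteq> {z. c < strong_maximal f z}"
        using less_le_trans[OF *(4) strong_maximal_ge[OF *(1,2)]] by blast
    qed
  qed
  then show "{x \<in> space borel. c < strong_maximal f x} \<in> sets borel" by simp
qed

lemma strong_maximal_cong_AE:
  assumes "AE z in lborel. \<bar>f z\<bar> = \<bar>g z\<bar>"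
  shows "strong_maximal f = strong_maximal g"
proof -
  have "mean_on S (\<lambda>\<zeta>. ennreal \<bar>f \<zeta>\<bar>) = mean_on S (\<lambda>\<zeta>. ennreal \<bar>g \<zeta>\<bar>)" for S
    unfolding mean_on_def using AE_completion[OF assms]
    by (intro arg_cong2[of _ _ _ _ "(/)"] nn_integral_cong_AE refl) (auto elim!: eventually_mono)
  then show ?thesis unfolding strong_maximal_def by (intro ext) simp
qed

lemma ennreal_mult_divide_cancel:
  assumes "0 < m"
  shows "ennreal m * (A / ennreal m) = A"
proof -
  have "ennreal m \<noteq> 0" "ennreal m \<noteq> top" using assms by (auto simp: ennreal_eq_0_iff)
  then show ?thesis by (simp add: ennreal_times_divide mult.commute[of "ennreal m"] mult_divide_eq_ennreal)
qed

text \<open>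
  The cylinder is admissible for every point \<open>(x, s)\<close> with \<open>s\<close> in its window, not just for \<open>(x, t)\<close>.
  This freedom is what creates the potential in time.
\<close>

lemma cyl_integral_le_maximal:
  fixes x :: "'a::euclidean_space"
  assumes h: "integrable lborel h" "\<And>z. 0 \<le> h z" and r: "0 < r" and s: "s \<in> window t \<theta> r"
  shows "ennreal (LINT z|lborel. indicator (cyl x t \<theta> r) z * h z)
    \<le> ennreal (2 * unit_ball_vol DIM('a) * r ^ (DIM('a) + 2)) * strong_maximal h (x, s)"
proof -
  have [measurable]: "h \<in> borel_measurable borel" using h by (auto dest: borel_measurable_integrable)
  let ?m = "2 * unit_ball_vol DIM('a) * r ^ (DIM('a) + 2)"
  have m: "0 < ?m" using r unit_ball_vol_pos[OF of_nat_0_le_iff, of "DIM('a)"] by simp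
  from integrable_cyl[OF h(1), of x t \<theta> r] have "ennreal (LINT z|lborel. indicator (cyl x t \<theta> r) z * h z)
     = (\<integral>\<^sup>+z. ennreal (indicator (cyl x t \<theta> r) z * h z) \<partial>lborel)"
    by (intro nn_integral_eq_integral[symmetric]) (use h in auto)
  also have "\<dots> = (\<integral>\<^sup>+z\<in>cyl x t \<theta> r. ennreal \<bar>h z\<bar> \<partial>lborel)"
    by (intro nn_integral_cong) (use h in \<open>auto simp: indicator_def\<close>)
  also have "\<dots> = ennreal ?m * mean_on (cyl x t \<theta> r) (\<lambda>z. ennreal \<bar>h z\<bar>)"
    unfolding lebesgue_mean_eq[OF cyl_measurable] emeasure_cyl[OF r]
    by (rule ennreal_mult_divide_cancel[OF m, symmetric])
  also have "\<dots> \<le> ennreal ?m * strong_maximal h (x, s)"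
    unfolding cyl_def window_def using r s by (intro mult_left_mono strong_maximal_ge) (auto simp: window_def)
  finally show ?thesis .
qed

section \<open>The pointwise estimate by a potential\<close>

text \<open>
  The last summand dominates the sum of the earlier ones. The second bound feeds the induction for
  the first.
\<close>

lemma geometric_cutoff:
  fixes X :: real
  assumes "0 \<le> X"
  shows "(\<Sum>k<K. if 2 ^ k \<le> X then 2 ^ k else 0) \<le> 2 * X"
    and "(\<Sum>k<K. if 2 ^ k \<le> X then 2 ^ k else 0) \<le> (2 ^ K :: real)"
proof (induction K)
  case (Suc K)
  { case 1 then show ?case using Suc assms by auto }
  { case 2 then show ?case using Suc by auto }
qed (use assms in auto)

text \<open>
  What the estimate uses of a weak solution, after localisation to \<open>2Q\<close>: Borel functions on the whole
  space, \<open>G\<close> the gradient and \<open>H\<close> the flux of \<open>v\<close>, and a common majorant \<open>h\<close>.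
\<close>

locale parabolic_data =
  fixes N :: nat and v :: "nat \<Rightarrow> 'a::euclidean_space \<times> real \<Rightarrow> real"
    and G H :: "nat \<Rightarrow> 'a \<times> real \<Rightarrow> 'a" and h :: "'a \<times> real \<Rightarrow> real"
    and \<Lambda> :: real and x0 :: 'a and t0 \<rho> :: real
  assumes v: "\<And>i. i < N \<Longrightarrow> integrable lborel (v i)"
    and G: "\<And>i. i < N \<Longrightarrow> integrable lborel (G i)"
    and H: "\<And>i. i < N \<Longrightarrow> integrable lborel (H i)"
    and h: "integrable lborel h" "\<And>z. 0 \<le> h z"
    and Gh: "AE z in lborel. vnorm N (\<lambda>i. G i z) \<le> h z"
    and Hh: "AE z in lborel. vnorm N (\<lambda>i. H i z) \<le> \<Lambda> * h z"
    and sw: "\<And>i. i < N \<Longrightarrow> space_weak (ball x0 (2 * \<rho>)) (v i) (G i)"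
    and tw: "\<And>i. i < N \<Longrightarrow> time_weak (ball x0 (2 * \<rho>) \<times> tint t0 (2 * \<rho>)) (v i) (H i)"
    and \<Lambda>: "0 \<le> \<Lambda>" and \<rho>: "0 < \<rho>"
begin

text \<open>
  With this shift the window at scale \<open>r\<close> is the image of \<open>tint t0 \<rho>\<close> under the homothety with centre
  \<open>t\<close> and ratio \<open>(r / \<rho>)^2\<close>. The value outside \<open>tint t0 \<rho>\<close> is a default that keeps \<open>|\<theta>| \<le> 1\<close>.
\<close>

definition \<theta> :: "real \<Rightarrow> real" where
  "\<theta> t = (if t \<in> tint t0 \<rho> then (t0 - t) / \<rho>\<^sup>2 else 0)"

lemma theta_bound: "\<bar>\<theta> t\<bar> \<le> 1"
  using \<rho> by (auto simp: \<theta>_def tint_def abs_le_iff field_simps)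

lemma theta_measurable [measurable]: "\<theta> \<in> borel_measurable borel"
  unfolding \<theta>_def[abs_def] tint_def by measurable

lemma window_rho: "t \<in> tint t0 \<rho> \<Longrightarrow> window t (\<theta> t) \<rho> = tint t0 \<rho>"
  and closed_window_rho: "t \<in> tint t0 \<rho> \<Longrightarrow> closed_window t (\<theta> t) \<rho> = {t0 - \<rho>\<^sup>2 .. t0 + \<rho>\<^sup>2}"
proof -
  assume "t \<in> tint t0 \<rho>"
  then have "\<rho>\<^sup>2 * \<theta> t = t0 - t" using \<rho> by (simp add: \<theta>_def)
  then have "t + \<rho>\<^sup>2 * (\<theta> t - 1) = t0 - \<rho>\<^sup>2" "t + \<rho>\<^sup>2 * (\<theta> t + 1) = t0 + \<rho>\<^sup>2"
    by (simp_all add: right_diff_distrib distrib_left)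
  then show "window t (\<theta> t) \<rho> = tint t0 \<rho>" "closed_window t (\<theta> t) \<rho> = {t0 - \<rho>\<^sup>2 .. t0 + \<rho>\<^sup>2}"
    by (simp_all add: window_def closed_window_def tint_def)
qed

text \<open>
  At the largest scale all points of the time interval share one kernel. This makes the base value of
  the telescoping sum independent of \<open>t\<close>.
\<close>

lemma kernel_rho:
  assumes "t \<in> tint t0 \<rho>"
  shows "kernel x t (\<theta> t) \<rho> z = kernel x t0 0 \<rho> z"
proof -
  have "(s - t) / \<rho>\<^sup>2 - (t0 - t) / \<rho>\<^sup>2 = (s - t0) / \<rho>\<^sup>2" for s by (simp add: diff_divide_distrib)
  then show ?thesis using assms by (simp add: kernel_def tbump_def \<theta>_def)
qed

definition step_const :: real where
  "step_const = (1 + 16 * \<Lambda>) * 2 ^ (DIM('a) + 2) * unit_ball_vol DIM('a)"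

lemma step_const_pos: "0 < step_const"
  using \<Lambda> unit_ball_vol_pos[OF of_nat_0_le_iff, of "DIM('a)"] by (simp add: step_const_def add_pos_nonneg)

text \<open>
  \<open>avg_step\<close> for the scalar function \<open>\<Sum> e i * v i\<close>, whose gradient and flux have the majorants of the
  system; the supremum over \<open>e\<close> gives the Euclidean norm with a constant that is independent of \<open>N\<close>.
\<close>

lemma vector_step:
  assumes x: "x \<in> ball x0 \<rho>" and t: "t \<in> tint t0 \<rho>" and r: "0 < r" "r \<le> \<rho>"
  shows "vnorm N (\<lambda>i. avg (v i) x t (\<theta> t) r - avg (v i) x t (\<theta> t) (r / 2))
     \<le> (1 + 16 * \<Lambda>) * 2 ^ (DIM('a) + 1) / r ^ (DIM('a) + 1) * (LINT z|lborel. indicator (cyl x t (\<theta> t) r) z * h z)"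
proof (rule vnorm_le_dual)
  fix e :: "nat \<Rightarrow> real" assume e: "(\<Sum>i<N. (e i)\<^sup>2) \<le> 1"
  let ?v = "\<lambda>z. \<Sum>i<N. e i * v i z" and ?G = "\<lambda>z. \<Sum>i<N. e i *\<^sub>R G i z" and ?H = "\<lambda>z. \<Sum>i<N. e i *\<^sub>R H i z"
  have avg: "avg ?v x t (\<theta> t) r' = (\<Sum>i<N. e i * avg (v i) x t (\<theta> t) r')" if "0 < r'" for r'
  proof -
    have int: "integrable lborel (\<lambda>z. v i z * kernel x t (\<theta> t) r' z)" if "i < N" for i
    proof (rule integrable_mult_bounded[OF v[OF that], of _ "1 / r' ^ (DIM('a) + 2)"])
      show "\<bar>kernel x t (\<theta> t) r' z\<bar> \<le> 1 / r' ^ (DIM('a) + 2)" for z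
        using kernel_bound[OF \<open>0 < r'\<close>, of x t "\<theta> t" z] by simp
    qed (use kernel_measurable[OF \<open>0 < r'\<close>] in simp)
    have "avg ?v x t (\<theta> t) r' = (LINT z|lborel. (\<Sum>i<N. e i * (v i z * kernel x t (\<theta> t) r' z)))"
      unfolding avg_def by (simp add: sum_distrib_right mult.assoc)
    also have "\<dots> = (\<Sum>i<N. e i * avg (v i) x t (\<theta> t) r')"
      unfolding avg_def using int by (subst Bochner_Integration.integral_sum) auto
    finally show ?thesis .
  qed
  have "\<bar>avg ?v x t (\<theta> t) r - avg ?v x t (\<theta> t) (r / 2)\<bar>
     \<le> (1 + 16 * \<Lambda>) * 2 ^ (DIM('a) + 1) / r ^ (DIM('a) + 1) * (LINT z|lborel. indicator (cyl x t (\<theta> t) r) z * h z)"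
  proof (rule avg_step[where U="ball x0 (2 * \<rho>)" and J="tint t0 (2 * \<rho>)"])
    show "integrable lborel ?v" "integrable lborel ?G" "integrable lborel ?H" "integrable lborel h"
      using v G H h by auto
    show "AE z in lborel. norm (?G z) \<le> h z"
      using Gh by eventually_elim (use norm_sum_le_vnorm[OF e] in \<open>rule order_trans\<close>)
    show "AE z in lborel. norm (?H z) \<le> \<Lambda> * h z"
      using Hh by eventually_elim (use norm_sum_le_vnorm[OF e] in \<open>rule order_trans\<close>)
    show "space_weak (ball x0 (2 * \<rho>)) ?v ?G" by (rule space_weak_sum[OF v G sw])
    show "time_weak (ball x0 (2 * \<rho>) \<times> tint t0 (2 * \<rho>)) ?v ?H" by (rule time_weak_sum[OF v H tw])
    show "cball x r \<subseteq> ball x0 (2 * \<rho>)"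
    proof
      fix y assume "y \<in> cball x r"
      then show "y \<in> ball x0 (2 * \<rho>)"
        using x r dist_triangle[of x0 y x] by auto
    qed
    show "closed_window t (\<theta> t) r \<subseteq> tint t0 (2 * \<rho>)"
      using closed_window_mono[of r \<rho> "\<theta> t" t] closed_window_rho[OF t] theta_bound r \<rho> by (auto simp: tint_def power_mult_distrib subset_iff) (smt (verit) zero_less_power)+
  qed (use \<Lambda> r theta_bound in auto)
  then show "(\<Sum>i<N. e i * (avg (v i) x t (\<theta> t) r - avg (v i) x t (\<theta> t) (r / 2)))
    \<le> (1 + 16 * \<Lambda>) * 2 ^ (DIM('a) + 1) / r ^ (DIM('a) + 1) * (LINT z|lborel. indicator (cyl x t (\<theta> t) r) z * h z)"
    using r by (simp add: avg right_diff_distrib sum_subtractf abs_le_iff)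
qed

lemma vector_step_maximal:
  assumes x: "x \<in> ball x0 \<rho>" and t: "t \<in> tint t0 \<rho>" and r: "0 < r" "r \<le> \<rho>"
    and s: "s \<in> window t (\<theta> t) r"
  shows "ennreal (vnorm N (\<lambda>i. avg (v i) x t (\<theta> t) r - avg (v i) x t (\<theta> t) (r / 2)))
     \<le> ennreal (step_const * r) * strong_maximal h (x, s)"
proof -
  let ?c = "(1 + 16 * \<Lambda>) * 2 ^ (DIM('a) + 1) / r ^ (DIM('a) + 1)"
  have c: "0 \<le> ?c" using \<Lambda> r by simp
  have "ennreal (vnorm N (\<lambda>i. avg (v i) x t (\<theta> t) r - avg (v i) x t (\<theta> t) (r / 2)))
     \<le> ennreal (?c * (LINT z|lborel. indicator (cyl x t (\<theta> t) r) z * h z))"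
    by (intro ennreal_leI vector_step x t r)
  also have "\<dots> = ennreal ?c * ennreal (LINT z|lborel. indicator (cyl x t (\<theta> t) r) z * h z)"
    by (rule ennreal_mult'[OF c])
  also have "\<dots> \<le> ennreal ?c * (ennreal (2 * unit_ball_vol DIM('a) * r ^ (DIM('a) + 2)) * strong_maximal h (x, s))"
    by (intro mult_left_mono cyl_integral_le_maximal h r s) simp
  also have "\<dots> = ennreal (step_const * r) * strong_maximal h (x, s)"
  proof -
    have "?c * (2 * unit_ball_vol DIM('a) * r ^ (DIM('a) + 2)) = step_const * r"
      using r by (simp add: step_const_def field_simps)
    then show ?thesis using c by (simp only: mult.assoc[symmetric] ennreal_mult'[symmetric])
  qed
  finally show ?thesis .
qed

text \<open>
  The preceding bound holds for every \<open>s\<close> in the window, of length \<open>2 r^2\<close>; this is its mean over the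
  window.
\<close>

lemma vector_step_integral:
  assumes x: "x \<in> ball x0 \<rho>" and t: "t \<in> tint t0 \<rho>" and r: "0 < r" "r \<le> \<rho>"
  shows "ennreal (vnorm N (\<lambda>i. avg (v i) x t (\<theta> t) r - avg (v i) x t (\<theta> t) (r / 2)))
     \<le> (\<integral>\<^sup>+s. ennreal (step_const / (2 * r)) * indicator (window t (\<theta> t) r) s * strong_maximal h (x, s) \<partial>lborel)"
proof -
  let ?V = "vnorm N (\<lambda>i. avg (v i) x t (\<theta> t) r - avg (v i) x t (\<theta> t) (r / 2))"
  have em: "emeasure lborel (window t (\<theta> t) r) = ennreal (2 * r\<^sup>2)"
    unfolding window_def using r by (subst emeasure_lborel_Ioo) (auto simp: algebra_simps)
  have [measurable]: "window t (\<theta> t) r \<in> sets borel" unfolding window_def by simp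
  have "ennreal ?V = (\<integral>\<^sup>+s. ennreal (?V / (2 * r\<^sup>2)) * indicator (window t (\<theta> t) r) s \<partial>lborel)"
    using r vnorm_nonneg[of N] by (simp add: nn_integral_cmult_indicator em ennreal_mult''[symmetric] del: ennreal_mult'')
  also have "\<dots> \<le> (\<integral>\<^sup>+s. ennreal (step_const / (2 * r)) * indicator (window t (\<theta> t) r) s * strong_maximal h (x, s) \<partial>lborel)"
  proof (rule nn_integral_mono)
    fix s
    show "ennreal (?V / (2 * r\<^sup>2)) * indicator (window t (\<theta> t) r) s
       \<le> ennreal (step_const / (2 * r)) * indicator (window t (\<theta> t) r) s * strong_maximal h (x, s)"
    proof (cases "s \<in> window t (\<theta> t) r")
      case True
      have "ennreal (?V / (2 * r\<^sup>2)) = ennreal (1 / (2 * r\<^sup>2)) * ennreal ?V"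
        using r by (simp add: ennreal_mult'[symmetric])
      also have "\<dots> \<le> ennreal (1 / (2 * r\<^sup>2)) * (ennreal (step_const * r) * strong_maximal h (x, s))"
        by (intro mult_left_mono vector_step_maximal x t r True) simp
      also have "\<dots> = ennreal (step_const / (2 * r)) * strong_maximal h (x, s)"
        using r step_const_pos by (simp add: mult.assoc[symmetric] ennreal_mult'[symmetric] power2_eq_square)
      finally show ?thesis using True by simp
    qed simp
  qed
  finally show ?thesis .
qed

text \<open>
  The point \<open>s\<close> lies in the window at scale \<open>\<rho> / 2^k\<close> only if \<open>|t - s| \<le> 2 (\<rho> / 2^k)^2\<close>, hence only
  if \<open>2^k\<close> is at most the number \<open>X\<close> of the proof. Up to that index the weights grow geometrically, so
  their sum is comparable with the last one.
\<close>

lemma dyadic_sum: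
  assumes "s \<noteq> t" 
  shows "(\<Sum>k<K. step_const / (2 * (\<rho> / 2 ^ k)) * indicator (window t (\<theta> t) (\<rho> / 2 ^ k)) s) \<le> 2 * step_const * (1 / sqrt \<bar>t - s\<bar>)"
proof -
  define X where "X = 2 * \<rho> / sqrt \<bar>t - s\<bar>"
  have d: "0 < \<bar>t - s\<bar>" using assms by simp
  have X: "0 \<le> X" using \<rho> by (simp add: X_def)
  have "(\<Sum>k<K. step_const / (2 * (\<rho> / 2 ^ k)) * indicator (window t (\<theta> t) (\<rho> / 2 ^ k)) s)
     \<le> (\<Sum>k<K. step_const / (2 * \<rho>) * (if 2 ^ k \<le> X then 2 ^ k else 0))"
  proof (rule sum_mono)
    fix k
    have "2 ^ k \<le> X" if "s \<in> window t (\<theta> t) (\<rho> / 2 ^ k)"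
    proof -
      have "\<bar>t - s\<bar> \<le> 2 * (\<rho> / 2 ^ k)\<^sup>2"
        using window_dist[OF that theta_bound] by (simp add: abs_minus_commute)
      also have "\<dots> \<le> (2 * (\<rho> / 2 ^ k))\<^sup>2"
        unfolding power_mult_distrib[of 2] by (intro mult_right_mono) auto
      finally have "sqrt \<bar>t - s\<bar> \<le> 2 * (\<rho> / 2 ^ k)"
        using \<rho> by (simp add: real_le_lsqrt)
      then show ?thesis using d \<rho> by (simp add: X_def field_simps)
    qed
    then show "step_const / (2 * (\<rho> / 2 ^ k)) * indicator (window t (\<theta> t) (\<rho> / 2 ^ k)) s
       \<le> step_const / (2 * \<rho>) * (if 2 ^ k \<le> X then 2 ^ k else 0)"
      using step_const_pos \<rho> by (auto simp: indicator_def)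
  qed
  also have "\<dots> = step_const / (2 * \<rho>) * (\<Sum>k<K. if 2 ^ k \<le> X then 2 ^ k else 0)"
    by (rule sum_distrib_left[symmetric])
  also have "\<dots> \<le> step_const / (2 * \<rho>) * (2 * X)"
    using step_const_pos \<rho> by (intro mult_left_mono geometric_cutoff X) auto
  also have "\<dots> = 2 * step_const * (1 / sqrt \<bar>t - s\<bar>)"
    using \<rho> by (simp add: X_def)
  finally show ?thesis .
qed

definition maximal_potential :: "'a \<Rightarrow> real \<Rightarrow> ennreal" where
  "maximal_potential x t = (\<integral>\<^sup>+s\<in>tint t0 \<rho>. strong_maximal h (x, s) * ennreal (1 / sqrt \<bar>t - s\<bar>) \<partial>lborel)"

text \<open>
  The sum of the dyadic steps, with the sum over scales taken under the integral in \<open>s\<close>. Windows are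
  contained in \<open>tint t0 \<rho>\<close>, so nothing outside the interval enters.
\<close>

lemma telescoped_estimate:
  assumes x: "x \<in> ball x0 \<rho>" and t: "t \<in> tint t0 \<rho>"
  shows "ennreal (vnorm N (\<lambda>i. avg (v i) x t (\<theta> t) (\<rho> / 2 ^ K) - avg (v i) x t (\<theta> t) \<rho>))
     \<le> ennreal (2 * step_const) * maximal_potential x t"
proof -
  let ?a = "\<lambda>k i. avg (v i) x t (\<theta> t) (\<rho> / 2 ^ k)"
  let ?k = "\<lambda>k s. step_const / (2 * (\<rho> / 2 ^ k)) * indicator (window t (\<theta> t) (\<rho> / 2 ^ k)) s"
  have [measurable]: "window t (\<theta> t) r \<in> sets borel" for r unfolding window_def by simp
  have [measurable]: "(\<lambda>s. strong_maximal h (x, s)) \<in> borel_measurable borel" 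
    by (rule measurable_compose[OF _ strong_maximal_measurable])
       (auto intro!: borel_measurable_continuous_onI continuous_intros)
  have sub: "window t (\<theta> t) (\<rho> / 2 ^ k) \<subseteq> tint t0 \<rho>" for k
    using window_mono[of "\<rho> / 2 ^ k" \<rho> "\<theta> t" t] window_rho[OF t] theta_bound \<rho> by (simp add: divide_le_eq)
  have tri: "vnorm N (\<lambda>i. ?a K i - ?a 0 i) \<le> (\<Sum>k<K. vnorm N (\<lambda>i. ?a k i - ?a (Suc k) i))"
  proof (induction K)
    case 0
    then show ?case by (simp add: vnorm_def vinner_def)
  next
    case (Suc K)
    have "vnorm N (\<lambda>i. ?a (Suc K) i - ?a 0 i) = vnorm N (\<lambda>i. (?a K i - ?a 0 i) + (-1) * (?a K i - ?a (Suc K) i))"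
      by simp
    also have "\<dots> \<le> vnorm N (\<lambda>i. ?a K i - ?a 0 i) + vnorm N (\<lambda>i. (-1) * (?a K i - ?a (Suc K) i))"
      by (rule vnorm_triangle)
    also have "\<dots> = vnorm N (\<lambda>i. ?a K i - ?a 0 i) + vnorm N (\<lambda>i. ?a K i - ?a (Suc K) i)"
      unfolding vnorm_scale by simp
    finally show ?case using Suc by simp
  qed
  have "ennreal (vnorm N (\<lambda>i. ?a K i - ?a 0 i)) \<le> (\<Sum>k<K. ennreal (vnorm N (\<lambda>i. ?a k i - ?a (Suc k) i)))"
    using tri by (simp add: sum_ennreal vnorm_nonneg ennreal_leI)
  also have "\<dots> \<le> (\<Sum>k<K. \<integral>\<^sup>+s. ennreal (step_const / (2 * (\<rho> / 2 ^ k))) * indicator (window t (\<theta> t) (\<rho> / 2 ^ k)) s * strong_maximal h (x, s) \<partial>lborel)"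
  proof (rule sum_mono)
    fix k
    show "ennreal (vnorm N (\<lambda>i. ?a k i - ?a (Suc k) i)) \<le>
      (\<integral>\<^sup>+s. ennreal (step_const / (2 * (\<rho> / 2 ^ k))) * indicator (window t (\<theta> t) (\<rho> / 2 ^ k)) s * strong_maximal h (x, s) \<partial>lborel)"
      using vector_step_integral[OF x t, of "\<rho> / 2 ^ k"] \<rho> by (simp add: divide_le_eq mult.commute)
  qed
  also have "\<dots> = (\<integral>\<^sup>+s. (\<Sum>k<K. ennreal (step_const / (2 * (\<rho> / 2 ^ k))) * indicator (window t (\<theta> t) (\<rho> / 2 ^ k)) s * strong_maximal h (x, s)) \<partial>lborel)"
    by (rule nn_integral_sum[symmetric]) measurable
  also have "\<dots> \<le> (\<integral>\<^sup>+s. ennreal (2 * step_const) * (strong_maximal h (x, s) * ennreal (1 / sqrt \<bar>t - s\<bar>) * indicator (tint t0 \<rho>) s) \<partial>lborel)"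
  proof (rule nn_integral_mono_AE)
    have "AE s in lborel. s \<noteq> t" by (rule AE_lborel_singleton)
    then show "AE s in lborel. (\<Sum>k<K. ennreal (step_const / (2 * (\<rho> / 2 ^ k))) * indicator (window t (\<theta> t) (\<rho> / 2 ^ k)) s * strong_maximal h (x, s))
      \<le> ennreal (2 * step_const) * (strong_maximal h (x, s) * ennreal (1 / sqrt \<bar>t - s\<bar>) * indicator (tint t0 \<rho>) s)"
    proof eventually_elim
      case (elim s)
      have eq: "(\<Sum>k<K. ennreal (step_const / (2 * (\<rho> / 2 ^ k))) * indicator (window t (\<theta> t) (\<rho> / 2 ^ k)) s * strong_maximal h (x, s))
        = ennreal (\<Sum>k<K. ?k k s) * strong_maximal h (x, s)"
      proof -
        have "ennreal (\<Sum>k<K. ?k k s) = (\<Sum>k<K. ennreal (?k k s))"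
          using step_const_pos \<rho> by (intro sum_ennreal[symmetric]) auto
        also have "\<dots> = (\<Sum>k<K. ennreal (step_const / (2 * (\<rho> / 2 ^ k))) * indicator (window t (\<theta> t) (\<rho> / 2 ^ k)) s)"
          by (intro sum.cong refl) (auto simp: indicator_def)
        finally show ?thesis by (simp only: sum_distrib_right)
      qed
      show ?case
      proof (cases "s \<in> tint t0 \<rho>")
        case True
        have "ennreal (\<Sum>k<K. ?k k s) \<le> ennreal (2 * step_const) * ennreal (1 / sqrt \<bar>t - s\<bar>)"
          using dyadic_sum[OF elim, of K] step_const_pos by (simp add: ennreal_mult'[symmetric] ennreal_leI)
        from mult_right_mono[OF this, of "strong_maximal h (x, s)"] show ?thesis
          unfolding eq using True by (simp add: mult_ac)
      next
        case False
        then have "\<And>k. s \<notin> window t (\<theta> t) (\<rho> / 2 ^ k)" using sub by blast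
        then show ?thesis by simp
      qed
    qed
  qed
  also have "\<dots> = ennreal (2 * step_const) * maximal_potential x t"
    unfolding maximal_potential_def tint_def by (subst nn_integral_cmult) auto
  finally show ?thesis by simp
qed

text \<open>
  The average at the largest scale, by \<open>kernel_rho\<close> the common base value for all \<open>t\<close>.
\<close>

definition base_mean :: "'a \<Rightarrow> nat \<Rightarrow> real" where
  "base_mean x i = avg (v i) x t0 0 \<rho>"

text \<open>
  Let \<open>K\<close> tend to infinity in \<open>telescoped_estimate\<close> along the subsequence of scales at which the
  averages converge.
\<close>

lemma pointwise_estimate:
  "AE z in lborel. z \<in> ball x0 \<rho> \<times> tint t0 \<rho> \<longrightarrow>
     ennreal (vnorm N (\<lambda>i. kernel_mass TYPE('a) * v i z - base_mean (fst z) i)) \<le> ennreal (2 * step_const) * maximal_potential (fst z) (snd z)"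
proof -
  let ?Q = "ball x0 \<rho> \<times> tint t0 \<rho>"
  have "(\<lambda>k. \<rho> * (1 / 2) ^ k) \<longlonglongrightarrow> \<rho> * 0"
    by (intro tendsto_mult_left LIMSEQ_power_zero) simp
  then have lim: "(\<lambda>k. \<rho> / 2 ^ k) \<longlonglongrightarrow> 0" by (simp add: power_one_over)
  have Q: "?Q \<in> sets borel" unfolding tint_def by (intro borel_open open_Times) auto
  have bQ: "bounded ?Q" unfolding tint_def by (intro bounded_Times) auto
  have pos: "\<And>k. 0 < \<rho> / 2 ^ k" using \<rho> by simp
  obtain s where s: "strict_mono s" "AE z in lborel. z \<in> ?Q \<longrightarrow> (\<forall>i<N.
     (\<lambda>k. avg (v i) (fst z) (snd z) (\<theta> (snd z)) (\<rho> / 2 ^ s k)) \<longlonglongrightarrow> kernel_mass TYPE('a) * v i z)"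
    using avg_AE_subseq[of N v, OF v theta_measurable theta_bound Q bQ pos lim] by blast
  from s(2) show ?thesis
  proof eventually_elim
    case (elim z)
    show ?case
    proof
      assume z: "z \<in> ?Q"
      obtain x t where xt: "z = (x, t)" by (cases z)
      have x: "x \<in> ball x0 \<rho>" and t: "t \<in> tint t0 \<rho>" using z xt by auto
      have base_mean: "base_mean x i = avg (v i) x t (\<theta> t) \<rho>" for i
        unfolding base_mean_def avg_def kernel_rho[OF t] ..
      have "(\<lambda>k. vnorm N (\<lambda>i. avg (v i) x t (\<theta> t) (\<rho> / 2 ^ s k) - base_mean x i)) \<longlonglongrightarrow> vnorm N (\<lambda>i. kernel_mass TYPE('a) * v i z - base_mean x i)"
        unfolding vnorm_def vinner_def
      proof (intro tendsto_real_sqrt tendsto_sum tendsto_inner tendsto_diff tendsto_const)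
        fix i assume "i \<in> {..<N}"
        then show "(\<lambda>k. avg (v i) x t (\<theta> t) (\<rho> / 2 ^ s k)) \<longlonglongrightarrow> kernel_mass TYPE('a) * v i z"
          "(\<lambda>k. avg (v i) x t (\<theta> t) (\<rho> / 2 ^ s k)) \<longlonglongrightarrow> kernel_mass TYPE('a) * v i z"
          using elim z xt by auto
      qed
      then have lim: "(\<lambda>k. ennreal (vnorm N (\<lambda>i. avg (v i) x t (\<theta> t) (\<rho> / 2 ^ s k) - base_mean x i))) \<longlonglongrightarrow> ennreal (vnorm N (\<lambda>i. kernel_mass TYPE('a) * v i z - base_mean x i))"
        by (rule tendsto_ennrealI)
      have "ennreal (vnorm N (\<lambda>i. kernel_mass TYPE('a) * v i z - base_mean x i)) \<le> ennreal (2 * step_const) * maximal_potential x t"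
        by (rule LIMSEQ_le_const2[OF lim]) (use telescoped_estimate[OF x t] base_mean in auto)
      then show "ennreal (vnorm N (\<lambda>i. kernel_mass TYPE('a) * v i z - base_mean (fst z) i)) \<le> ennreal (2 * step_const) * maximal_potential (fst z) (snd z)"
        using xt by simp
    qed
  qed
qed

end

section \<open>The kernel \<open>|t - s|^(-1/2)\<close> and Hoelder's inequality\<close>

lemma nn_integral_powr_0:
  assumes \<alpha>: "\<alpha> < 1" and l: "0 \<le> l"
  shows "(\<integral>\<^sup>+s. ennreal (indicator {0..l} s * s powr (- \<alpha>)) \<partial>lborel) = ennreal (l powr (1 - \<alpha>) / (1 - \<alpha>))"
proof -
  have "((\<lambda>s. s powr (- \<alpha>)) has_integral (l powr (- \<alpha> + 1) / (- \<alpha> + 1))) {0..l}"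
    using \<alpha> l by (intro has_integral_powr_from_0) auto
  from nn_integral_has_integral_lebesgue[OF _ this] show ?thesis by simp
qed

text \<open>
  The part of the interval on either side of \<open>t\<close> is at most \<open>b - a\<close> long.
\<close>

lemma powr_dist_integral:
  fixes t :: real
  assumes \<alpha>: "\<alpha> < 1" and t: "t \<in> {a<..<b}"
  shows "(\<integral>\<^sup>+s. ennreal (indicator {a<..<b} s * \<bar>t - s\<bar> powr (- \<alpha>)) \<partial>lborel)
     \<le> ennreal (2 * (b - a) powr (1 - \<alpha>) / (1 - \<alpha>))"
proof -
  define l where "l = b - a"
  have l: "0 \<le> l" using t by (simp add: l_def)
  let ?f = "\<lambda>s. ennreal (indicator {0..l} s * s powr (- \<alpha>))"
  have [measurable]: "?f \<in> borel_measurable borel" by measurable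
  have "(\<integral>\<^sup>+s. ennreal (indicator {a<..<b} s * \<bar>t - s\<bar> powr (- \<alpha>)) \<partial>lborel)
    \<le> (\<integral>\<^sup>+s. ?f (- t + 1 * s) + ?f (t + (-1) * s) \<partial>lborel)"
  proof (rule nn_integral_mono)
    fix s
    show "ennreal (indicator {a<..<b} s * \<bar>t - s\<bar> powr (- \<alpha>)) \<le> ?f (- t + 1 * s) + ?f (t + (-1) * s)"
    proof (cases "s \<in> {a<..<b}")
      case True
      show ?thesis
      proof (cases "t \<le> s")
        case True
        then have "ennreal (indicator {a<..<b} s * \<bar>t - s\<bar> powr (- \<alpha>)) = ?f (- t + 1 * s)"
          using \<open>s \<in> {a<..<b}\<close> t by (auto simp: l_def abs_minus_commute)
        then show ?thesis by simp
      next
        case False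
        then have "ennreal (indicator {a<..<b} s * \<bar>t - s\<bar> powr (- \<alpha>)) = ?f (t + (-1) * s)"
          using \<open>s \<in> {a<..<b}\<close> t by (auto simp: l_def)
        then show ?thesis by simp
      qed
    qed simp
  qed
  also have "\<dots> = (\<integral>\<^sup>+s. ?f (- t + 1 * s) \<partial>lborel) + (\<integral>\<^sup>+s. ?f (t + (-1) * s) \<partial>lborel)"
    by (rule nn_integral_add) measurable
  also have "(\<integral>\<^sup>+s. ?f (- t + 1 * s) \<partial>lborel) = (\<integral>\<^sup>+s. ?f s \<partial>lborel)"
    by (subst (2) nn_integral_real_affine[of _ 1 "- t"]) auto
  also have "(\<integral>\<^sup>+s. ?f (t + (-1) * s) \<partial>lborel) = (\<integral>\<^sup>+s. ?f s \<partial>lborel)"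
    by (subst (2) nn_integral_real_affine[of _ "-1" t]) auto
  also have "(\<integral>\<^sup>+s. ?f s \<partial>lborel) = ennreal (l powr (1 - \<alpha>) / (1 - \<alpha>))"
    by (rule nn_integral_powr_0[OF \<alpha> l])
  also have "ennreal (l powr (1 - \<alpha>) / (1 - \<alpha>)) + ennreal (l powr (1 - \<alpha>) / (1 - \<alpha>)) = ennreal (2 * (b - a) powr (1 - \<alpha>) / (1 - \<alpha>))"
    using \<alpha> by (simp add: l_def ennreal_plus[symmetric] del: ennreal_plus)
  finally show ?thesis .
qed

text \<open>
  The tangent inequality \<open>ln x \<le> ln S + (x / S - 1)\<close> at the weighted mean \<open>S\<close>, averaged with the
  weights.
\<close>

lemma weighted_am_gm3:
  fixes u v w :: real
  assumes "0 \<le> a" "0 \<le> b" "0 \<le> c" "a + b + c = 1" "0 \<le> u" "0 \<le> v" "0 \<le> w"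
  shows "u powr a * v powr b * w powr c \<le> a * u + b * v + c * w"
proof (cases "u = 0 \<or> v = 0 \<or> w = 0")
  case True
  then have e: "u powr a * v powr b * w powr c = 0" by auto
  show ?thesis unfolding e using assms by (intro add_nonneg_nonneg mult_nonneg_nonneg)
next
  case False
  then have pos: "0 < u" "0 < v" "0 < w" using assms by auto
  define S where "S = a * u + b * v + c * w"
  have S: "0 < S"
  proof -
    define m where "m = min u (min v w)"
    have "0 < m" using pos by (simp add: m_def)
    have "m = a * m + b * m + c * m" using assms(4) by (simp add: distrib_right[symmetric])
    also have "\<dots> \<le> S" unfolding S_def using assms by (intro add_mono mult_left_mono) (auto simp: m_def)
    finally show ?thesis using \<open>0 < m\<close> by simp
  qed
  have ln: "ln x \<le> ln S + (x / S - 1)" if "0 < x" for x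
    using ln_le_minus_one[of "x / S"] that S by (simp add: ln_div)
  have "a * ln u + b * ln v + c * ln w \<le> a * (ln S + (u / S - 1)) + b * (ln S + (v / S - 1)) + c * (ln S + (w / S - 1))"
    using assms pos by (intro add_mono mult_left_mono ln) auto
  also have "\<dots> = (a + b + c) * (ln S - 1) + (a * u + b * v + c * w) / S"
    by (simp add: algebra_simps add_divide_distrib)
  also have "\<dots> = ln S" using assms(4) S by (simp add: S_def[symmetric])
  finally have "exp (a * ln u + b * ln v + c * ln w) \<le> exp (ln S)" by simp
  then show ?thesis
    using pos S by (simp add: powr_def exp_add S_def[symmetric])
qed

text \<open>
  Integrate the weighted inequality between arithmetic and geometric means of the normalised functions.
  Both sides vanish when one of the three bounds is zero, by the
  convention \<open>0 powr 0 = 0\<close>.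
\<close>

lemma Hoelder3:
  fixes X Y Z :: "'b \<Rightarrow> real"
  assumes abc: "0 \<le> a" "0 \<le> b" "0 \<le> c" "a + b + c = 1"
    and [measurable]: "X \<in> borel_measurable M" "Y \<in> borel_measurable M" "Z \<in> borel_measurable M"
    and nn: "\<And>s. 0 \<le> X s" "\<And>s. 0 \<le> Y s" "\<And>s. 0 \<le> Z s"
    and A: "0 \<le> A" "(\<integral>\<^sup>+s. ennreal (X s) \<partial>M) \<le> ennreal A"
    and B: "0 \<le> B" "(\<integral>\<^sup>+s. ennreal (Y s) \<partial>M) \<le> ennreal B"
    and C: "0 \<le> C" "(\<integral>\<^sup>+s. ennreal (Z s) \<partial>M) \<le> ennreal C"
  shows "(\<integral>\<^sup>+s. ennreal (X s powr a * Y s powr b * Z s powr c) \<partial>M) \<le> ennreal (A powr a * B powr b * C powr c)"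
proof (cases "A = 0 \<or> B = 0 \<or> C = 0")
  case True
  have *: "AE s in M. f s = 0" if "f \<in> borel_measurable M" "\<And>s. 0 \<le> f s" "(\<integral>\<^sup>+s. ennreal (f s) \<partial>M) \<le> ennreal 0" for f :: "'b \<Rightarrow> real"
  proof -
    have "(\<integral>\<^sup>+s. ennreal (f s) \<partial>M) = 0" using that(3) by simp
    then have "AE s in M. ennreal (f s) = 0" using that by (subst (asm) nn_integral_0_iff_AE) auto
    then show ?thesis by eventually_elim (use that in \<open>auto simp: ennreal_eq_0_iff intro: antisym\<close>)
  qed
  have "AE s in M. X s = 0 \<or> Y s = 0 \<or> Z s = 0"
    using True *[of X] *[of Y] *[of Z] A B C nn by (auto elim!: eventually_mono)
  then have "(\<integral>\<^sup>+s. ennreal (X s powr a * Y s powr b * Z s powr c) \<partial>M) = (\<integral>\<^sup>+s. 0 \<partial>M)"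
    by (intro nn_integral_cong_AE) (auto elim!: eventually_mono)
  then show ?thesis by simp
next
  case False
  then have pos: "0 < A" "0 < B" "0 < C" using A B C by auto
  define E where "E = A powr a * B powr b * C powr c"
  have E: "0 \<le> E" by (simp add: E_def)
  have "(\<integral>\<^sup>+s. ennreal (X s powr a * Y s powr b * Z s powr c) \<partial>M)
    \<le> (\<integral>\<^sup>+s. ennreal (E * a / A) * ennreal (X s) + (ennreal (E * b / B) * ennreal (Y s) + ennreal (E * c / C) * ennreal (Z s)) \<partial>M)"
  proof (rule nn_integral_mono)
    fix s
    have "X s powr a * Y s powr b * Z s powr c = E * ((X s / A) powr a * (Y s / B) powr b * (Z s / C) powr c)"
      using pos nn by (simp add: E_def powr_divide)
    also have "\<dots> \<le> E * (a * (X s / A) + b * (Y s / B) + c * (Z s / C))"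
      using pos nn abc E by (intro mult_left_mono weighted_am_gm3) auto
    also have "\<dots> = (E * a / A) * X s + ((E * b / B) * Y s + (E * c / C) * Z s)"
      by (simp add: algebra_simps)
    finally show "ennreal (X s powr a * Y s powr b * Z s powr c)
       \<le> ennreal (E * a / A) * ennreal (X s) + (ennreal (E * b / B) * ennreal (Y s) + ennreal (E * c / C) * ennreal (Z s))"
      using E abc pos nn by (simp add: ennreal_mult'[symmetric] ennreal_plus[symmetric] ennreal_leI del: ennreal_plus)
  qed
  also have "\<dots> = ennreal (E * a / A) * (\<integral>\<^sup>+s. ennreal (X s) \<partial>M) + (ennreal (E * b / B) * (\<integral>\<^sup>+s. ennreal (Y s) \<partial>M) + ennreal (E * c / C) * (\<integral>\<^sup>+s. ennreal (Z s) \<partial>M))"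
    by (simp add: nn_integral_add nn_integral_cmult)
  also have "\<dots> \<le> ennreal (E * a / A) * ennreal A + (ennreal (E * b / B) * ennreal B + ennreal (E * c / C) * ennreal C)"
    by (intro add_mono mult_left_mono A B C) auto
  also have "\<dots> = ennreal (E * a + (E * b + E * c))"
    using E abc pos by (simp add: ennreal_mult'[symmetric] ennreal_plus[symmetric] del: ennreal_plus)
  also have "E * a + (E * b + E * c) = E" using abc(4) by (simp add: distrib_left[symmetric] add.assoc)
  finally show ?thesis unfolding E_def .
qed

section \<open>Mapping properties of the potential\<close>

definition potential :: "real \<Rightarrow> real \<Rightarrow> (real \<Rightarrow> ennreal) \<Rightarrow> real \<Rightarrow> ennreal" where
  "potential a b \<gamma> t = (\<integral>\<^sup>+s\<in>{a<..<b}. \<gamma> s * ennreal (1 / sqrt \<bar>t - s\<bar>) \<partial>lborel)"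

lemma epowr_measurable [measurable]:
  assumes [measurable]: "f \<in> borel_measurable M"
  shows "(\<lambda>s. epowr (f s) q) \<in> borel_measurable M"
  unfolding epowr_def by measurable

text \<open>
  A real-valued version of \<open>\<gamma>\<close> on the interval. If a power of \<open>\<gamma>\<close> is integrable, it agrees with \<open>\<gamma>\<close>
  almost everywhere (\<open>finite_ae\<close>); otherwise the mean of that power in the final estimates is infinite.
\<close>

definition finite_part :: "(real \<Rightarrow> ennreal) \<Rightarrow> real \<Rightarrow> real \<Rightarrow> real \<Rightarrow> real" where
  "finite_part \<gamma> a b s = indicator {a<..<b} s * enn2real (\<gamma> s)"

lemma finite_part_nonneg: "0 \<le> finite_part \<gamma> a b s"
  by (simp add: finite_part_def)

lemma finite_part_measurable [measurable]: "\<gamma> \<in> borel_measurable borel \<Longrightarrow> finite_part \<gamma> a b \<in> borel_measurable borel"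
  unfolding finite_part_def[abs_def] by measurable

lemma finite_ae:
  assumes [measurable]: "\<gamma> \<in> borel_measurable borel" and G: "(\<integral>\<^sup>+s\<in>{a<..<b}. epowr (\<gamma> s) q \<partial>lborel) = ennreal G"
  shows "AE s in lborel. s \<in> {a<..<b} \<longrightarrow> \<gamma> s = ennreal (finite_part \<gamma> a b s)"
    and "(\<integral>\<^sup>+s. ennreal (finite_part \<gamma> a b s powr q) \<partial>lborel) = ennreal G"
proof -
  have "(\<integral>\<^sup>+s\<in>{a<..<b}. epowr (\<gamma> s) q \<partial>lborel) \<noteq> \<infinity>" using G by simp
  then have "AE s in lborel. epowr (\<gamma> s) q * indicator {a<..<b} s \<noteq> \<infinity>"
    by (intro nn_integral_PInf_AE) measurable
  then show ae: "AE s in lborel. s \<in> {a<..<b} \<longrightarrow> \<gamma> s = ennreal (finite_part \<gamma> a b s)"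
    by eventually_elim (auto simp: epowr_def finite_part_def less_top split: if_splits)
  have "(\<integral>\<^sup>+s. ennreal (finite_part \<gamma> a b s powr q) \<partial>lborel) = (\<integral>\<^sup>+s\<in>{a<..<b}. epowr (\<gamma> s) q \<partial>lborel)"
    using ae by (intro nn_integral_cong_AE) (auto elim!: eventually_mono simp: epowr_def finite_part_def indicator_def)
  then show "(\<integral>\<^sup>+s. ennreal (finite_part \<gamma> a b s powr q) \<partial>lborel) = ennreal G" using G by simp
qed

text \<open>
  The kernel \<open>|t - s|^(-1/2)\<close> of the Abel transform, cut off to the interval.
\<close>

definition abel :: "real \<Rightarrow> real \<Rightarrow> real \<Rightarrow> real \<Rightarrow> real" where
  "abel a b t s = indicator {a<..<b} s * (1 / sqrt \<bar>t - s\<bar>)"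

lemma abel_nonneg: "0 \<le> abel a b t s"
  by (simp add: abel_def)

lemma abel_powr: "abel a b t s powr r = indicator {a<..<b} s * \<bar>t - s\<bar> powr (- (r / 2))"
proof (cases "s = t")
  case False
  then show ?thesis
    by (simp add: abel_def indicator_def powr_half_sqrt[symmetric] powr_powr powr_minus_divide[symmetric] powr_divide)
qed (simp add: abel_def)

text \<open>
  The power \<open>r\<close> of the kernel is integrable exactly for \<open>r < 2\<close>. This is the source of the three
  regimes of the theorem.
\<close>

lemma abel_integral:
  assumes "r < 2" "t \<in> {a<..<b}"
  shows "(\<integral>\<^sup>+s. ennreal (abel a b t s powr r) \<partial>lborel) \<le> ennreal (2 * (b - a) powr (1 - r / 2) / (1 - r / 2))"
  unfolding abel_powr using assms by (intro powr_dist_integral) auto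

lemma abel_measurable [measurable]: "(\<lambda>s. abel a b t s) \<in> borel_measurable borel" "(\<lambda>s. abel a b s t) \<in> borel_measurable borel"
   "(\<lambda>p. abel a b (fst p) (snd p)) \<in> borel_measurable (lborel \<Otimes>\<^sub>M lborel)"
   "(\<lambda>p. abel a b (snd p) (fst p)) \<in> borel_measurable (lborel \<Otimes>\<^sub>M lborel)"
  unfolding abel_def by measurable

lemma potential_eq:
  assumes [measurable]: "\<gamma> \<in> borel_measurable borel" and G: "(\<integral>\<^sup>+s\<in>{a<..<b}. epowr (\<gamma> s) q \<partial>lborel) = ennreal G"
  shows "potential a b \<gamma> t = (\<integral>\<^sup>+s. ennreal (finite_part \<gamma> a b s * abel a b t s) \<partial>lborel)"
  unfolding potential_def using finite_ae(1)[OF assms]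
  by (intro nn_integral_cong_AE)
     (auto elim!: eventually_mono simp: abel_def indicator_def ennreal_mult'[symmetric] finite_part_nonneg)

text \<open>
  Hoelder's inequality with the conjugate exponent \<open>r\<close>, which is below \<open>2\<close> because \<open>q\<close> is above \<open>2\<close>.
  The third factor of \<open>Hoelder3\<close> is the indicator with exponent \<open>0\<close>.
\<close>

lemma potential_sup_bound:
  assumes [measurable]: "\<gamma> \<in> borel_measurable borel" and q: "2 < q" and t: "t \<in> {a<..<b}"
    and G: "0 \<le> G" "(\<integral>\<^sup>+s\<in>{a<..<b}. epowr (\<gamma> s) q \<partial>lborel) = ennreal G"
  defines "r \<equiv> q / (q - 1)"
  shows "potential a b \<gamma> t \<le> ennreal (G powr (1 / q) * (2 * (b - a) powr (1 - r / 2) / (1 - r / 2)) powr (1 / r))"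
proof -
  have r: "r < 2" "0 < r" "1 / q + 0 + 1 / r = 1" using q by (auto simp: r_def field_simps)
  have l: "0 < b - a" using t by simp
  have "potential a b \<gamma> t = (\<integral>\<^sup>+s. ennreal (finite_part \<gamma> a b s * abel a b t s) \<partial>lborel)"
    by (rule potential_eq[OF assms(1) G(2)])
  also have "\<dots> = (\<integral>\<^sup>+s. ennreal ((finite_part \<gamma> a b s powr q) powr (1 / q) * (indicator {a<..<b} s :: real) powr 0 * (abel a b t s powr r) powr (1 / r)) \<partial>lborel)"
    using q r by (intro nn_integral_cong) (simp add: powr_powr finite_part_nonneg abel_nonneg, simp add: finite_part_def)
  also have "\<dots> \<le> ennreal (G powr (1 / q) * (b - a) powr 0 * (2 * (b - a) powr (1 - r / 2) / (1 - r / 2)) powr (1 / r))"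
  proof (rule Hoelder3)
    show "(\<integral>\<^sup>+s. ennreal (finite_part \<gamma> a b s powr q) \<partial>lborel) \<le> ennreal G" using finite_ae(2)[OF assms(1) G(2)] by simp
    show "(\<integral>\<^sup>+s. ennreal (indicator {a<..<b} s) \<partial>lborel) \<le> ennreal (b - a)"
      using l by (simp add: ennreal_indicator)
    show "(\<integral>\<^sup>+s. ennreal (abel a b t s powr r) \<partial>lborel) \<le> ennreal (2 * (b - a) powr (1 - r / 2) / (1 - r / 2))"
      by (rule abel_integral[OF r(1) t])
  qed (use r q l G in auto)
  finally show ?thesis using l by simp
qed

text \<open>
  Young's convolution inequality with explicit constants. Write the integrand \<open>\<gamma> k\<close> as

    \<open>(\<gamma>^q k^r)^(1/p) \<cdot> (\<gamma>^q)^(1/q - 1/p) \<cdot> (k^r)^(1 - 1/q),\<close>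

  which is possible by the relation between \<open>p\<close>, \<open>q\<close> and \<open>r\<close>. Hoelder's inequality bounds the power \<open>p\<close>
  of the potential by a multiple of \<open>\<integral> \<gamma>^q k^r ds\<close>, and Fubini's theorem integrates that in \<open>t\<close>. The
  result is stated for a function \<open>o'\<close> below the potential, as the potential may be infinite at some
  points. The constants are kept, since the exponential estimate lets \<open>p\<close> tend to infinity.
\<close>

lemma potential_Lp_bound:
  fixes o' :: "real \<Rightarrow> real"
  assumes [measurable]: "\<gamma> \<in> borel_measurable borel" and q: "1 < q" "q \<le> p" and ab: "a < b"
    and G: "0 \<le> G" "(\<integral>\<^sup>+s\<in>{a<..<b}. epowr (\<gamma> s) q \<partial>lborel) = ennreal G"
    and r: "1 / r = 1 + 1 / p - 1 / q" "r < 2" and C: "0 \<le> C"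
    and o': "\<And>t. 0 \<le> o' t" "AE t in lborel. t \<in> {a<..<b} \<longrightarrow> ennreal (o' t) \<le> ennreal C * potential a b \<gamma> t"
  shows "(\<integral>\<^sup>+t\<in>{a<..<b}. ennreal (o' t powr p) \<partial>lborel)
    \<le> ennreal (C powr p * (2 * (b - a) powr (1 - r / 2) / (1 - r / 2)) powr (p / r) * G powr (p / q))"
proof -
  let ?A = "2 * (b - a) powr (1 - r / 2) / (1 - r / 2)"
  have p: "0 < p" using q by simp
  have r0: "0 < r"
  proof -
    have "1 / q < 1" using q by simp
    moreover have "0 < 1 / p" using p by simp
    ultimately have "0 < 1 + 1 / p - 1 / q" by linarith
    then show ?thesis using r by (metis zero_less_divide_1_iff)
  qed
  have A: "0 < ?A" using r ab by simp
  \<comment> \<open>the convolution of the powers, which is all that still depends on \<open>t\<close> after Hoelder's inequality\<close>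
  define D where "D t = (\<integral>\<^sup>+s. ennreal (finite_part \<gamma> a b s powr q * abel a b t s powr r) \<partial>lborel)" for t
  let ?c = "C powr p * (G powr (p / q - 1) * ?A powr (p - p / q))"
  have w: "1 / p + (1 / q - 1 / p) + (1 - 1 / q) = 1" "0 \<le> 1 / q - 1 / p" "0 \<le> 1 - 1 / q"
    using q by (auto simp: field_simps)
  have exps: "q * (1 / p) + q * (1 / q - 1 / p) = 1" "r * (1 / p) + r * (1 - 1 / q) = 1"
  proof -
    show "q * (1 / p) + q * (1 / q - 1 / p) = 1" using q by (simp add: field_simps)
    have "r * (1 / p) + r * (1 - 1 / q) = r * (1 / r)" unfolding r(1) by (simp add: algebra_simps)
    then show "r * (1 / p) + r * (1 - 1 / q) = 1" using r0 by simp
  qed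
  \<comment> \<open>where \<open>D t\<close> is infinite, \<open>0 * top = 0\<close> requires a separate look at vanishing constants\<close>
  have pt: "ennreal (o' t powr p) \<le> ennreal ?c * D t"
    if t: "t \<in> {a<..<b}" and ot: "ennreal (o' t) \<le> ennreal C * potential a b \<gamma> t" for t
  proof (cases "D t = top")
    case True
    show ?thesis
    proof (cases "?c = 0")
      case True
      then consider "C = 0" | "G = 0" using A by auto
      then have "o' t = 0"
      proof cases
        case 1
        then show ?thesis using ot o'(1)[of t] by (simp add: ennreal_eq_0_iff)
      next
        case 2
        have "(\<integral>\<^sup>+s. ennreal (finite_part \<gamma> a b s powr q) \<partial>lborel) = 0"
          using finite_ae(2)[OF assms(1) G(2)] 2 by simp
        then have "AE s in lborel. ennreal (finite_part \<gamma> a b s powr q) = 0"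
          by (subst (asm) nn_integral_0_iff_AE) auto
        then have "AE s in lborel. ennreal (finite_part \<gamma> a b s * abel a b t s) = 0"
          by eventually_elim simp
        then have "potential a b \<gamma> t = 0"
          unfolding potential_eq[OF assms(1) G(2)] by (subst nn_integral_0_iff_AE) auto
        then show ?thesis using ot o'(1)[of t] by (simp add: ennreal_eq_0_iff)
      qed
      then show ?thesis using p by simp
    next
      case False
      then have "0 < ?c" by (simp add: less_le)
      then have "ennreal ?c \<noteq> 0" by (simp only: ennreal_eq_0_iff not_le not_False_eq_True)
      from ennreal_top_mult_left[OF this] show ?thesis unfolding True by (simp only: top_greatest)
    qed
  next
    case False
    then obtain d where d: "D t = ennreal d" "0 \<le> d" by (cases "D t") auto
    let ?X = "\<lambda>s. finite_part \<gamma> a b s powr q * abel a b t s powr r" and ?Y = "\<lambda>s. finite_part \<gamma> a b s powr q" and ?Z = "\<lambda>s. abel a b t s powr r"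
    have "potential a b \<gamma> t = (\<integral>\<^sup>+s. ennreal (finite_part \<gamma> a b s * abel a b t s) \<partial>lborel)"
      by (rule potential_eq[OF assms(1) G(2)])
    also have "\<dots> = (\<integral>\<^sup>+s. ennreal (?X s powr (1 / p) * ?Y s powr (1 / q - 1 / p) * ?Z s powr (1 - 1 / q)) \<partial>lborel)"
    proof (intro nn_integral_cong arg_cong[of _ _ ennreal])
      fix s
      have "?X s powr (1 / p) * ?Y s powr (1 / q - 1 / p) * ?Z s powr (1 - 1 / q)
        = finite_part \<gamma> a b s powr (q * (1 / p) + q * (1 / q - 1 / p)) * abel a b t s powr (r * (1 / p) + r * (1 - 1 / q))"
        by (simp add: powr_mult powr_powr powr_add mult_ac)
      then show "finite_part \<gamma> a b s * abel a b t s = ?X s powr (1 / p) * ?Y s powr (1 / q - 1 / p) * ?Z s powr (1 - 1 / q)"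
        unfolding exps by (simp add: finite_part_nonneg abel_nonneg)
    qed
    also have "\<dots> \<le> ennreal (d powr (1 / p) * G powr (1 / q - 1 / p) * ?A powr (1 - 1 / q))"
    proof (rule Hoelder3)
      show "(\<integral>\<^sup>+s. ennreal (?X s) \<partial>lborel) \<le> ennreal d" using d by (simp add: D_def)
      show "(\<integral>\<^sup>+s. ennreal (?Y s) \<partial>lborel) \<le> ennreal G" using finite_ae(2)[OF assms(1) G(2)] by simp
      show "(\<integral>\<^sup>+s. ennreal (?Z s) \<partial>lborel) \<le> ennreal ?A" by (rule abel_integral[OF r(2) t])
    qed (use w d G A p in auto)
    finally have "ennreal (o' t) \<le> ennreal C * ennreal (d powr (1 / p) * G powr (1 / q - 1 / p) * ?A powr (1 - 1 / q))"
      using ot by (meson mult_left_mono order_trans zero_le)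
    then have "o' t \<le> C * (d powr (1 / p) * G powr (1 / q - 1 / p) * ?A powr (1 - 1 / q))"
      using C by (simp add: ennreal_mult'[symmetric])
    then have "o' t powr p \<le> (C * (d powr (1 / p) * G powr (1 / q - 1 / p) * ?A powr (1 - 1 / q))) powr p"
      using p o'(1) by (intro powr_mono2) auto
    also have "\<dots> = C powr p * (d * G powr ((1 / q - 1 / p) * p) * ?A powr ((1 - 1 / q) * p))"
      using p d C A by (simp add: powr_mult powr_powr)
    also have "(1 / q - 1 / p) * p = p / q - 1" using p by (simp add: left_diff_distrib)
    also have "(1 - 1 / q) * p = p - p / q" by (simp add: left_diff_distrib)
    finally have "o' t powr p \<le> ?c * d" by (simp add: mult_ac)
    then show ?thesis unfolding d(1) by (subst ennreal_mult'[symmetric]) (auto intro: ennreal_leI)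
  qed
  have [measurable]: "D \<in> borel_measurable borel"
  proof -
    have "D \<in> borel_measurable lborel"
      unfolding D_def by (rule lborel.borel_measurable_nn_integral) (simp add: case_prod_beta)
    then show ?thesis by simp
  qed
  have "(\<integral>\<^sup>+t\<in>{a<..<b}. ennreal (o' t powr p) \<partial>lborel) \<le> (\<integral>\<^sup>+t. ennreal ?c * (D t * indicator {a<..<b} t) \<partial>lborel)"
  proof (rule nn_integral_mono_AE)
    show "AE t in lborel. ennreal (o' t powr p) * indicator {a<..<b} t \<le> ennreal ?c * (D t * indicator {a<..<b} t)"
      using o'(2) by eventually_elim (use pt in \<open>auto simp: indicator_def\<close>)
  qed
  also have "\<dots> = ennreal ?c * (\<integral>\<^sup>+t. D t * indicator {a<..<b} t \<partial>lborel)"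
    by (rule nn_integral_cmult) measurable
  also have "(\<integral>\<^sup>+t. D t * indicator {a<..<b} t \<partial>lborel)
     = (\<integral>\<^sup>+t. (\<integral>\<^sup>+s. ennreal (finite_part \<gamma> a b s powr q) * ennreal (abel a b s t powr r) \<partial>lborel) \<partial>lborel)"
  proof (rule nn_integral_cong)
    fix t
    have "D t * indicator {a<..<b} t = (\<integral>\<^sup>+s. ennreal (finite_part \<gamma> a b s powr q * abel a b t s powr r) * indicator {a<..<b} t \<partial>lborel)"
      unfolding D_def by (rule nn_integral_multc[symmetric]) measurable
    also have "\<dots> = (\<integral>\<^sup>+s. ennreal (finite_part \<gamma> a b s powr q) * ennreal (abel a b s t powr r) \<partial>lborel)"
      by (intro nn_integral_cong) (auto simp: abel_powr finite_part_def indicator_def ennreal_mult'[symmetric] abs_minus_commute)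
    finally show "D t * indicator {a<..<b} t = (\<integral>\<^sup>+s. ennreal (finite_part \<gamma> a b s powr q) * ennreal (abel a b s t powr r) \<partial>lborel)" .
  qed
  also have "\<dots> = (\<integral>\<^sup>+s. (\<integral>\<^sup>+t. ennreal (finite_part \<gamma> a b s powr q) * ennreal (abel a b s t powr r) \<partial>lborel) \<partial>lborel)"
    by (rule lborel_pair.Fubini') (simp add: case_prod_beta)
  also have "\<dots> \<le> (\<integral>\<^sup>+s. ennreal (finite_part \<gamma> a b s powr q) * ennreal ?A \<partial>lborel)"
  proof (rule nn_integral_mono)
    fix s
    show "(\<integral>\<^sup>+t. ennreal (finite_part \<gamma> a b s powr q) * ennreal (abel a b s t powr r) \<partial>lborel) \<le> ennreal (finite_part \<gamma> a b s powr q) * ennreal ?A"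
    proof (cases "s \<in> {a<..<b}")
      case True
      have "(\<integral>\<^sup>+t. ennreal (finite_part \<gamma> a b s powr q) * ennreal (abel a b s t powr r) \<partial>lborel) = ennreal (finite_part \<gamma> a b s powr q) * (\<integral>\<^sup>+t. ennreal (abel a b s t powr r) \<partial>lborel)"
        by (rule nn_integral_cmult) measurable
      also have "\<dots> \<le> ennreal (finite_part \<gamma> a b s powr q) * ennreal ?A"
        by (intro mult_left_mono abel_integral r True) simp
      finally show ?thesis .
    qed (simp add: finite_part_def)
  qed
  also have "\<dots> = ennreal G * ennreal ?A"
    using finite_ae(2)[OF assms(1) G(2)] by (subst nn_integral_multc) auto
  finally have "(\<integral>\<^sup>+t\<in>{a<..<b}. ennreal (o' t powr p) \<partial>lborel) \<le> ennreal ?c * (ennreal G * ennreal ?A)"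
    by (simp add: mult_left_mono)
  also have "\<dots> = ennreal (?c * (G * ?A))"
    using G A by (simp add: ennreal_mult'[symmetric])
  also have "?c * (G * ?A) = C powr p * ?A powr (p / r) * G powr (p / q)"
  proof -
    have 1: "G powr (p / q - 1) * G = G powr (p / q)"
      using G by (cases "G = 0") (auto simp: powr_diff)
    have 2: "?A powr (p - p / q) * ?A = ?A powr (p / r)"
    proof -
      have "p / r = p * (1 / r)" by simp
      also have "\<dots> = p - p / q + 1" unfolding r(1) using p by (simp add: algebra_simps)
      finally show ?thesis by (simp only: powr_add powr_one[OF less_imp_le[OF A]])
    qed
    have "c * (g * e) * (G * A) = c * (e * A) * (g * G)" for c g e A :: real by simp
    then show ?thesis unfolding 1[symmetric] 2[symmetric] .
  qed
  finally show ?thesis .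
qed

text \<open>
  For \<open>s\<close> in the interval, \<open>\<integral> |t' - s|^(-1/2) dt'\<close> is at most \<open>4 (b - a)^(1/2)\<close>, which in turn is at
  most \<open>4 (b - a) |t - s|^(-1/2)\<close> for every \<open>t\<close> in the interval. So the time mean of the potential is
  bounded by four times its value at any point.
\<close>

lemma potential_mean_bound:
  assumes [measurable]: "\<gamma> \<in> borel_measurable borel" and t: "t \<in> {a<..<b}"
  shows "(\<integral>\<^sup>+t'\<in>{a<..<b}. potential a b \<gamma> t' \<partial>lborel) \<le> ennreal (4 * (b - a)) * potential a b \<gamma> t"
proof -
  have l: "0 < b - a" using t by simp
  let ?k = "\<lambda>t s. ennreal (abel a b t s)"
  have "(\<integral>\<^sup>+t'\<in>{a<..<b}. potential a b \<gamma> t' \<partial>lborel) = (\<integral>\<^sup>+t'. (\<integral>\<^sup>+s. \<gamma> s * indicator {a<..<b} s * ?k s t' \<partial>lborel) \<partial>lborel)"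
  proof (rule nn_integral_cong)
    fix t'
    have "potential a b \<gamma> t' * indicator {a<..<b} t' = (\<integral>\<^sup>+s. \<gamma> s * ennreal (1 / sqrt \<bar>t' - s\<bar>) * indicator {a<..<b} s * indicator {a<..<b} t' \<partial>lborel)"
      unfolding potential_def by (rule nn_integral_multc[symmetric]) measurable
    also have "\<dots> = (\<integral>\<^sup>+s. \<gamma> s * indicator {a<..<b} s * ?k s t' \<partial>lborel)"
      by (intro nn_integral_cong) (auto simp: abel_def indicator_def abs_minus_commute)
    finally show "potential a b \<gamma> t' * indicator {a<..<b} t' = (\<integral>\<^sup>+s. \<gamma> s * indicator {a<..<b} s * ?k s t' \<partial>lborel)" .
  qed
  also have "\<dots> = (\<integral>\<^sup>+s. (\<integral>\<^sup>+t'. \<gamma> s * indicator {a<..<b} s * ?k s t' \<partial>lborel) \<partial>lborel)"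
    by (rule lborel_pair.Fubini') (simp add: case_prod_beta)
  also have "\<dots> \<le> (\<integral>\<^sup>+s. ennreal (4 * (b - a)) * (\<gamma> s * ennreal (1 / sqrt \<bar>t - s\<bar>) * indicator {a<..<b} s) \<partial>lborel)"
  proof (rule nn_integral_mono_AE)
    have "AE s in lborel. s \<noteq> t" by (rule AE_lborel_singleton)
    then show "AE s in lborel. (\<integral>\<^sup>+t'. \<gamma> s * indicator {a<..<b} s * ?k s t' \<partial>lborel) \<le> ennreal (4 * (b - a)) * (\<gamma> s * ennreal (1 / sqrt \<bar>t - s\<bar>) * indicator {a<..<b} s)"
    proof eventually_elim
      case (elim s)
      show ?case
      proof (cases "s \<in> {a<..<b}")
        case True
        have "(\<integral>\<^sup>+t'. \<gamma> s * indicator {a<..<b} s * ?k s t' \<partial>lborel) = \<gamma> s * (\<integral>\<^sup>+t'. ?k s t' \<partial>lborel)"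
          using True by (simp add: nn_integral_cmult)
        also have "(\<integral>\<^sup>+t'. ?k s t' \<partial>lborel) \<le> ennreal (4 * sqrt (b - a))"
        proof -
          have "(\<integral>\<^sup>+t'. ?k s t' \<partial>lborel) = (\<integral>\<^sup>+t'. ennreal (abel a b s t' powr 1) \<partial>lborel)" by (simp add: abel_nonneg)
          also have "\<dots> \<le> ennreal (2 * (b - a) powr (1 - 1 / 2) / (1 - 1 / 2))" by (rule abel_integral) (use True in auto)
          finally show ?thesis using l by (simp add: powr_half_sqrt)
        qed
        also have "ennreal (4 * sqrt (b - a)) \<le> ennreal (4 * (b - a)) * ennreal (1 / sqrt \<bar>t - s\<bar>)"
        proof -
          have "\<bar>t - s\<bar> \<le> b - a" "0 < \<bar>t - s\<bar>" using True t elim by auto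
          then have "sqrt \<bar>t - s\<bar> \<le> sqrt (b - a)" "0 < sqrt \<bar>t - s\<bar>" by auto
          then have "sqrt (b - a) * sqrt \<bar>t - s\<bar> \<le> sqrt (b - a) * sqrt (b - a)" using l by (intro mult_left_mono) auto
          then have "4 * sqrt (b - a) \<le> 4 * (b - a) * (1 / sqrt \<bar>t - s\<bar>)"
            using \<open>0 < sqrt \<bar>t - s\<bar>\<close> l by (simp add: field_simps)
          then show ?thesis using l by (simp add: ennreal_mult'[symmetric] ennreal_leI)
        qed
        finally have "(\<integral>\<^sup>+t'. \<gamma> s * indicator {a<..<b} s * ?k s t' \<partial>lborel) \<le> \<gamma> s * (ennreal (4 * (b - a)) * ennreal (1 / sqrt \<bar>t - s\<bar>))"
          by (simp add: mult_left_mono)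
        then show ?thesis using True by (simp add: mult_ac)
      qed simp
    qed
  qed
  also have "\<dots> = ennreal (4 * (b - a)) * potential a b \<gamma> t"
    unfolding potential_def by (rule nn_integral_cmult) measurable
  finally show ?thesis .
qed

section \<open>Mean values of functions bounded by a potential\<close>

lemma epowr_mono: "x \<le> y \<Longrightarrow> 0 < p \<Longrightarrow> epowr x p \<le> epowr y p"
  by (cases x; cases y) (auto simp: epowr_def top_unique intro!: ennreal_leI powr_mono2)

lemma epowr_ennreal: "0 \<le> x \<Longrightarrow> epowr (ennreal x) p = ennreal (x powr p)"
  by (simp add: epowr_def)

lemma mean_on_interval:
  fixes a b :: real
  assumes "a < b"
  shows "mean_on {a<..<b} f = (\<integral>\<^sup>+t\<in>{a<..<b}. f t \<partial>lborel) / ennreal (b - a)"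
  using assms by (simp add: lebesgue_mean_eq)

lemma mean_epowr_cases:
  fixes a b :: real
  assumes ab: "a < b"
  obtains (top) "(\<integral>\<^sup>+s\<in>{a<..<b}. epowr (\<gamma> s) q \<partial>lborel) = top" "mean_on {a<..<b} (\<lambda>s. epowr (\<gamma> s) q) = top"
    | (real) G where "0 \<le> G" "(\<integral>\<^sup>+s\<in>{a<..<b}. epowr (\<gamma> s) q \<partial>lborel) = ennreal G"
        "mean_on {a<..<b} (\<lambda>s. epowr (\<gamma> s) q) = ennreal (G / (b - a))"
proof (cases "\<integral>\<^sup>+s\<in>{a<..<b}. epowr (\<gamma> s) q \<partial>lborel")
  case (real G)
  then show ?thesis
    using that(2)[of G] mean_on_interval[OF ab, of "\<lambda>s. epowr (\<gamma> s) q"] ab by (simp add: divide_ennreal)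
next
  case top
  then show ?thesis
    using that(1) mean_on_interval[OF ab, of "\<lambda>s. epowr (\<gamma> s) q"] ab by (simp add: ennreal_top_divide)
qed

text \<open>
  \<open>potential_Lp_bound\<close> for \<open>o' / (b - a)^(1/2)\<close>, in scale-invariant form: the powers of \<open>b - a\<close> add up
  to the one that turns both integrals into mean values.
\<close>

lemma potential_mean_power:
  fixes o' :: "real \<Rightarrow> real"
  assumes \<gamma>: "\<gamma> \<in> borel_measurable borel" and q: "1 < q" "q \<le> p" and ab: "a < b"
    and r: "1 / r = 1 + 1 / p - 1 / q" "r < 2" and C: "0 < C"
    and o': "\<And>t. 0 \<le> o' t" "AE t in lborel. t \<in> {a<..<b} \<longrightarrow> ennreal (o' t) \<le> ennreal C * potential a b \<gamma> t"
  shows "epowr (mean_on {a<..<b} (\<lambda>t. ennreal (o' t powr p / (b - a) powr (p / 2)))) (1 / p)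
    \<le> ennreal (C * (2 / (1 - r / 2)) powr (1 / r)) * epowr (mean_on {a<..<b} (\<lambda>t. epowr (\<gamma> t) q)) (1 / q)"
proof -
  define l where "l = b - a"
  have l: "0 < l" using ab by (simp add: l_def)
  define k where "k = 2 / (1 - r / 2)"
  have k: "0 < k" using r(2) by (simp add: k_def)
  have p: "0 < p" using q by simp
  have pr: "p / r = p + 1 - p / q"
  proof -
    have "p / r = p * (1 / r)" by simp
    also have "\<dots> = p + 1 - p / q" unfolding r(1) using p by (simp add: algebra_simps)
    finally show ?thesis .
  qed
  from ab show ?thesis
  proof (cases rule: mean_epowr_cases[where \<gamma>=\<gamma> and q=q])
    case top
    then show ?thesis using C k by (simp add: epowr_def k_def[symmetric])
  next
    case (real G)
    have eq: "o' t powr p / l powr (p / 2) = (o' t / l powr (1 / 2)) powr p" for t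
      using o'(1)[of t] l by (simp add: powr_divide powr_powr)
    have "(\<integral>\<^sup>+t\<in>{a<..<b}. ennreal ((o' t / l powr (1 / 2)) powr p) \<partial>lborel)
      \<le> ennreal ((C / l powr (1 / 2)) powr p * (2 * (b - a) powr (1 - r / 2) / (1 - r / 2)) powr (p / r) * G powr (p / q))"
    proof (rule potential_Lp_bound[OF \<gamma> q ab real(1,2) r])
      show "0 \<le> C / l powr (1 / 2)" using C by simp
      show "0 \<le> o' t / l powr (1 / 2)" for t using o'(1)[of t] by simp
      show "AE t in lborel. t \<in> {a<..<b} \<longrightarrow> ennreal (o' t / l powr (1 / 2)) \<le> ennreal (C / l powr (1 / 2)) * potential a b \<gamma> t"
        using o'(2)
      proof eventually_elim
        case (elim t)
        have m: "0 \<le> 1 / l powr (1 / 2)" by simp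
        have "ennreal (o' t / l powr (1 / 2)) = ennreal (1 / l powr (1 / 2)) * ennreal (o' t)"
          using ennreal_mult'[OF m, of "o' t"] by simp
        moreover have "ennreal (C / l powr (1 / 2)) = ennreal (1 / l powr (1 / 2)) * ennreal C"
          using ennreal_mult'[OF m, of C] by simp
        ultimately show ?case using elim by (simp add: mult.assoc mult_left_mono)
      qed
    qed
    also have "(C / l powr (1 / 2)) powr p * (2 * (b - a) powr (1 - r / 2) / (1 - r / 2)) powr (p / r) * G powr (p / q)
      = l * (C * k powr (1 / r) * (G / l) powr (1 / q)) powr p"
    proof -
      have 1: "2 * (b - a) powr (1 - r / 2) / (1 - r / 2) = k * l powr (1 - r / 2)" by (simp add: k_def l_def)
      have 2: "(C / l powr (1 / 2)) powr p = C powr p * l powr (- (p / 2))"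
        using C l by (simp add: powr_divide powr_powr powr_minus_divide)
      have 3: "(k * l powr (1 - r / 2)) powr (p / r) = k powr (p / r) * l powr ((1 - r / 2) * (p / r))"
        using k l by (simp add: powr_mult powr_powr)
      have 4: "(C * k powr (1 / r) * (G / l) powr (1 / q)) powr p = C powr p * k powr (p / r) * (G powr (p / q) * l powr (- (p / q)))"
        using C k l real(1) by (simp add: powr_mult powr_powr powr_divide powr_minus_divide)
      have r0: "r \<noteq> 0"
      proof
        assume "r = 0"
        then have "1 + 1 / p - 1 / q = 0" using r(1) by simp
        moreover have "1 / q < 1" "0 < 1 / p" using q by auto
        ultimately show False by linarith
      qed
      have "(1 - r / 2) * (p / r) = p / r - p / 2" using r0 by (simp add: field_simps)
      then have e: "- (p / 2) + (1 - r / 2) * (p / r) = 1 + - (p / q)" unfolding pr by simp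
      have "l powr (- (p / 2)) * l powr ((1 - r / 2) * (p / r)) = l * l powr (- (p / q))"
        unfolding powr_add[symmetric] e by (simp only: powr_add powr_one[OF less_imp_le[OF l]])
      moreover have "x * y * (k' * z) * g = (x * k' * g) * (y * z)" for x y k' z g :: real by simp
      ultimately show ?thesis unfolding 1 2 3 4 by (simp add: mult_ac)
    qed
    finally have "(\<integral>\<^sup>+t\<in>{a<..<b}. ennreal (o' t powr p / l powr (p / 2)) \<partial>lborel) \<le> ennreal l * ennreal ((C * k powr (1 / r) * (G / l) powr (1 / q)) powr p)"
      unfolding eq using l by (simp add: ennreal_mult')
    then have "mean_on {a<..<b} (\<lambda>t. ennreal (o' t powr p / l powr (p / 2))) \<le> ennreal ((C * k powr (1 / r) * (G / l) powr (1 / q)) powr p)"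
      unfolding mean_on_interval[OF ab] l_def[symmetric] using l by (intro divide_le_posI_ennreal) auto
    from epowr_mono[OF this, of "1 / p"] have
      "epowr (mean_on {a<..<b} (\<lambda>t. ennreal (o' t powr p / l powr (p / 2)))) (1 / p) \<le> ennreal (C * k powr (1 / r) * (G / l) powr (1 / q))"
      using p C k by (simp add: epowr_ennreal powr_powr)
    also have "\<dots> = ennreal (C * k powr (1 / r)) * epowr (ennreal (G / l)) (1 / q)"
      using C k l real(1) by (simp add: epowr_ennreal ennreal_mult'[symmetric])
    finally show ?thesis unfolding real(3) l_def[symmetric] k_def[symmetric] .
  qed
qed

lemma potential_mean_sup:
  fixes o' :: "real \<Rightarrow> real"
  assumes \<gamma>: "\<gamma> \<in> borel_measurable borel" and q: "2 < q" and C: "0 < C"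
    and t: "t \<in> {a<..<b}" and o': "0 \<le> x" "ennreal x \<le> ennreal C * potential a b \<gamma> t"
  defines "r \<equiv> q / (q - 1)"
  shows "ennreal (x / (b - a) powr (1 / 2))
    \<le> ennreal (C * (2 / (1 - r / 2)) powr (1 / r)) * epowr (mean_on {a<..<b} (\<lambda>t. epowr (\<gamma> t) q)) (1 / q)"
proof -
  define l where "l = b - a"
  have ab: "a < b" using t by simp
  have l: "0 < l" using t by (simp add: l_def)
  define k where "k = 2 / (1 - r / 2)"
  have r: "r < 2" "0 < r" "1 / r = 1 - 1 / q" using q by (auto simp: r_def field_simps)
  have k: "0 < k" using r by (simp add: k_def)
  from ab show ?thesis
  proof (cases rule: mean_epowr_cases[where \<gamma>=\<gamma> and q=q])
    case top
    then show ?thesis using C k by (simp add: epowr_def k_def[symmetric])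
  next
    case (real G)
    have "ennreal x \<le> ennreal C * ennreal (G powr (1 / q) * (2 * (b - a) powr (1 - r / 2) / (1 - r / 2)) powr (1 / r))"
      using o'(2) potential_sup_bound[OF \<gamma> q t real(1,2)] unfolding r_def by (meson mult_left_mono order_trans zero_le)
    also have "\<dots> = ennreal (C * (G powr (1 / q) * (k * l powr (1 - r / 2)) powr (1 / r)))"
      using C by (simp add: ennreal_mult' k_def l_def)
    finally have "x \<le> C * (G powr (1 / q) * (k * l powr (1 - r / 2)) powr (1 / r))"
      using C by simp
    also have "\<dots> = C * k powr (1 / r) * (G / l) powr (1 / q) * l powr (1 / 2)"
    proof -
      have 1: "(k * l powr (1 - r / 2)) powr (1 / r) = k powr (1 / r) * l powr ((1 - r / 2) * (1 / r))"
        using k l by (simp add: powr_mult powr_powr)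
      have 2: "(G / l) powr (1 / q) = G powr (1 / q) * l powr (- (1 / q))"
        using l real(1) by (simp add: powr_divide powr_minus_divide)
      have "(1 - r / 2) * (1 / r) = 1 / r - 1 / 2" using r by (simp add: field_simps)
      then have e: "(1 - r / 2) * (1 / r) = - (1 / q) + 1 / 2" unfolding r(3) by simp
      show ?thesis unfolding 1 2 e powr_add by (simp add: mult_ac)
    qed
    finally have "x / l powr (1 / 2) \<le> C * k powr (1 / r) * (G / l) powr (1 / q)"
      using l by (simp add: divide_le_eq)
    then have "ennreal (x / l powr (1 / 2)) \<le> ennreal (C * k powr (1 / r) * (G / l) powr (1 / q))" by (rule ennreal_leI)
    also have "\<dots> = ennreal (C * k powr (1 / r)) * epowr (ennreal (G / l)) (1 / q)"
      using C k l real(1) by (simp add: epowr_ennreal ennreal_mult'[symmetric])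
    finally show ?thesis unfolding real(3) l_def[symmetric] k_def[symmetric] .
  qed
qed

text \<open>
  From \<open>m^m / m! \<le> e^m \<le> 3^m\<close> with \<open>m = j + 1\<close>, and \<open>j + 1 \<le> 2^j\<close>.
\<close>

lemma factorial_growth: "(2 * (real j + 1)) ^ (j + 1) / fact j \<le> 6 * 12 ^ j"
proof -
  have "(real (j + 1)) ^ (j + 1) / fact (j + 1) \<le> exp (real (j + 1))"
  proof -
    have "(\<lambda>n. real (j + 1) ^ n /\<^sub>R fact n) sums exp (real (j + 1))" by (rule exp_converges)
    from sum_le_suminf[OF sums_summable[OF this], of "{j + 1}"] sums_unique[OF this] show ?thesis
      by (simp add: divide_inverse mult.commute)
  qed
  also have "\<dots> = exp 1 ^ (j + 1)" using exp_of_nat_mult[of "j + 1" "1::real"] by (simp only: mult_1_right)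
  also have "\<dots> \<le> 3 ^ (j + 1)" by (intro power_mono exp_le) simp
  finally have "(real (j + 1)) ^ (j + 1) \<le> 3 ^ (j + 1) * fact (j + 1)" by (simp add: divide_le_eq)
  then have "(2 * (real j + 1)) ^ (j + 1) \<le> 2 ^ (j + 1) * (3 ^ (j + 1) * ((real j + 1) * fact j))"
    unfolding power_mult_distrib by (intro mult_left_mono) (simp_all add: add.commute)
  also have "real j + 1 \<le> 2 ^ j"
    by (induction j) auto
  then have "2 ^ (j + 1) * (3 ^ (j + 1) * ((real j + 1) * fact j)) \<le> 2 ^ (j + 1) * (3 ^ (j + 1) * (2 ^ j * fact j))"
    by (intro mult_left_mono mult_right_mono) auto
  also have "\<dots> = 6 * 12 ^ j * fact j"
  proof -
    have "(12::real) ^ j = 2 ^ j * 3 ^ j * 2 ^ j" by (simp add: power_mult_distrib[symmetric])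
    then show ?thesis by simp
  qed
  finally show ?thesis by (simp add: divide_le_eq)
qed

text \<open>
  Expand the exponential. The term of index \<open>j\<close> is an \<open>L^p\<close> norm with \<open>p = 2 j\<close>, for which
  \<open>potential_Lp_bound\<close> with \<open>q = 2\<close> has \<open>r = 2 j / (j + 1)\<close>; the factor \<open>1 / (1 - r/2)\<close> equals \<open>j + 1\<close> and
  enters with the power \<open>p / r = j + 1\<close>. This growth is compensated by \<open>j!\<close> up to \<open>12^j\<close>
  (\<open>factorial_growth\<close>). Since \<open>c \<ge> 5 C\<close>, the factor \<open>(C/c)^(2j)\<close> is at most \<open>24^(-j)\<close>, so the terms are at
  most \<open>6 \<cdot> 2^(-j)\<close> and add up to \<open>12 \<le> c\<close>.
\<close>

lemma potential_mean_exp: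
  fixes o' :: "real \<Rightarrow> real"
  assumes \<gamma>: "\<gamma> \<in> borel_measurable borel" and ab: "a < b" and C: "0 < C"
    and [measurable]: "o' \<in> borel_measurable borel"
    and o': "\<And>t. 0 \<le> o' t" "AE t in lborel. t \<in> {a<..<b} \<longrightarrow> ennreal (o' t) \<le> ennreal C * potential a b \<gamma> t"
  defines "c \<equiv> 12 + 5 * C"
  shows "mean_on {a<..<b} (\<lambda>t. ennreal (exp ((quot (o' t)
           (ennreal (c * (b - a) powr (1 / 2)) * epowr (mean_on {a<..<b} (\<lambda>t. epowr (\<gamma> t) 2)) (1 / 2)))\<^sup>2))) \<le> ennreal c"
proof -
  define l where "l = b - a"
  have l: "0 < l" using ab by (simp add: l_def)
  have c: "0 < c" "1 \<le> c" "12 \<le> c" "5 * C \<le> c" using C by (auto simp: c_def)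
  let ?d = "ennreal (c * (b - a) powr (1 / 2)) * epowr (mean_on {a<..<b} (\<lambda>t. epowr (\<gamma> t) 2)) (1 / 2)"
  \<comment> \<open>the degenerate denominators \<open>0\<close> and infinity, for which the quotient is \<open>0\<close>\<close>
  have triv: ?thesis if "\<And>t. quot (o' t) ?d = 0"
  proof -
    have "(\<lambda>t. ennreal (exp ((quot (o' t) ?d)\<^sup>2))) = (\<lambda>_. 1)"
      unfolding that by simp
    then have "mean_on {a<..<b} (\<lambda>t. ennreal (exp ((quot (o' t) ?d)\<^sup>2))) = mean_on {a<..<b} (\<lambda>_. 1)"
      by (simp only:)
    also have "\<dots> = ennreal l / ennreal l"
      using ab by (simp add: mean_on_interval l_def)
    also have "\<dots> \<le> ennreal c" using l c by (simp add: divide_ennreal ennreal_leI)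
    finally show ?thesis .
  qed
  from ab show ?thesis
  proof (cases rule: mean_epowr_cases[where \<gamma>=\<gamma> and q=2])
    case top
    have "?d = top" unfolding top(2) using c l by (simp add: epowr_def l_def ennreal_mult_top)
    then show ?thesis by (intro triv) (simp add: quot_def)
  next
    case (real G)
    show ?thesis
    proof (cases "G = 0")
      case True
      have "?d = 0" unfolding real(3) using True by (simp add: epowr_def)
      then show ?thesis by (intro triv) (simp add: quot_def)
    next
      case False
      then have G: "0 < G" using real(1) by simp
      define e where "e = c * sqrt G"
      have e: "0 < e" using c G by (simp add: e_def)
      have d: "?d = ennreal e"
      proof -
        have "c * l powr (1 / 2) * (G / l) powr (1 / 2) = e"
          using l G by (simp add: e_def powr_divide powr_half_sqrt)
        then show ?thesis unfolding real(3) l_def[symmetric] using l G c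
          by (simp add: epowr_ennreal ennreal_mult'[symmetric])
      qed
      have quot: "quot (o' t) ?d = o' t / e" for t
        unfolding d quot_def using e o'(1)[of t] by (simp add: divide_ennreal)
      define f where "f j t = ennreal ((o' t / e) ^ (2 * j) / fact j) * indicator {a<..<b} t" for j t
      have [measurable]: "f j \<in> borel_measurable lborel" for j unfolding f_def[abs_def] by measurable
      have sum: "(\<Sum>j. f j t) = ennreal (exp ((o' t / e)\<^sup>2)) * indicator {a<..<b} t" for t
      proof -
        have "(\<lambda>j. ((o' t / e)\<^sup>2) ^ j /\<^sub>R fact j) sums exp ((o' t / e)\<^sup>2)" by (rule exp_converges)
        moreover have "((o' t / e)\<^sup>2) ^ j /\<^sub>R fact j = (o' t / e) ^ (2 * j) / fact j" for j
          unfolding power_mult[of _ 2 j] real_scaleR_def divide_inverse[of _ "fact j"] by (rule mult.commute)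
        ultimately have "(\<lambda>j. (o' t / e) ^ (2 * j) / fact j) sums exp ((o' t / e)\<^sup>2)"
          by (simp only:)
        then have "(\<Sum>j. ennreal ((o' t / e) ^ (2 * j) / fact j)) = ennreal (exp ((o' t / e)\<^sup>2))"
          using e o'(1)[of t] by (intro suminf_ennreal_eq) auto
        then show ?thesis unfolding f_def by (simp add: ennreal_suminf_multc)
      qed
      have tbd: "(\<integral>\<^sup>+t. f j t \<partial>lborel) \<le> ennreal (6 * l * (1 / 2) ^ j)" for j
      proof (cases "j = 0")
        case True
        have "(\<integral>\<^sup>+t. f j t \<partial>lborel) = ennreal l"
          unfolding f_def True using ab by (simp add: l_def)
        then show ?thesis using l True by (simp add: ennreal_leI)
      next
        case False
        define p where "p = real (2 * j)"
        define r where "r = 2 * real j / (real j + 1)"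
        have j: "1 \<le> real j" using False by simp
        have r: "1 / r = 1 + 1 / p - 1 / 2" "r < 2" "1 - r / 2 = 1 / (real j + 1)" "p / r = real j + 1"
          using j by (auto simp: r_def p_def field_simps)
        have "(\<integral>\<^sup>+t. f j t \<partial>lborel) = (\<integral>\<^sup>+t. ennreal (1 / fact j) * (ennreal ((o' t / e) powr p) * indicator {a<..<b} t) \<partial>lborel)"
        proof (intro nn_integral_cong)
          fix t
          have "(o' t / e) powr p = (o' t / e) ^ (2 * j)"
            unfolding p_def using False e o'(1)[of t] by (intro powr_realpow') auto
          then show "f j t = ennreal (1 / fact j) * (ennreal ((o' t / e) powr p) * indicator {a<..<b} t)"
            unfolding f_def by (simp add: mult.assoc[symmetric] ennreal_mult'[symmetric])
        qed
        also have "\<dots> = ennreal (1 / fact j) * (\<integral>\<^sup>+t\<in>{a<..<b}. ennreal ((o' t / e) powr p) \<partial>lborel)"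
          by (rule nn_integral_cmult) measurable
        also have "\<dots> \<le> ennreal (1 / fact j) * ennreal ((C / e) powr p * (2 * (b - a) powr (1 - r / 2) / (1 - r / 2)) powr (p / r) * G powr (p / 2))"
        proof (intro mult_left_mono potential_Lp_bound[OF \<gamma> _ _ ab real(1,2)])
          show "2 \<le> p" using j by (simp add: p_def)
          show "0 \<le> C / e" using C e by simp
          show "0 \<le> o' t / e" for t using o'(1)[of t] e by simp
          show "AE t in lborel. t \<in> {a<..<b} \<longrightarrow> ennreal (o' t / e) \<le> ennreal (C / e) * potential a b \<gamma> t"
            using o'(2)
          proof eventually_elim
            case (elim t)
            have m: "0 \<le> 1 / e" using e by simp
            have "ennreal (o' t / e) = ennreal (1 / e) * ennreal (o' t)"
              using ennreal_mult'[OF m, of "o' t"] by simp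
            moreover have "ennreal (C / e) = ennreal (1 / e) * ennreal C"
              using ennreal_mult'[OF m, of C] by simp
            ultimately show ?case using elim by (simp add: mult.assoc mult_left_mono)
          qed
        qed (use r in auto)
        also have "\<dots> = ennreal (1 / fact j * ((C / c)\<^sup>2 ^ j * (2 * (real j + 1)) ^ (j + 1) * l))"
        proof -
          have 1: "(C / e) powr p = (C / c)\<^sup>2 ^ j / G ^ j"
          proof -
            have "(C / e) powr p = (C / e) ^ (2 * j)" unfolding p_def using C e by (simp add: powr_realpow[symmetric])
            also have "\<dots> = ((C / e)\<^sup>2) ^ j" by (rule power_mult)
            also have "(C / e)\<^sup>2 = (C / c)\<^sup>2 / G" using G by (simp add: e_def power_divide power_mult_distrib)
            finally show ?thesis by (simp add: power_divide power_mult_distrib)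
          qed
          have 2: "(2 * (b - a) powr (1 - r / 2) / (1 - r / 2)) powr (p / r) = (2 * (real j + 1)) ^ (j + 1) * l"
          proof -
            have "2 * (b - a) powr (1 - r / 2) / (1 - r / 2) = (2 * (real j + 1)) * l powr (1 / (real j + 1))"
              unfolding r(3) l_def by simp
            moreover have "((2 * (real j + 1)) * l powr (1 / (real j + 1))) powr (real j + 1)
               = (2 * (real j + 1)) powr (real (j + 1)) * l"
              using l by (simp add: powr_mult powr_powr add.commute)
            moreover have "(2 * (real j + 1)) powr (real (j + 1)) = (2 * (real j + 1)) ^ (j + 1)"
              by (rule powr_realpow) simp
            ultimately show ?thesis unfolding r(4) by simp
          qed
          have 3: "G powr (p / 2) = G ^ j" unfolding p_def using G by (simp add: powr_realpow)
          have "x / g * (y * l) * g = x * y * l" if "g \<noteq> 0" for x y g :: real using that by simp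
          note cancel = this[of "G ^ j" "(C / c)\<^sup>2 ^ j" "(2 * (real j + 1)) ^ (j + 1)"]
          have "G ^ j \<noteq> 0" using G by simp
          from cancel[OF this] show ?thesis unfolding 1 2 3
            by (simp only: ennreal_mult'[symmetric] divide_nonneg_pos fact_gt_zero zero_le_one)
        qed
        also have "\<dots> \<le> ennreal (6 * l * (1 / 2) ^ j)"
        proof (rule ennreal_leI)
          have "(C / c)\<^sup>2 \<le> 1 / 24"
          proof -
            have "C / c \<le> 1 / 5" "0 \<le> C / c" using c C by (auto simp: divide_le_eq)
            then have "(C / c)\<^sup>2 \<le> (1 / 5)\<^sup>2" by (intro power_mono) auto
            then show ?thesis by (simp add: power2_eq_square)
          qed
          then have "((C / c)\<^sup>2) ^ j \<le> (1 / 24) ^ j" by (intro power_mono) auto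
          moreover have "(2 * (real j + 1)) ^ (j + 1) / fact j \<le> 6 * 12 ^ j" by (rule factorial_growth)
          ultimately have "((C / c)\<^sup>2) ^ j * ((2 * (real j + 1)) ^ (j + 1) / fact j) \<le> (1 / 24) ^ j * (6 * 12 ^ j)"
            by (intro mult_mono) auto
          also have "\<dots> = 6 * (1 / 2) ^ j"
          proof -
            have "(1 / 24) ^ j * 12 ^ j = ((1 / 2) ^ j :: real)" by (simp add: power_mult_distrib[symmetric])
            then show ?thesis by simp
          qed
          finally have "((C / c)\<^sup>2) ^ j * ((2 * (real j + 1)) ^ (j + 1) / fact j) * l \<le> 6 * (1 / 2) ^ j * l"
            using l by (intro mult_right_mono) auto
          then show "1 / fact j * ((C / c)\<^sup>2 ^ j * (2 * (real j + 1)) ^ (j + 1) * l) \<le> 6 * l * (1 / 2) ^ j"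
            by (simp add: mult_ac)
        qed
        finally show ?thesis .
      qed
      have "(\<integral>\<^sup>+t\<in>{a<..<b}. ennreal (exp ((quot (o' t) ?d)\<^sup>2)) \<partial>lborel) = (\<integral>\<^sup>+t. (\<Sum>j. f j t) \<partial>lborel)"
        unfolding sum quot ..
      also have "\<dots> = (\<Sum>j. \<integral>\<^sup>+t. f j t \<partial>lborel)" by (rule nn_integral_suminf) measurable
      also have "\<dots> \<le> (\<Sum>j. ennreal (6 * l * (1 / 2) ^ j))" by (intro suminf_le tbd) auto
      also have "\<dots> = ennreal (6 * l * 2)"
      proof (rule suminf_ennreal_eq)
        show "(\<lambda>j. 6 * l * (1 / 2) ^ j) sums (6 * l * 2)"
          using sums_mult[OF geometric_sums[of "1 / 2 :: real"], of "6 * l"] by simp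
      qed (use l in simp)
      also have "\<dots> \<le> ennreal l * ennreal c"
        using l c by (simp add: ennreal_mult'[symmetric] ennreal_leI)
      finally show ?thesis
        unfolding mean_on_interval[OF ab] l_def[symmetric] using l by (intro divide_le_posI_ennreal) auto
    qed
  qed
qed

section \<open>Borel representatives\<close>

text \<open>
  The definitions of the problem use Lebesgue measure, which is complete; Fubini's theorem is applied
  to the Borel measure \<open>lborel\<close>. The facts of this section mediate between the two.
\<close>

lemma borel_measurable_lebesgue_AE:
  fixes f g :: "'b::euclidean_space \<Rightarrow> 'c::euclidean_space"
  assumes "g \<in> borel_measurable lborel" "AE z in lborel. f z = g z"
  shows "f \<in> borel_measurable lebesgue"
proof -
  have "g \<in> borel_measurable lebesgue" using assms(1) by (rule measurable_completion)
  moreover have "AE z in lebesgue. g z = f z"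
    using AE_completion[OF assms(2)] by eventually_elim simp
  ultimately show ?thesis by (rule borel_measurable_AE)
qed

lemma borel_representative:
  fixes f :: "'b::euclidean_space \<Rightarrow> 'c::euclidean_space"
  assumes "f \<in> borel_measurable lebesgue"
  shows "\<exists>g\<in>borel_measurable borel. AE z in lborel. f z = g z"
proof -
  have "\<forall>b. \<exists>g\<in>borel_measurable lborel. AE z in lborel. f z \<bullet> b = g z"
    using assms by (intro allI completion_ex_borel_measurable_real) auto
  then obtain g where g: "\<And>b. g b \<in> borel_measurable lborel" "\<And>b. AE z in lborel. f z \<bullet> b = g b z" by metis
  show ?thesis
  proof (intro bexI)
    have "AE z in lborel. \<forall>b\<in>(Basis::'c set). f z \<bullet> b = g b z"
      using g(2) by (intro AE_finite_allI) auto
    then show "AE z in lborel. f z = (\<Sum>b\<in>Basis. g b z *\<^sub>R b)"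
    proof eventually_elim
      case (elim z)
      have "f z = (\<Sum>b\<in>Basis. (f z \<bullet> b) *\<^sub>R b)" by (simp add: euclidean_representation)
      then show ?case using elim by simp
    qed
    show "(\<lambda>z. \<Sum>b\<in>Basis. g b z *\<^sub>R b) \<in> borel_measurable borel"
      using g(1) by (intro borel_measurable_sum borel_measurable_scaleR) auto
  qed
qed

lemma integrable_representative:
  fixes f :: "'b::euclidean_space \<Rightarrow> 'c::euclidean_space"
  assumes "f \<in> borel_measurable lebesgue" "(\<integral>\<^sup>+z. ennreal (norm (f z)) \<partial>lborel) < \<infinity>"
  shows "\<exists>g. integrable lborel g \<and> (AE z in lborel. f z = g z)"
proof -
  obtain g where g: "g \<in> borel_measurable borel" "AE z in lborel. f z = g z"
    using borel_representative[OF assms(1)] by blast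
  have "(\<integral>\<^sup>+z. ennreal (norm (g z)) \<partial>lborel) = (\<integral>\<^sup>+z. ennreal (norm (f z)) \<partial>lborel)"
    using g(2) by (intro nn_integral_cong_AE) (auto elim!: eventually_mono)
  then have "integrable lborel g" using g(1) assms(2) by (intro integrableI_bounded) auto
  with g(2) show ?thesis by blast
qed

lemma integral_lebesgue_eq_lborel:
  fixes f g :: "'b::euclidean_space \<Rightarrow> 'c::euclidean_space"
  assumes g: "g \<in> borel_measurable lborel" and fg: "AE z in lborel. f z = g z"
  shows "(LINT z|lebesgue. f z) = (LINT z|lborel. g z)"
proof -
  have "(LINT z|lebesgue. f z) = (LINT z|lebesgue. g z)"
    using borel_measurable_lebesgue_AE[OF assms] measurable_completion[OF g] AE_completion[OF fg]
    by (intro integral_cong_AE) auto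
  also have "\<dots> = (LINT z|lborel. g z)" by (rule integral_completion[OF g])
  finally show ?thesis .
qed

lemma AE_lborel_sections:
  fixes P :: "'a::euclidean_space \<times> real \<Rightarrow> bool"
  assumes "AE z in lborel. P z"
  shows "AE x in lborel. AE t in lborel. P (x, t)" "AE t in lborel. AE x in lborel. P (x, t)"
proof -
  have 1: "AE z in lborel \<Otimes>\<^sub>M lborel. P z" using assms unfolding lborel_prod .
  from lborel_pair.AE_pair[OF this] show "AE x in lborel. AE t in lborel. P (x, t)" .
  have "AE z in distr (lborel \<Otimes>\<^sub>M lborel) (lborel \<Otimes>\<^sub>M lborel) (\<lambda>(t, x). (x, t)). P z"
    by (subst lborel_pair.distr_pair_swap[symmetric]) (rule 1)
  then have "AE z in lborel \<Otimes>\<^sub>M lborel. P (case z of (t, x) \<Rightarrow> (x, t))"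
    by (rule AE_distrD[rotated]) measurable
  from lborel_pair.AE_pair[OF this] show "AE t in lborel. AE x in lborel. P (x, t)" by simp
qed

section \<open>From the base value to the time mean\<close>

context parabolic_data
begin

definition vmean :: "'a \<Rightarrow> nat \<Rightarrow> real" where
  "vmean x i = (LINT t|lborel. indicator (tint t0 \<rho>) t * v i (x, t)) / (2 * \<rho>\<^sup>2)"

lemma tint_eq: "tint t0 \<rho> = {t0 - \<rho>\<^sup>2<..<t0 + \<rho>\<^sup>2}"
  by (simp add: tint_def)

lemma maximal_potential_eq: "maximal_potential x t = potential (t0 - \<rho>\<^sup>2) (t0 + \<rho>\<^sup>2) (\<lambda>s. strong_maximal h (x, s)) t"
  unfolding maximal_potential_def potential_def tint_eq ..

lemma section_measurable: "(\<lambda>s. strong_maximal h (x, s)) \<in> borel_measurable borel"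
  by (rule measurable_compose[OF _ strong_maximal_measurable])
     (auto intro!: borel_measurable_continuous_onI continuous_intros)

text \<open>
  The mean of \<open>k v - w\<close> over the interval is \<open>k vmean - w\<close>, and its norm is at most the mean of the
  norm, by duality. The mean of the potential is at most four times its value at \<open>t\<close>.
\<close>

lemma vmean_estimate:
  assumes int: "\<And>i. i < N \<Longrightarrow> integrable lborel (\<lambda>t. v i (x, t))"
    and ae: "AE t in lborel. t \<in> tint t0 \<rho> \<longrightarrow> ennreal (vnorm N (\<lambda>i. k * v i (x, t) - w i)) \<le> ennreal c * maximal_potential x t"
    and c: "0 \<le> c" and t: "t \<in> tint t0 \<rho>"
  shows "ennreal (vnorm N (\<lambda>i. k * vmean x i - w i)) \<le> ennreal (4 * c) * maximal_potential x t"
proof -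
  let ?I = "tint t0 \<rho>" and ?l = "2 * \<rho>\<^sup>2"
  let ?f = "\<lambda>t. vnorm N (\<lambda>i. k * v i (x, t) - w i)"
  have l: "0 < ?l" using \<rho> by simp
  have [measurable]: "?I \<in> sets borel" by (simp add: tint_eq)
  have emI: "emeasure lborel ?I = ennreal ?l" unfolding tint_eq using \<rho> by simp
  have intI: "integrable lborel (\<lambda>t. indicator ?I t * v i (x, t))" if "i < N" for i
    using integrable_mult_bounded[OF int[OF that], of "indicator ?I" 1]
    by (simp add: mult.commute indicator_def)
  have oneI: "integrable lborel (indicator ?I :: real \<Rightarrow> real)" "(LINT t|lborel. indicator ?I t) = ?l"
    using l emI by (auto simp: measure_def)
  have "(\<integral>\<^sup>+t\<in>?I. ennreal (?f t) \<partial>lborel) \<le> (\<integral>\<^sup>+t\<in>?I. ennreal c * maximal_potential x t \<partial>lborel)"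
    using ae by (intro nn_integral_mono_AE) (auto elim!: eventually_mono simp: indicator_def)
  also have "\<dots> = ennreal c * (\<integral>\<^sup>+t\<in>?I. maximal_potential x t \<partial>lborel)"
  proof -
    have "(\<lambda>t. maximal_potential x t) \<in> borel_measurable lborel"
      unfolding maximal_potential_def
      by (rule lborel.borel_measurable_nn_integral) (use section_measurable in \<open>simp add: case_prod_beta\<close>)
    then show ?thesis by (simp add: nn_integral_cmult[symmetric] mult.assoc)
  qed
  also have "\<dots> \<le> ennreal c * (ennreal (4 * ?l) * maximal_potential x t)"
    using potential_mean_bound[OF section_measurable t[unfolded tint_eq], of x]
    unfolding maximal_potential_eq tint_eq by (intro mult_left_mono) auto
  also have "\<dots> = ennreal ?l * (ennreal (4 * c) * maximal_potential x t)"
  proof -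
    have "ennreal c * ennreal (4 * ?l) = ennreal (c * (4 * ?l))" using c by (simp only: ennreal_mult')
    also have "c * (4 * ?l) = ?l * (4 * c)" by simp
    also have "ennreal (?l * (4 * c)) = ennreal ?l * ennreal (4 * c)" using l by (intro ennreal_mult') simp
    finally show ?thesis by (simp only: mult.assoc[symmetric])
  qed
  finally have main: "(\<integral>\<^sup>+t\<in>?I. ennreal (?f t) \<partial>lborel) \<le> ennreal ?l * (ennreal (4 * c) * maximal_potential x t)" .
  show ?thesis
  proof (cases "ennreal (4 * c) * maximal_potential x t")
    case (real B)
    have fin: "(\<integral>\<^sup>+t\<in>?I. ennreal (?f t) \<partial>lborel) \<le> ennreal (?l * B)"
      using main real l by (simp add: ennreal_mult')
    have "vnorm N (\<lambda>i. k * vmean x i - w i) \<le> B"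
    proof (rule vnorm_le_dual)
      fix e :: "nat \<Rightarrow> real" assume e: "(\<Sum>i<N. (e i)\<^sup>2) \<le> 1"
      let ?g = "\<lambda>t. \<Sum>i<N. e i * (k * (indicator ?I t * v i (x, t)) - w i * indicator ?I t)"
      have gi: "integrable lborel ?g"
        using intI oneI by (intro Bochner_Integration.integrable_sum integrable_mult_right Bochner_Integration.integrable_diff) auto
      have "(LINT t|lborel. ?g t) = (\<Sum>i<N. e i * (k * (?l * vmean x i) - w i * ?l))"
        using intI oneI l by (subst Bochner_Integration.integral_sum) (auto simp: vmean_def)
      also have "\<dots> = ?l * (\<Sum>i<N. e i * (k * vmean x i - w i))"
        by (simp add: sum_distrib_left algebra_simps)
      finally have eq: "?l * (\<Sum>i<N. e i * (k * vmean x i - w i)) = (LINT t|lborel. ?g t)" ..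
      have "ennreal (LINT t|lborel. ?g t) \<le> ennreal (norm (LINT t|lborel. ?g t))"
        by (intro ennreal_leI) simp
      also have "\<dots> \<le> (\<integral>\<^sup>+t. ennreal (norm (?g t)) \<partial>lborel)"
        by (rule integral_norm_bound_ennreal[OF gi])
      also have "\<dots> \<le> (\<integral>\<^sup>+t\<in>?I. ennreal (?f t) \<partial>lborel)"
      proof (rule nn_integral_mono)
        fix t
        have "norm (\<Sum>i<N. e i *\<^sub>R (k * v i (x, t) - w i)) \<le> ?f t"
          by (rule norm_sum_le_vnorm[OF e])
        then show "ennreal (norm (?g t)) \<le> ennreal (?f t) * indicator ?I t"
          by (auto simp: indicator_def intro!: ennreal_leI)
      qed
      finally have "ennreal (?l * (\<Sum>i<N. e i * (k * vmean x i - w i))) \<le> ennreal (?l * B)"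
        using fin eq by auto
      then have "?l * (\<Sum>i<N. e i * (k * vmean x i - w i)) \<le> ?l * B"
        using l real by (subst (asm) ennreal_le_iff) auto
      then show "(\<Sum>i<N. e i * (k * vmean x i - w i)) \<le> B" using l by simp
    qed
    then show ?thesis unfolding real(2) by (rule ennreal_leI)
  qed simp
qed

text \<open>
  Both \<open>v\<close> and its time mean are close to the base value, with constants \<open>2\<close> and \<open>8\<close> times
  \<open>step_const\<close>; the triangle inequality adds them, and division by the mass of the kernel undoes the
  missing normalisation.
\<close>

lemma oscillation_estimate:
  "AE x in lborel. x \<in> ball x0 \<rho> \<longrightarrow> (\<forall>i<N. integrable lborel (\<lambda>t. v i (x, t))) \<and>
     (AE t in lborel. t \<in> tint t0 \<rho> \<longrightarrow>
        ennreal (vnorm N (\<lambda>i. v i (x, t) - vmean x i)) \<le> ennreal (10 * step_const / kernel_mass TYPE('a)) * maximal_potential x t)"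
proof -
  let ?k = "kernel_mass TYPE('a)"
  have k: "0 < ?k" by (rule kernel_mass_pos)
  have "AE x in lborel. \<forall>i\<in>{..<N}. integrable lborel (\<lambda>t. v i (x, t))"
  proof (intro AE_finite_allI)
    fix i assume "i \<in> {..<N}"
    then have "integrable (lborel \<Otimes>\<^sub>M lborel) (v i)" using v unfolding lborel_prod by simp
    from lborel_pair.AE_integrable_fst'[OF this] show "AE x in lborel. integrable lborel (\<lambda>t. v i (x, t))" .
  qed simp
  moreover have "AE x in lborel. AE t in lborel. (x, t) \<in> ball x0 \<rho> \<times> tint t0 \<rho> \<longrightarrow>
     ennreal (vnorm N (\<lambda>i. ?k * v i (x, t) - base_mean x i)) \<le> ennreal (2 * step_const) * maximal_potential x t"
    using AE_lborel_sections(1)[OF pointwise_estimate] by simp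
  ultimately show ?thesis
  proof eventually_elim
    case (elim x)
    show ?case
    proof (intro impI conjI)
      assume x: "x \<in> ball x0 \<rho>"
      show int: "\<forall>i<N. integrable lborel (\<lambda>t. v i (x, t))" using elim by auto
      have ae: "AE t in lborel. t \<in> tint t0 \<rho> \<longrightarrow> ennreal (vnorm N (\<lambda>i. ?k * v i (x, t) - base_mean x i)) \<le> ennreal (2 * step_const) * maximal_potential x t"
        using elim(2) x by simp
      then show "AE t in lborel. t \<in> tint t0 \<rho> \<longrightarrow>
        ennreal (vnorm N (\<lambda>i. v i (x, t) - vmean x i)) \<le> ennreal (10 * step_const / ?k) * maximal_potential x t"
      proof eventually_elim
        case (elim t)
        show ?case
        proof
          assume t: "t \<in> tint t0 \<rho>"
          have 1: "ennreal (vnorm N (\<lambda>i. ?k * v i (x, t) - base_mean x i)) \<le> ennreal (2 * step_const) * maximal_potential x t"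
            using elim t by blast
          have 2: "ennreal (vnorm N (\<lambda>i. ?k * vmean x i - base_mean x i)) \<le> ennreal (4 * (2 * step_const)) * maximal_potential x t"
            by (rule vmean_estimate[OF _ ae _ t]) (use int step_const_pos in auto)
          have "?k * vnorm N (\<lambda>i. v i (x, t) - vmean x i) = vnorm N (\<lambda>i. ?k * (v i (x, t) - vmean x i))"
            unfolding vnorm_scale using k by simp
          also have "\<dots> = vnorm N (\<lambda>i. (?k * v i (x, t) - base_mean x i) + (-1) * (?k * vmean x i - base_mean x i))"
            by (simp add: algebra_simps)
          also have "\<dots> \<le> vnorm N (\<lambda>i. ?k * v i (x, t) - base_mean x i) + vnorm N (\<lambda>i. (-1) * (?k * vmean x i - base_mean x i))"
            by (rule vnorm_triangle)
          also have "vnorm N (\<lambda>i. (-1) * (?k * vmean x i - base_mean x i)) = vnorm N (\<lambda>i. ?k * vmean x i - base_mean x i)"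
            unfolding vnorm_scale by simp
          finally have "ennreal (?k * vnorm N (\<lambda>i. v i (x, t) - vmean x i))
             \<le> ennreal (vnorm N (\<lambda>i. ?k * v i (x, t) - base_mean x i)) + ennreal (vnorm N (\<lambda>i. ?k * vmean x i - base_mean x i))"
            by (simp add: ennreal_leI vnorm_nonneg flip: ennreal_plus)
          also have "\<dots> \<le> ennreal (2 * step_const) * maximal_potential x t + ennreal (4 * (2 * step_const)) * maximal_potential x t"
            by (rule add_mono[OF 1 2])
          also have "\<dots> = ennreal (10 * step_const) * maximal_potential x t"
            using step_const_pos by (simp flip: distrib_right ennreal_plus)
          finally have "ennreal (1 / ?k) * ennreal (?k * vnorm N (\<lambda>i. v i (x, t) - vmean x i)) \<le> ennreal (1 / ?k) * (ennreal (10 * step_const) * maximal_potential x t)"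
            by (rule mult_left_mono) simp
          moreover have "ennreal (1 / ?k) * ennreal (?k * y) = ennreal y" for y
            using k by (simp add: ennreal_mult'[symmetric])
          moreover have "ennreal (1 / ?k) * (ennreal (10 * step_const) * maximal_potential x t) = ennreal (10 * step_const / ?k) * maximal_potential x t"
            using k by (simp add: mult.assoc[symmetric] ennreal_mult'[symmetric])
          ultimately show "ennreal (vnorm N (\<lambda>i. v i (x, t) - vmean x i)) \<le> ennreal (10 * step_const / ?k) * maximal_potential x t"
            by simp
        qed
      qed
    qed
  qed
qed

end

section \<open>Measurability of Caratheodory compositions\<close>

lemma tendsto_componentwise_fun:
  fixes f :: "'b \<Rightarrow> nat \<Rightarrow> 'c::topological_space"
  assumes "\<And>i. ((\<lambda>k. f k i) \<longlongrightarrow> l i) F"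
  shows "(f \<longlongrightarrow> l) F"
proof -
  have "limitin (product_topology (\<lambda>_::nat. euclidean :: 'c topology) UNIV) f l F"
    unfolding limitin_componentwise using assms by simp
  then show ?thesis by (simp add: euclidean_product_topology)
qed

lemma simple_function_vector:
  fixes F :: "nat \<Rightarrow> 'b \<Rightarrow> 'c::zero"
  assumes "\<And>j. j < m \<Longrightarrow> simple_function M (F j)"
  shows "simple_function M (\<lambda>z j. if j < m then F j z else 0)"
  using assms
proof (induction m)
  case 0
  then show ?case by simp
next
  case (Suc m)
  have eq: "(\<lambda>z j. if j < Suc m then F j z else 0) = (\<lambda>z. (\<lambda>g x. g(m := x)) (\<lambda>j. if j < m then F j z else 0) (F m z))"
    by (auto simp: fun_eq_iff less_Suc_eq)
  have "simple_function M (\<lambda>z j. if j < m then F j z else 0)" using Suc.IH Suc.prems by simp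
  then show ?case unfolding eq
    by (rule simple_function_compose2) (simp add: Suc.prems)
qed

text \<open>
  A simple function takes finitely many values, and on each of its level sets the composition is a
  section of \<open>a\<close> at a fixed argument.
\<close>

lemma simple_function_composition_measurable:
  fixes a :: "'b \<Rightarrow> 'c \<Rightarrow> 'd::{second_countable_topology, real_normed_vector}"
  assumes g: "simple_function M g" and a: "\<And>z. z \<in> space M \<Longrightarrow> (\<lambda>y. a y (g z)) \<in> borel_measurable M"
  shows "(\<lambda>z. a z (g z)) \<in> borel_measurable M"
proof -
  have "(\<lambda>x. (\<lambda>i z. a z i) (g x) x) \<in> borel_measurable M"
  proof (rule measurable_compose_countable'[where I="g ` space M"])
    show "g \<in> M \<rightarrow>\<^sub>M count_space (g ` space M)"
      using g by (subst measurable_count_space_eq2) (auto simp: simple_function_def)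
    show "countable (g ` space M)" using simple_functionD(1)[OF g] by (rule countable_finite)
  qed (use a in auto)
  then show ?thesis .
qed

text \<open>
  Approximate \<open>g\<close> by simple functions, for which the composition is measurable, and use continuity of
  \<open>A z\<close> to pass to the limit. The null set \<open>Z\<close> on which continuity fails is removed before the limit
  and restored after it, by completeness of Lebesgue measure.
\<close>

lemma caratheodory_measurable:
  fixes A :: "'b::euclidean_space \<Rightarrow> (nat \<Rightarrow> 'c::euclidean_space) \<Rightarrow> nat \<Rightarrow> 'd::euclidean_space"
  assumes S: "S \<in> sets lebesgue" and i: "i < N"
    and A: "\<And>\<xi>. \<xi> \<in> vecs N \<Longrightarrow> vmeasurable_on N S (\<lambda>z. A z \<xi>)"
    and cont: "AE z in lebesgue_on S. continuous_on (vecs N) (A z)"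
    and g: "vmeasurable_on N S g" "\<And>z. z \<in> S \<Longrightarrow> g z \<in> vecs N"
  shows "(\<lambda>z. indicator S z *\<^sub>R A z (g z) i) \<in> borel_measurable lebesgue"
proof -
  have sp: "space (lebesgue_on S) = S" by (simp add: space_restrict_space)
  have S': "S \<inter> space lebesgue \<in> sets lebesgue" using S by simp
  have "\<exists>F. (\<forall>k. simple_function (lebesgue_on S) (F k)) \<and> (\<forall>z\<in>S. (\<lambda>k. F k z) \<longlonglongrightarrow> g z j)" if "j < N" for j
  proof -
    have "(\<lambda>z. g z j) \<in> borel_measurable (lebesgue_on S)" using g(1) that by (auto simp: vmeasurable_on_def)
    from borel_measurable_implies_sequence_metric[OF this, of 0] show ?thesis unfolding sp by blast
  qed
  then obtain F where F: "\<And>j k. j < N \<Longrightarrow> simple_function (lebesgue_on S) (F j k)"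
    "\<And>j z. j < N \<Longrightarrow> z \<in> S \<Longrightarrow> (\<lambda>k. F j k z) \<longlonglongrightarrow> g z j" by metis
  define d where "d k z j = (if j < N then F j k z else 0)" for k z j
  have sd: "simple_function (lebesgue_on S) (d k)" for k
    unfolding d_def[abs_def] by (rule simple_function_vector) (rule F(1))
  have dv: "d k z \<in> vecs N" for k z by (auto simp: vecs_def d_def)
  have dlim: "(\<lambda>k. d k z) \<longlonglongrightarrow> g z" if "z \<in> S" for z
  proof (rule tendsto_componentwise_fun)
    fix j
    show "(\<lambda>k. d k z j) \<longlonglongrightarrow> g z j"
      using F(2)[of j z] that g(2)[OF that] by (cases "j < N") (auto simp: d_def vecs_def)
  qed
  have meas: "(\<lambda>z. indicator S z *\<^sub>R A z (d k z) i) \<in> borel_measurable lebesgue" for k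
  proof -
    have "(\<lambda>z. A z (d k z) i) \<in> borel_measurable (lebesgue_on S)"
      by (rule simple_function_composition_measurable[where a="\<lambda>z \<xi>. A z \<xi> i", OF sd])
         (use A[OF dv] i in \<open>auto simp: vmeasurable_on_def\<close>)
    then show ?thesis by (subst (asm) borel_measurable_restrict_space_iff[OF S'])
  qed
  have "AE z in lebesgue. z \<in> S \<longrightarrow> continuous_on (vecs N) (A z)"
    using cont by (subst (asm) AE_restrict_space_iff[OF S'])
  then obtain Z where Z: "Z \<in> null_sets lebesgue" "\<And>z. z \<notin> Z \<Longrightarrow> z \<in> S \<Longrightarrow> continuous_on (vecs N) (A z)"
    by (auto elim!: AE_E3)
  let ?f = "\<lambda>k z. indicator (- Z) z *\<^sub>R (indicator S z *\<^sub>R A z (d k z) i)"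
  let ?g = "\<lambda>z. indicator (- Z) z *\<^sub>R (indicator S z *\<^sub>R A z (g z) i)"
  have Zs: "- Z \<in> sets lebesgue" using sets.compl_sets[OF null_setsD2[OF Z(1)]] by (simp add: Compl_eq_Diff_UNIV)
  have "?g \<in> borel_measurable lebesgue"
  proof (rule borel_measurable_LIMSEQ_metric)
    show "?f k \<in> borel_measurable lebesgue" for k
      by (rule borel_measurable_scaleR[OF borel_measurable_indicator[OF Zs] meas])
    fix z
    show "(\<lambda>k. ?f k z) \<longlonglongrightarrow> ?g z"
    proof (cases "z \<in> S \<and> z \<notin> Z")
      case True
      have "(\<lambda>k. A z (d k z)) \<longlonglongrightarrow> A z (g z)"
        by (rule continuous_on_tendsto_compose[OF Z(2) dlim]) (use True g dv in auto)
      moreover have "continuous_on UNIV (\<lambda>y. (y :: nat \<Rightarrow> 'd) i)" by simp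
      ultimately have "(\<lambda>k. A z (d k z) i) \<longlonglongrightarrow> A z (g z) i"
        using continuous_on_tendsto_compose[of UNIV "\<lambda>y. (y :: nat \<Rightarrow> 'd) i"] by auto
      then show ?thesis using True by simp
    qed (auto simp: indicator_def)
  qed
  moreover have "AE z in lebesgue. ?g z = indicator S z *\<^sub>R A z (g z) i"
    using AE_not_in[OF Z(1)] by eventually_elim simp
  ultimately show ?thesis by (rule borel_measurable_AE)
qed

section \<open>Weak solutions satisfy the scalar weak equations\<close>

text \<open>
  Multiply the weak gradient equation on the slice at time \<open>t\<close> by \<open>\<beta> t\<close> and integrate in \<open>t\<close>. The
  slices of \<open>v\<close> and \<open>G\<close> represent \<open>f\<close> and \<open>g\<close> for almost every \<open>t\<close>, by Fubini's theorem.
\<close>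

lemma space_weak_from_slices:
  fixes f v :: "'a::euclidean_space \<times> real \<Rightarrow> real" and g G :: "'a \<times> real \<Rightarrow> 'a"
  assumes v: "integrable lborel v" and G: "integrable lborel G"
    and fv: "AE z in lborel. indicator (U \<times> J) z * f z = v z"
    and gG: "AE z in lborel. indicator (U \<times> J) z *\<^sub>R g z = G z"
    and J: "J \<in> sets lebesgue"
    and wg: "AE t in lebesgue_on J. weak_gradient U (\<lambda>x. f (x, t)) (\<lambda>x. g (x, t))"
  shows "space_weak U v G"
  unfolding space_weak_def
proof (intro allI impI)
  fix \<phi> :: "'a \<Rightarrow> real" and \<beta> :: "real \<Rightarrow> real" and b :: 'a
  assume *: "test_fun U \<phi> \<and> b \<in> Basis \<and> continuous_on UNIV \<beta> \<and> bounded (range \<beta>)"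
  then have b: "b \<in> Basis" and \<phi>: "test_fun U \<phi>" by auto
  obtain B where B: "\<And>x. \<bar>\<phi> x\<bar> \<le> B" "\<And>x c. c \<in> Basis \<Longrightarrow> \<bar>frechet_derivative \<phi> (at x) c\<bar> \<le> B"
    using test_fun_bounded[OF \<phi>] by blast
  obtain B' where B': "\<And>x. \<bar>\<beta> x\<bar> \<le> B'" using * by (auto simp: bounded_iff)
  let ?d = "\<lambda>c x. frechet_derivative \<phi> (at x) c"
  note [measurable] = fst_snd_borel
  have \<phi>m [measurable]: "\<phi> \<in> borel_measurable borel" and \<beta>m [measurable]: "\<beta> \<in> borel_measurable borel"
    using test_fun_derivative(3)[OF \<phi>] * by (blast intro: borel_measurable_continuous_onI)+
  have dm: "?d c \<in> borel_measurable borel" if "c \<in> Basis" for c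
    using test_fun_derivative(2)[OF \<phi> that] by (rule borel_measurable_continuous_onI)
  note [measurable] = dm[OF b]
  have bd: "\<bar>\<phi> (fst z) * \<beta> (snd z)\<bar> \<le> B * B'" "\<bar>?d b (fst z) * \<beta> (snd z)\<bar> \<le> B * B'" for z :: "'a \<times> real"
    unfolding abs_mult using B(1)[of "fst z"] B(2)[OF b, of "fst z"] B'[of "snd z"] by (auto intro!: mult_mono)
  have i1: "integrable lborel (\<lambda>z. v z * (?d b (fst z) * \<beta> (snd z)))"
    by (rule integrable_mult_bounded[OF v _ bd(2)]) measurable
  have i2: "integrable lborel (\<lambda>z. (G z \<bullet> b) * (\<phi> (fst z) * \<beta> (snd z)))"
    by (rule integrable_mult_bounded[OF integrable_inner_left _ bd(1)]) (use G in simp, measurable)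
  have slice: "AE t in lborel. (LINT x|lborel. v (x, t) * (?d b x * \<beta> t)) = - (LINT x|lborel. (G (x, t) \<bullet> b) * (\<phi> x * \<beta> t))"
  proof -
    have "AE t in lborel. AE x in lborel. indicator (U \<times> J) (x, t) * f (x, t) = v (x, t)"
      "AE t in lborel. AE x in lborel. indicator (U \<times> J) (x, t) *\<^sub>R g (x, t) = G (x, t)"
      using AE_lborel_sections(2)[OF fv] AE_lborel_sections(2)[OF gG] by auto
    moreover have "AE t in lborel. integrable lborel (\<lambda>x. v (x, t))"
      using lborel_pair.AE_integrable_snd[of "\<lambda>x t. v (x, t)"] v by (simp add: lborel_prod)
    moreover have "AE t in lborel. integrable lborel (\<lambda>x. G (x, t))"
      using lborel_pair.AE_integrable_snd[of "\<lambda>x t. G (x, t)"] G by (simp add: lborel_prod)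
    moreover have "AE t in lborel. t \<in> J \<longrightarrow> weak_gradient U (\<lambda>x. f (x, t)) (\<lambda>x. g (x, t))"
    proof -
      have "J \<inter> space lebesgue \<in> sets lebesgue" using J by simp
      then show ?thesis using wg by (simp add: AE_restrict_space_iff AE_completion_iff)
    qed
    ultimately show ?thesis
    proof eventually_elim
      case (elim t)
      note e = elim
      show ?case
      proof (cases "t \<in> J")
        case False
        have "AE x in lborel. v (x, t) * (?d b x * \<beta> t) = 0" 
          using e(1) by eventually_elim (use False in auto)
        moreover have "AE x in lborel. (G (x, t) \<bullet> b) * (\<phi> x * \<beta> t) = 0"
          using e(2) by eventually_elim (use False in auto)
        ultimately show ?thesis by (simp add: integral_eq_zero_AE)
      next
        case True
        have ivd: "integrable lborel (\<lambda>x. v (x, t) * ?d c x)" if "c \<in> Basis" for c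
          by (rule integrable_mult_bounded[OF e(3) _ B(2)]) (use dm that in auto)
        have ivg: "integrable lborel (\<lambda>x. v (x, t) *\<^sub>R grad \<phi> x)"
          unfolding grad_def scaleR_sum_right scaleR_scaleR
          by (intro Bochner_Integration.integrable_sum integrable_scaleR_left ivd)
        have iG: "integrable lborel (\<lambda>x. (G (x, t) \<bullet> c) * \<phi> x)" for c
          by (rule integrable_mult_bounded[OF _ _ B(1)]) (use e(4) in auto)
        have iGs: "integrable lborel (\<lambda>x. \<phi> x *\<^sub>R G (x, t))"
        proof -
          have "integrable lborel (\<lambda>x. \<Sum>c\<in>Basis. ((G (x, t) \<bullet> c) * \<phi> x) *\<^sub>R c)"
            by (intro Bochner_Integration.integrable_sum integrable_scaleR_left iG)
          moreover have "(\<Sum>c\<in>Basis. ((G (x, t) \<bullet> c) * \<phi> x) *\<^sub>R c) = \<phi> x *\<^sub>R G (x, t)" for x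
            by (subst (2) euclidean_representation[symmetric]) (simp add: scaleR_sum_right mult.commute)
          ultimately show ?thesis by simp
        qed
        have grb: "grad \<phi> x \<bullet> b = ?d b x" for x
          using b by (simp add: grad_def)
        have "(LINT x|lebesgue. indicator U x *\<^sub>R (f (x, t) *\<^sub>R grad \<phi> x)) = (LINT x|lborel. v (x, t) *\<^sub>R grad \<phi> x)"
        proof (rule integral_lebesgue_eq_lborel)
          show "AE x in lborel. indicator U x *\<^sub>R (f (x, t) *\<^sub>R grad \<phi> x) = v (x, t) *\<^sub>R grad \<phi> x"
            using e(1) by eventually_elim (use True in \<open>auto simp: indicator_def split: if_splits\<close>)
        qed (use ivg in auto)
        moreover have "(LINT x|lebesgue. indicator U x *\<^sub>R (\<phi> x *\<^sub>R g (x, t))) = (LINT x|lborel. \<phi> x *\<^sub>R G (x, t))"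
        proof (rule integral_lebesgue_eq_lborel)
          show "AE x in lborel. indicator U x *\<^sub>R (\<phi> x *\<^sub>R g (x, t)) = \<phi> x *\<^sub>R G (x, t)"
            using e(2) by eventually_elim (use True in \<open>auto simp: indicator_def split: if_splits\<close>)
        qed (use iGs in auto)
        moreover have "(LINT x:U|lebesgue. f (x, t) *\<^sub>R grad \<phi> x) = - (LINT x:U|lebesgue. \<phi> x *\<^sub>R g (x, t))"
          using e(5) True \<phi> by (auto simp: weak_gradient_def)
        ultimately have "(LINT x|lborel. v (x, t) *\<^sub>R grad \<phi> x) = - (LINT x|lborel. \<phi> x *\<^sub>R G (x, t))"
          unfolding set_lebesgue_integral_def by simp
        then have "(LINT x|lborel. v (x, t) *\<^sub>R grad \<phi> x) \<bullet> b = - (LINT x|lborel. \<phi> x *\<^sub>R G (x, t)) \<bullet> b" by simp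
        then have "(LINT x|lborel. v (x, t) * ?d b x) = - (LINT x|lborel. (G (x, t) \<bullet> b) * \<phi> x)"
          using integral_inner_left[of b lborel "\<lambda>x. v (x, t) *\<^sub>R grad \<phi> x", OF ivg]
            integral_inner_left[of b lborel "\<lambda>x. \<phi> x *\<^sub>R G (x, t)", OF iGs]
          by (simp add: grb mult.commute)
        then have "(LINT x|lborel. v (x, t) * ?d b x) * \<beta> t = (- (LINT x|lborel. (G (x, t) \<bullet> b) * \<phi> x)) * \<beta> t" by simp
        then show ?thesis by (simp add: mult.assoc[symmetric])
      qed
    qed
  qed
  have "(LINT z|lborel. v z * (?d b (fst z) * \<beta> (snd z))) = (LINT t|lborel. LINT x|lborel. v (x, t) * (?d b x * \<beta> t))"
    using lborel_pair.integral_snd[of "\<lambda>x t. v (x, t) * (?d b x * \<beta> t)"] i1 by (simp add: lborel_prod split_beta')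
  also have "\<dots> = (LINT t|lborel. - (LINT x|lborel. (G (x, t) \<bullet> b) * (\<phi> x * \<beta> t)))"
  proof (rule integral_cong_AE[OF _ _ slice])
    show "(\<lambda>t. LINT x|lborel. v (x, t) * (?d b x * \<beta> t)) \<in> borel_measurable lborel"
      using lborel_pair.integrable_snd[of "\<lambda>x t. v (x, t) * (?d b x * \<beta> t)"] i1 by (simp add: lborel_prod split_beta')
    show "(\<lambda>t. - (LINT x|lborel. (G (x, t) \<bullet> b) * (\<phi> x * \<beta> t))) \<in> borel_measurable lborel"
      using lborel_pair.integrable_snd[of "\<lambda>x t. (G (x, t) \<bullet> b) * (\<phi> x * \<beta> t)"] i2 by (simp add: lborel_prod split_beta')
  qed
  also have "\<dots> = - (LINT z|lborel. (G z \<bullet> b) * (\<phi> (fst z) * \<beta> (snd z)))"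
    using lborel_pair.integral_snd[of "\<lambda>x t. (G (x, t) \<bullet> b) * (\<phi> x * \<beta> t)"] i2 by (simp add: lborel_prod split_beta')
  finally show "(LINT z|lborel. v z * (?d b (fst z) * \<beta> (snd z))) = - (LINT z|lborel. (G z \<bullet> b) * (\<phi> (fst z) * \<beta> (snd z)))" .
qed

lemma test_fun_subset: "test_fun D \<psi> \<Longrightarrow> D \<subseteq> U \<Longrightarrow> test_fun U \<psi>"
  by (auto simp: test_fun_def compactly_in_def)

lemma test_fun_null: "test_fun U (\<lambda>_. 0)"
  by (simp add: test_fun_def compactly_in_def)

text \<open>
  Test the system with the vector function whose only nonzero component is \<open>\<psi>\<close>, at position \<open>i\<close>. As
  \<open>\<psi>\<close> is supported in \<open>D\<close>, nothing is lost by the cut-off.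
\<close>

lemma time_weak_from_solution:
  fixes u :: "'a::euclidean_space \<times> real \<Rightarrow> nat \<Rightarrow> real"
  assumes sol: "weak_solution N S A F u Du" and i: "i < N" and D: "D \<subseteq> S"
    and v: "integrable lborel v" "AE z in lborel. indicator D z * u z i = v z"
    and P: "integrable lborel P" "AE z in lborel. indicator D z *\<^sub>R A z (Du z) i = P z"
    and R: "integrable lborel R" "AE z in lborel. indicator D z *\<^sub>R F z i = R z"
  shows "time_weak D v (\<lambda>z. P z - R z)"
  unfolding time_weak_def
proof (intro allI impI)
  fix \<psi> :: "'a \<times> real \<Rightarrow> real" assume \<psi>: "test_fun D \<psi>"
  obtain B where B: "\<And>z. \<bar>time_deriv \<psi> z\<bar> \<le> B" "\<And>z. norm (space_grad \<psi> z) \<le> B"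
    using test_fun_time_space_bounded[OF \<psi>] by blast
  have c: "time_deriv \<psi> \<in> borel_measurable lborel" "space_grad \<psi> \<in> borel_measurable lborel"
    using test_fun_time_space_continuous[OF \<psi>] by (auto intro: borel_measurable_continuous_onI)
  have i1: "integrable lborel (\<lambda>z. v z * time_deriv \<psi> z)"
    by (rule integrable_mult_bounded[OF v(1) c(1) B(1)])
  have i2: "integrable lborel (\<lambda>z. P z \<bullet> space_grad \<psi> z)"
    by (rule integrable_inner_bounded[OF P(1) c(2) B(2)])
  have i3: "integrable lborel (\<lambda>z. R z \<bullet> space_grad \<psi> z)"
    by (rule integrable_inner_bounded[OF R(1) c(2) B(2)])
  let ?\<phi> = "\<lambda>j. if j = i then \<psi> else (\<lambda>_. 0)"
  have td0: "time_deriv (\<lambda>_. 0) z = 0" and sg0: "space_grad (\<lambda>_. 0) z = 0" for z :: "'a \<times> real"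
    by (simp_all add: time_deriv_def space_grad_def grad_def)
  have td: "vinner N w (\<lambda>j. time_deriv (?\<phi> j) z) = w i * time_deriv \<psi> z" for w z
  proof -
    have "vinner N w (\<lambda>j. time_deriv (?\<phi> j) z) = (\<Sum>j<N. if j = i then w i * time_deriv \<psi> z else 0)"
      unfolding vinner_def by (intro sum.cong) (auto simp: td0)
    then show ?thesis using i by simp
  qed
  have sg: "vinner N w (\<lambda>j. space_grad (?\<phi> j) z) = w i \<bullet> space_grad \<psi> z" for w z
  proof -
    have "vinner N w (\<lambda>j. space_grad (?\<phi> j) z) = (\<Sum>j<N. if j = i then w i \<bullet> space_grad \<psi> z else 0)"
      unfolding vinner_def by (intro sum.cong) (auto simp: sg0)
    then show ?thesis using i by simp
  qed
  have tests: "\<forall>j<N. test_fun S (?\<phi> j)"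
    by (simp add: test_fun_subset[OF \<psi> D] test_fun_null)
  have "(LINT z:S|lebesgue. - vinner N (u z) (\<lambda>j. time_deriv (?\<phi> j) z)
                             + vinner N (A z (Du z)) (\<lambda>j. space_grad (?\<phi> j) z))
        = (LINT z:S|lebesgue. vinner N (F z) (\<lambda>j. space_grad (?\<phi> j) z))"
    by (rule mp[OF spec[OF sol[unfolded weak_solution_def], of ?\<phi>] tests])
  then have eq: "(LINT z|lebesgue. indicator S z *\<^sub>R (- (u z i * time_deriv \<psi> z) + A z (Du z) i \<bullet> space_grad \<psi> z))
     = (LINT z|lebesgue. indicator S z *\<^sub>R (F z i \<bullet> space_grad \<psi> z))"
    unfolding td sg set_lebesgue_integral_def .
  have off: "time_deriv \<psi> z = 0 \<and> space_grad \<psi> z = 0" if "z \<notin> D" for z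
    using test_fun_time_space_zero[OF \<psi> that] by simp
  have "(LINT z|lebesgue. indicator S z *\<^sub>R (- (u z i * time_deriv \<psi> z) + A z (Du z) i \<bullet> space_grad \<psi> z))
    = (LINT z|lborel. - (v z * time_deriv \<psi> z) + P z \<bullet> space_grad \<psi> z)"
  proof (rule integral_lebesgue_eq_lborel)
    show "(\<lambda>z. - (v z * time_deriv \<psi> z) + P z \<bullet> space_grad \<psi> z) \<in> borel_measurable lborel"
      using i1 i2 by auto
    show "AE z in lborel. indicator S z *\<^sub>R (- (u z i * time_deriv \<psi> z) + A z (Du z) i \<bullet> space_grad \<psi> z)
       = - (v z * time_deriv \<psi> z) + P z \<bullet> space_grad \<psi> z"
      using v(2) P(2)
    proof eventually_elim
      case (elim z)
      show ?case
      proof (cases "z \<in> D")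
        case True
        then show ?thesis using elim D by auto
      next
        case False
        then show ?thesis using off[OF False] by simp
      qed
    qed
  qed
  moreover have "(LINT z|lebesgue. indicator S z *\<^sub>R (F z i \<bullet> space_grad \<psi> z)) = (LINT z|lborel. R z \<bullet> space_grad \<psi> z)"
  proof (rule integral_lebesgue_eq_lborel)
    show "(\<lambda>z. R z \<bullet> space_grad \<psi> z) \<in> borel_measurable lborel" using i3 by auto
    show "AE z in lborel. indicator S z *\<^sub>R (F z i \<bullet> space_grad \<psi> z) = R z \<bullet> space_grad \<psi> z"
      using R(2)
    proof eventually_elim
      case (elim z)
      show ?case
      proof (cases "z \<in> D")
        case True
        then show ?thesis using elim D by auto
      next
        case False
        then show ?thesis using off[OF False] by simp
      qed
    qed
  qed
  ultimately have "(LINT z|lborel. - (v z * time_deriv \<psi> z) + P z \<bullet> space_grad \<psi> z) = (LINT z|lborel. R z \<bullet> space_grad \<psi> z)"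
    using eq by simp
  then have "- (LINT z|lborel. v z * time_deriv \<psi> z) + (LINT z|lborel. P z \<bullet> space_grad \<psi> z) = (LINT z|lborel. R z \<bullet> space_grad \<psi> z)"
    using i1 i2 by (subst (asm) Bochner_Integration.integral_add) auto
  moreover have "(LINT z|lborel. (P z - R z) \<bullet> space_grad \<psi> z) = (LINT z|lborel. P z \<bullet> space_grad \<psi> z) - (LINT z|lborel. R z \<bullet> space_grad \<psi> z)"
    using i2 i3 by (simp add: inner_diff_left)
  ultimately show "(LINT z|lborel. v z * time_deriv \<psi> z) = (LINT z|lborel. (P z - R z) \<bullet> space_grad \<psi> z)" by simp
qed

section \<open>Functions controlled by a potential\<close>

lemma mean_on_cong_AE:
  fixes I :: "real set"
  assumes "AE t in lborel. t \<in> I \<longrightarrow> f t = g t"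
  shows "mean_on I f = mean_on I g"
  unfolding mean_on_def using AE_completion[OF assms]
  by (intro arg_cong2[of _ _ _ _ "(/)"] nn_integral_cong_AE refl) (auto elim!: eventually_mono simp: indicator_def)

text \<open>
  Almost everywhere on the interval, \<open>f\<close> is at most \<open>C\<close> times the potential of \<open>\<gamma>\<close>. The Borel function
  \<open>o'\<close> supplies the measurability that is not known of \<open>f\<close>; in the application \<open>f\<close> is the oscillation
  of a given representative of the solution.
\<close>

definition controlled :: "real \<Rightarrow> real \<Rightarrow> real \<Rightarrow> (real \<Rightarrow> ennreal) \<Rightarrow> (real \<Rightarrow> real) \<Rightarrow> bool" where
  "controlled C a b \<gamma> f \<longleftrightarrow> \<gamma> \<in> borel_measurable borel \<and>
     (\<exists>o'\<in>borel_measurable borel. (\<forall>t. 0 \<le> o' t) \<and> (AE t in lborel. t \<in> {a<..<b} \<longrightarrow> f t = o' t) \<and>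
       (AE t in lborel. t \<in> {a<..<b} \<longrightarrow> ennreal (o' t) \<le> ennreal C * potential a b \<gamma> t))"

lemma controlledI:
  assumes "\<gamma> \<in> borel_measurable borel" "o' \<in> borel_measurable borel" "\<And>t. 0 \<le> o' t"
    "AE t in lborel. t \<in> {a<..<b} \<longrightarrow> f t = o' t"
    "AE t in lborel. t \<in> {a<..<b} \<longrightarrow> ennreal (o' t) \<le> ennreal C * potential a b \<gamma> t"
  shows "controlled C a b \<gamma> f"
  unfolding controlled_def using assms by (intro conjI bexI[of _ o']) auto

lemma controlled_power:
  assumes f: "controlled C a b \<gamma> f" and ab: "a < b" and C: "0 < C" and q: "1 < q" "q \<le> p"
    and r: "1 / r = 1 + 1 / p - 1 / q" "r < 2"
  shows "epowr (mean_on {a<..<b} (\<lambda>t. ennreal (f t powr p / measure lebesgue {a<..<b} powr (p / 2)))) (1 / p)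
    \<le> ennreal (C * (2 / (1 - r / 2)) powr (1 / r)) * epowr (mean_on {a<..<b} (\<lambda>t. epowr (\<gamma> t) q)) (1 / q)"
proof -
  have m: "measure lebesgue {a<..<b} = b - a" using ab by simp
  obtain o' where o': "\<gamma> \<in> borel_measurable borel" "o' \<in> borel_measurable borel" "\<And>t. 0 \<le> o' t"
    "AE t in lborel. t \<in> {a<..<b} \<longrightarrow> f t = o' t"
    "AE t in lborel. t \<in> {a<..<b} \<longrightarrow> ennreal (o' t) \<le> ennreal C * potential a b \<gamma> t"
    using f unfolding controlled_def by blast
  have "mean_on {a<..<b} (\<lambda>t. ennreal (f t powr p / (b - a) powr (p / 2)))
     = mean_on {a<..<b} (\<lambda>t. ennreal (o' t powr p / (b - a) powr (p / 2)))"
    by (rule mean_on_cong_AE) (use o'(4) in \<open>eventually_elim, auto\<close>)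
  then show ?thesis unfolding m using potential_mean_power[OF o'(1) q ab r C o'(3,5)] by simp
qed

lemma controlled_exp:
  assumes f: "controlled C a b \<gamma> f" and ab: "a < b" and C: "0 < C"
  shows "mean_on {a<..<b} (\<lambda>t. ennreal (exp ((quot (f t)
           (ennreal ((12 + 5 * C) * measure lebesgue {a<..<b} powr (1 / 2))
             * epowr (mean_on {a<..<b} (\<lambda>t. epowr (\<gamma> t) 2)) (1 / 2)))\<^sup>2))) \<le> ennreal (12 + 5 * C)"
    (is "mean_on _ (\<lambda>t. ?E (f t)) \<le> _")
proof -
  have m: "measure lebesgue {a<..<b} = b - a" using ab by simp
  obtain o' where o': "\<gamma> \<in> borel_measurable borel" "o' \<in> borel_measurable borel" "\<And>t. 0 \<le> o' t"
    "AE t in lborel. t \<in> {a<..<b} \<longrightarrow> f t = o' t"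
    "AE t in lborel. t \<in> {a<..<b} \<longrightarrow> ennreal (o' t) \<le> ennreal C * potential a b \<gamma> t"
    using f unfolding controlled_def by blast
  have "mean_on {a<..<b} (\<lambda>t. ?E (f t)) = mean_on {a<..<b} (\<lambda>t. ?E (o' t))"
    by (rule mean_on_cong_AE) (use o'(4) in \<open>eventually_elim, auto\<close>)
  then show ?thesis unfolding m using potential_mean_exp[OF o'(1) ab C o'(2,3,5)] by simp
qed

lemma controlled_sup:
  assumes f: "controlled C a b \<gamma> f" and ab: "a < b" and C: "0 < C" and q: "2 < q"
  shows "esssup (lebesgue_on {a<..<b}) (\<lambda>t. ennreal (f t / measure lebesgue {a<..<b} powr (1 / 2)))
    \<le> ennreal (C * (2 / (1 - q / (q - 1) / 2)) powr (1 / (q / (q - 1)))) * epowr (mean_on {a<..<b} (\<lambda>t. epowr (\<gamma> t) q)) (1 / q)"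
    (is "_ \<le> ?R")
proof -
  let ?I = "{a<..<b}"
  have m: "measure lebesgue ?I = b - a" using ab by simp
  have I: "?I \<inter> space lebesgue \<in> sets lebesgue" by simp
  obtain o' where o': "\<gamma> \<in> borel_measurable borel" "o' \<in> borel_measurable borel" "\<And>t. 0 \<le> o' t"
    "AE t in lborel. t \<in> ?I \<longrightarrow> f t = o' t"
    "AE t in lborel. t \<in> ?I \<longrightarrow> ennreal (o' t) \<le> ennreal C * potential a b \<gamma> t"
    using f unfolding controlled_def by blast
  have "(\<lambda>t. indicator ?I t *\<^sub>R f t) \<in> borel_measurable lebesgue"
  proof (rule borel_measurable_lebesgue_AE)
    show "(\<lambda>t. indicator ?I t *\<^sub>R o' t) \<in> borel_measurable lborel" using o'(2) by simp
    show "AE t in lborel. indicator ?I t *\<^sub>R f t = indicator ?I t *\<^sub>R o' t"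
      using o'(4) by eventually_elim (auto simp: indicator_def)
  qed
  then have [measurable]: "f \<in> borel_measurable (lebesgue_on ?I)"
    by (subst borel_measurable_restrict_space_iff[OF I])
  show ?thesis unfolding m
  proof (rule esssup_I)
    show "(\<lambda>t. ennreal (f t / (b - a) powr (1 / 2))) \<in> borel_measurable (lebesgue_on ?I)"
      by measurable
    have "AE t in lborel. t \<in> ?I \<longrightarrow> ennreal (f t / (b - a) powr (1 / 2)) \<le> ?R"
      using o'(4,5) by eventually_elim (use potential_mean_sup[OF o'(1) q C _ o'(3)] in auto)
    then show "AE t in lebesgue_on ?I. ennreal (f t / (b - a) powr (1 / 2)) \<le> ?R"
      by (simp add: AE_restrict_space_iff[OF I] AE_completion_iff)
  qed
qed

section \<open>Oscillation of weak solutions\<close>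

text \<open>
  From \<open>f \<le> 1 + f^q\<close> on a set of finite measure.
\<close>

lemma finite_integral_of_power:
  fixes f :: "'b::euclidean_space \<Rightarrow> real"
  assumes D: "D \<in> sets borel" "bounded D" and f: "\<And>z. 0 \<le> f z" and q: "1 \<le> q"
    and fm: "(\<lambda>z. indicator D z * f z) \<in> borel_measurable lebesgue"
    and fin: "(\<integral>\<^sup>+z\<in>D. ennreal (f z powr q) \<partial>lebesgue) < \<infinity>"
  shows "(\<integral>\<^sup>+z. ennreal (indicator D z * f z) \<partial>lborel) < \<infinity>"
proof -
  have Dm: "D \<in> sets lebesgue" using D by auto
  have pm: "(\<lambda>z. ennreal ((indicator D z * f z) powr q)) \<in> borel_measurable lebesgue"
    using fm by measurable
  have eD: "emeasure lebesgue D < \<infinity>" using emeasure_bounded_finite[OF D(2)] D(1) by simp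
  have "(\<integral>\<^sup>+z. ennreal (indicator D z * f z) \<partial>lborel) = (\<integral>\<^sup>+z. ennreal (indicator D z * f z) \<partial>lebesgue)"
    by (rule nn_integral_completion[symmetric])
  also have "\<dots> \<le> (\<integral>\<^sup>+z. indicator D z + ennreal ((indicator D z * f z) powr q) \<partial>lebesgue)"
  proof (rule nn_integral_mono)
    fix z
    show "ennreal (indicator D z * f z) \<le> indicator D z + ennreal ((indicator D z * f z) powr q)"
    proof (cases "z \<in> D")
      case True
      have "f z \<le> 1 + f z powr q"
      proof (cases "f z \<le> 1")
        case False
        then have "f z powr 1 \<le> f z powr q" using q by (intro powr_mono) auto
        then show ?thesis using False by simp
      qed (simp add: add_increasing2)
      then have "ennreal (f z) \<le> ennreal (1 + f z powr q)" by (rule ennreal_leI)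
      also have "\<dots> = 1 + ennreal (f z powr q)" by (subst ennreal_plus) auto
      finally have "ennreal (f z) \<le> 1 + ennreal (f z powr q)" .
      then show ?thesis using True by simp
    qed simp
  qed
  also have "\<dots> = emeasure lebesgue D + (\<integral>\<^sup>+z. ennreal ((indicator D z * f z) powr q) \<partial>lebesgue)"
    using Dm pm by (subst nn_integral_add) auto
  also have "(\<integral>\<^sup>+z. ennreal ((indicator D z * f z) powr q) \<partial>lebesgue) = (\<integral>\<^sup>+z\<in>D. ennreal (f z powr q) \<partial>lebesgue)"
    by (intro nn_integral_cong) (auto simp: indicator_def)
  finally show ?thesis using eD fin by (auto simp: less_top[symmetric] top_unique ennreal_add_eq_top)
qed

lemma cylinder_inside:
  fixes x0 :: "'a::euclidean_space"
  assumes comp: "compactly_in (pcyl x0 t0 r) (\<Omega> \<times> {0<..<T})" and r: "0 < r"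
  shows "compactly_in (ball x0 r) \<Omega>" "0 < t0 - r\<^sup>2" "t0 + r\<^sup>2 < T" "pcyl x0 t0 r \<subseteq> \<Omega> \<times> {0<..<T}"
    "compact (closure (pcyl x0 t0 r))" "closure (pcyl x0 t0 r) \<subseteq> \<Omega> \<times> {0<..<T}"
proof -
  have r2: "0 < r\<^sup>2" using r by simp
  have cl: "closure (pcyl x0 t0 r) = cball x0 r \<times> {t0 - r\<^sup>2 .. t0 + r\<^sup>2}"
    unfolding pcyl_def tint_def closure_Times using r r2 by simp
  show c: "compact (closure (pcyl x0 t0 r))" "closure (pcyl x0 t0 r) \<subseteq> \<Omega> \<times> {0<..<T}"
    using comp by (auto simp: compactly_in_def)
  then show "pcyl x0 t0 r \<subseteq> \<Omega> \<times> {0<..<T}" using closure_subset by blast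
  have "(x0, t0 - r\<^sup>2) \<in> closure (pcyl x0 t0 r)" "(x0, t0 + r\<^sup>2) \<in> closure (pcyl x0 t0 r)"
    unfolding cl using r r2 by auto
  then show "0 < t0 - r\<^sup>2" "t0 + r\<^sup>2 < T" using c(2) by auto
  have "cball x0 r \<subseteq> \<Omega>"
  proof
    fix x assume "x \<in> cball x0 r"
    then have "(x, t0) \<in> closure (pcyl x0 t0 r)" unfolding cl using r2 by auto
    then show "x \<in> \<Omega>" using c(2) by auto
  qed
  then show "compactly_in (ball x0 r) \<Omega>" using r by (simp add: compactly_in_def)
qed

text \<open>
  The bridge from the given data, which are defined up to null sets and only locally, to integrable Borel
  functions on the whole space.
\<close>

lemma cutoff_representatives:
  fixes f :: "'b::euclidean_space \<Rightarrow> nat \<Rightarrow> 'c::euclidean_space"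
  assumes S: "S \<in> sets lebesgue" and D: "D \<in> sets borel" "bounded D" "D \<subseteq> S" and q: "1 \<le> q"
    and f: "vmeasurable_on N S f" and fq: "(\<integral>\<^sup>+z\<in>D. ennreal (vnorm N (f z) powr q) \<partial>lebesgue) < \<infinity>"
  obtains g where "\<And>i. i < N \<Longrightarrow> integrable lborel (g i)" "AE z in lborel. \<forall>i<N. indicator D z *\<^sub>R f z i = g i z"
    "AE z in lborel. indicator D z * vnorm N (f z) = vnorm N (\<lambda>i. g i z)"
proof -
  have S': "S \<inter> space lebesgue \<in> sets lebesgue" and DL: "D \<in> sets lebesgue" using S D by auto
  have m: "(\<lambda>z. indicator D z *\<^sub>R f z i) \<in> borel_measurable lebesgue" if "i < N" for i
  proof -
    have "(\<lambda>z. indicator S z *\<^sub>R f z i) \<in> borel_measurable lebesgue"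
      using f that borel_measurable_restrict_space_iff[OF S', of "\<lambda>z. f z i"] by (auto simp: vmeasurable_on_def)
    from borel_measurable_scaleR[OF borel_measurable_indicator[OF DL] this]
    have "(\<lambda>z. indicator D z *\<^sub>R (indicator S z *\<^sub>R f z i)) \<in> borel_measurable lebesgue" .
    moreover have "indicator D z *\<^sub>R (indicator S z *\<^sub>R f z i) = indicator D z *\<^sub>R f z i" for z
      using D(3) by (auto simp: indicator_def)
    ultimately show ?thesis by (simp only:)
  qed
  have "(\<lambda>z. vnorm N (\<lambda>i. indicator D z *\<^sub>R f z i)) \<in> borel_measurable lebesgue"
    by (rule vnorm_measurable) (rule m)
  then have vm: "(\<lambda>z. indicator D z * vnorm N (f z)) \<in> borel_measurable lebesgue" unfolding vnorm_scaleR by simp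
  have fin: "(\<integral>\<^sup>+z. ennreal (indicator D z * vnorm N (f z)) \<partial>lborel) < \<infinity>"
    by (rule finite_integral_of_power[OF D(1,2) vnorm_nonneg q vm fq])
  have "\<exists>g. integrable lborel g \<and> (AE z in lborel. indicator D z *\<^sub>R f z i = g z)" if "i < N" for i
  proof (rule integrable_representative[OF m[OF that]])
    have "norm (indicator D z *\<^sub>R f z i) \<le> indicator D z * vnorm N (f z)" for z
      using norm_comp_le_vnorm[OF that, of "f z"] by (auto simp: indicator_def)
    then have "(\<integral>\<^sup>+z. ennreal (norm (indicator D z *\<^sub>R f z i)) \<partial>lborel) \<le> (\<integral>\<^sup>+z. ennreal (indicator D z * vnorm N (f z)) \<partial>lborel)"
      by (intro nn_integral_mono ennreal_leI)
    then show "(\<integral>\<^sup>+z. ennreal (norm (indicator D z *\<^sub>R f z i)) \<partial>lborel) < \<infinity>"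
      using fin by (rule le_less_trans)
  qed
  then obtain g where g: "\<And>i. i < N \<Longrightarrow> integrable lborel (g i)"
    "\<And>i. i < N \<Longrightarrow> AE z in lborel. indicator D z *\<^sub>R f z i = g i z" by metis
  have all: "AE z in lborel. \<forall>i<N. indicator D z *\<^sub>R f z i = g i z"
    using g(2) by (auto simp: AE_all_countable)
  have "AE z in lborel. indicator D z * vnorm N (f z) = vnorm N (\<lambda>i. g i z)"
    using all
  proof eventually_elim
    case (elim z)
    have "indicator D z * vnorm N (f z) = vnorm N (\<lambda>i. indicator D z *\<^sub>R f z i)" unfolding vnorm_scaleR by simp
    also have "\<dots> = vnorm N (\<lambda>i. g i z)" by (rule vnorm_cong) (use elim in auto)
    finally show ?case .
  qed
  with g(1) all show ?thesis by (rule that)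
qed

lemma vnorm_integrable:
  assumes "\<And>i. i < N \<Longrightarrow> integrable M (g i)"
  shows "integrable M (\<lambda>z. vnorm N (\<lambda>i. g i z))"
proof (rule Bochner_Integration.integrable_bound)
  show "integrable M (\<lambda>z. \<Sum>i<N. norm (g i z))" using assms by auto
  show "(\<lambda>z. vnorm N (\<lambda>i. g i z)) \<in> borel_measurable M"
    by (rule vnorm_measurable) (use assms in auto)
  show "AE z in M. norm (vnorm N (\<lambda>i. g i z)) \<le> norm (\<Sum>i<N. norm (g i z))"
    unfolding vnorm_L2 by (simp add: L2_set_le_sum sum_nonneg)
qed

text \<open>
  All functions are multiplied by the indicator of \<open>2Q\<close> and replaced by Borel representatives; the
  flux is \<open>A(z, Du) - F\<close> and the majorant is \<open>h = |Du| + |F|\<close> on \<open>2Q\<close>. The growth condition gives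
  \<open>|A(z, Du) - F| \<le> L |Du| + |F| \<le> (L + 1) h\<close>. The maximal function does not see the change of
  representative.
\<close>

lemma solution_parabolic_data:
  fixes \<Omega> :: "'a::euclidean_space set"
  assumes setting: "solution_setting q L N \<Omega> T \<nu> A F u Du" and q: "1 < q" and L: "0 < L" and \<rho>: "0 < \<rho>"
    and comp: "compactly_in (pcyl x0 t0 (2 * \<rho>)) (\<Omega> \<times> {0<..<T})"
  obtains v G H h where "parabolic_data N v G H h (L + 1) x0 t0 \<rho>"
    "AE z in lborel. z \<in> pcyl x0 t0 (2 * \<rho>) \<longrightarrow> (\<forall>i<N. u z i = v i z)"
    "strong_maximal h = data_maximal N (pcyl x0 t0 (2 * \<rho>)) Du F"
proof -
  define D where "D = pcyl x0 t0 (2 * \<rho>)"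
  let ?U = "ball x0 (2 * \<rho>)" and ?J = "tint t0 (2 * \<rho>)" and ?S = "\<Omega> \<times> {0<..<T}"
  let ?n = "\<lambda>f z. ennreal (vnorm N (f z) powr q)"
  have DUJ: "D = ?U \<times> ?J" by (simp add: D_def pcyl_def)
  have r2: "0 < 2 * \<rho>" and q1: "1 \<le> q" using \<rho> q by auto
  note inside = cylinder_inside[OF comp r2]
  have DS: "D \<subseteq> ?S" using inside(4) by (simp add: D_def)
  have "open \<Omega>" and strc: "structure_conditions N \<nu> L ?S A"
    and Fm: "vmeasurable_on N ?S F" and FL: "Lq_loc N q ?S F"
    and ps: "parabolic_space N q \<Omega> T u Du" and sol: "weak_solution N ?S A F u Du"
    using setting by (auto simp: solution_setting_def)
  then have "open ?S" by (intro open_Times) auto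
  then have S: "?S \<in> sets lebesgue" "?S \<inter> space lebesgue \<in> sets lebesgue" by auto
  have "open D" unfolding DUJ tint_def by (intro open_Times) auto
  then have Db: "D \<in> sets borel" "bounded D"
    by (auto simp: DUJ tint_def intro!: bounded_Times)
  have um: "vmeasurable_on N ?S u" and Dm: "vmeasurable_on N ?S Du"
    and Dv: "\<And>z. z \<in> ?S \<Longrightarrow> Du z \<in> vecs N"
    using ps by (auto simp: parabolic_space_def)
  have slab: "(AE t in lebesgue_on ?J. W1q N q ?U (\<lambda>x. u (x, t)) (\<lambda>x. Du (x, t))) \<and>
        (\<integral>\<^sup>+z\<in>D. ennreal (vnorm N (u z) powr q + vnorm N (Du z) powr q) \<partial>lebesgue) < \<infinity>"
  proof -
    have "t0 - (2 * \<rho>)\<^sup>2 < t0 + (2 * \<rho>)\<^sup>2" using r2 by (simp add: zero_less_power2)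
    then show ?thesis
      using ps inside(1-3) unfolding parabolic_space_def DUJ tint_def by blast
  qed
  have "AE z in lebesgue_on ?S. \<forall>\<xi>\<in>vecs N.
      \<nu> * (vnorm N \<xi>)\<^sup>2 \<le> vinner N (A z \<xi>) \<xi> \<and> vnorm N (A z \<xi>) \<le> L * vnorm N \<xi>"
    using strc by (auto simp: structure_conditions_def)
  then have "AE z in lborel. z \<in> ?S \<longrightarrow> (\<forall>\<xi>\<in>vecs N.
      \<nu> * (vnorm N \<xi>)\<^sup>2 \<le> vinner N (A z \<xi>) \<xi> \<and> vnorm N (A z \<xi>) \<le> L * vnorm N \<xi>)"
    by (simp add: AE_restrict_space_iff[OF S(2)] AE_completion_iff)
  then have growth: "AE z in lborel. z \<in> D \<longrightarrow> vnorm N (A z (Du z)) \<le> L * vnorm N (Du z)"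
    by eventually_elim (use DS Dv in blast)
  have Am: "vmeasurable_on N ?S (\<lambda>z. A z (Du z))"
    unfolding vmeasurable_on_def
  proof (intro allI impI)
    fix i assume "i < N"
    then show "(\<lambda>z. A z (Du z) i) \<in> borel_measurable (lebesgue_on ?S)"
      by (subst borel_measurable_restrict_space_iff[OF S(2)], intro caratheodory_measurable[OF S(1) _ _ _ Dm Dv])
         (use strc in \<open>auto simp: structure_conditions_def\<close>)
  qed
  have le: "(\<integral>\<^sup>+z\<in>D. ?n u z \<partial>lebesgue) \<le> (\<integral>\<^sup>+z\<in>D. ennreal (vnorm N (u z) powr q + vnorm N (Du z) powr q) \<partial>lebesgue)"
    "(\<integral>\<^sup>+z\<in>D. ?n Du z \<partial>lebesgue) \<le> (\<integral>\<^sup>+z\<in>D. ennreal (vnorm N (u z) powr q + vnorm N (Du z) powr q) \<partial>lebesgue)"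
    by (intro nn_integral_mono mult_right_mono ennreal_leI; simp)+
  have uq: "(\<integral>\<^sup>+z\<in>D. ?n u z \<partial>lebesgue) < \<infinity>" and Dq: "(\<integral>\<^sup>+z\<in>D. ?n Du z \<partial>lebesgue) < \<infinity>"
    using le[THEN le_less_trans] slab by blast+
  have Fq: "(\<integral>\<^sup>+z\<in>D. ?n F z \<partial>lebesgue) < \<infinity>"
  proof -
    have "Lq_on N q (closure D) F" using FL inside(5,6) by (auto simp: Lq_loc_def D_def)
    then have "(\<integral>\<^sup>+z\<in>closure D. ?n F z \<partial>lebesgue) < \<infinity>" by (simp add: Lq_on_def)
    moreover have "(\<integral>\<^sup>+z\<in>D. ?n F z \<partial>lebesgue) \<le> (\<integral>\<^sup>+z\<in>closure D. ?n F z \<partial>lebesgue)"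
      using closure_subset[of D] by (intro nn_integral_mono mult_left_mono) (auto simp: indicator_def)
    ultimately show ?thesis using le_less_trans by blast
  qed
  obtain v where v: "\<And>i. i < N \<Longrightarrow> integrable lborel (v i)" "AE z in lborel. \<forall>i<N. indicator D z *\<^sub>R u z i = v i z"
    using cutoff_representatives[OF S(1) Db DS q1 um uq] by blast
  obtain G where G: "\<And>i. i < N \<Longrightarrow> integrable lborel (G i)" "AE z in lborel. \<forall>i<N. indicator D z *\<^sub>R Du z i = G i z"
    "AE z in lborel. indicator D z * vnorm N (Du z) = vnorm N (\<lambda>i. G i z)"
    using cutoff_representatives[OF S(1) Db DS q1 Dm Dq] by blast
  obtain R where R: "\<And>i. i < N \<Longrightarrow> integrable lborel (R i)" "AE z in lborel. \<forall>i<N. indicator D z *\<^sub>R F z i = R i z"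
    "AE z in lborel. indicator D z * vnorm N (F z) = vnorm N (\<lambda>i. R i z)"
    using cutoff_representatives[OF S(1) Db DS q1 Fm Fq] by blast
  have Aq: "(\<integral>\<^sup>+z\<in>D. ?n (\<lambda>z. A z (Du z)) z \<partial>lebesgue) < \<infinity>"
  proof -
    have [measurable]: "(\<lambda>z. vnorm N (\<lambda>i. G i z)) \<in> borel_measurable borel"
      using vnorm_integrable[OF G(1)] by (auto dest: borel_measurable_integrable)
    have Deq: "(\<integral>\<^sup>+z\<in>D. ?n Du z \<partial>lebesgue) = (\<integral>\<^sup>+z. ennreal (vnorm N (\<lambda>i. G i z) powr q) \<partial>lborel)"
      unfolding nn_integral_completion using G(3)
      by (intro nn_integral_cong_AE, eventually_elim) (auto simp: indicator_def split: if_splits)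
    have "(\<integral>\<^sup>+z\<in>D. ?n (\<lambda>z. A z (Du z)) z \<partial>lebesgue) \<le> (\<integral>\<^sup>+z. ennreal (L powr q) * ennreal (vnorm N (\<lambda>i. G i z) powr q) \<partial>lborel)"
      unfolding nn_integral_completion
    proof (rule nn_integral_mono_AE)
      show "AE z in lborel. ?n (\<lambda>z. A z (Du z)) z * indicator D z \<le> ennreal (L powr q) * ennreal (vnorm N (\<lambda>i. G i z) powr q)"
        using growth G(3)
      proof eventually_elim
        case (elim z)
        show ?case
        proof (cases "z \<in> D")
          case True
          then have "vnorm N (A z (Du z)) powr q \<le> (L * vnorm N (\<lambda>i. G i z)) powr q"
            using elim q by (intro powr_mono2) (auto simp: vnorm_nonneg)
          then show ?thesis using True L
            by (simp add: powr_mult vnorm_nonneg ennreal_mult'[symmetric] ennreal_leI)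
        qed simp
      qed
    qed
    also have "\<dots> = ennreal (L powr q) * (\<integral>\<^sup>+z. ennreal (vnorm N (\<lambda>i. G i z) powr q) \<partial>lborel)"
      by (rule nn_integral_cmult) measurable
    also have "\<dots> < \<infinity>" using Dq unfolding Deq by (simp add: ennreal_mult_less_top)
    finally show ?thesis .
  qed
  obtain P where P: "\<And>i. i < N \<Longrightarrow> integrable lborel (P i)" "AE z in lborel. \<forall>i<N. indicator D z *\<^sub>R A z (Du z) i = P i z"
    "AE z in lborel. indicator D z * vnorm N (A z (Du z)) = vnorm N (\<lambda>i. P i z)"
    using cutoff_representatives[OF S(1) Db DS q1 Am Aq] by blast
  have comp: "AE z in lborel. indicator D z *\<^sub>R f z i = g i z"
    if "AE z in lborel. \<forall>i<N. indicator D z *\<^sub>R f z i = g i z" "i < N"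
    for f :: "'a \<times> real \<Rightarrow> nat \<Rightarrow> 'c::euclidean_space" and g i
    using that(1) by eventually_elim (use that(2) in blast)
  define h where "h z = vnorm N (\<lambda>i. G i z) + vnorm N (\<lambda>i. R i z)" for z
  show ?thesis
  proof (rule that)
    show "parabolic_data N v G (\<lambda>i z. P i z - R i z) h (L + 1) x0 t0 \<rho>"
    proof
      show "integrable lborel (v i)" "integrable lborel (G i)" "integrable lborel (\<lambda>z. P i z - R i z)" if "i < N" for i
        using v G P R that by auto
      show "integrable lborel h" unfolding h_def[abs_def]
        by (intro Bochner_Integration.integrable_add vnorm_integrable G R)
      show "0 \<le> h z" for z by (simp add: h_def vnorm_nonneg)
      show "AE z in lborel. vnorm N (\<lambda>i. G i z) \<le> h z"
        by (simp add: h_def vnorm_nonneg)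
      show "AE z in lborel. vnorm N (\<lambda>i. P i z - R i z) \<le> (L + 1) * h z"
        using growth P(3) G(3)
      proof eventually_elim
        case (elim z)
        have "vnorm N (\<lambda>i. P i z - R i z) \<le> vnorm N (\<lambda>i. P i z) + vnorm N (\<lambda>i. R i z)" by (rule vnorm_diff_le)
        also have "vnorm N (\<lambda>i. P i z) \<le> L * vnorm N (\<lambda>i. G i z)"
          using elim unfolding elim(2,3)[symmetric] by (cases "z \<in> D") simp_all
        also have "L * vnorm N (\<lambda>i. G i z) + vnorm N (\<lambda>i. R i z) \<le> (L + 1) * vnorm N (\<lambda>i. G i z) + (L + 1) * vnorm N (\<lambda>i. R i z)"
          unfolding distrib_right using L mult_nonneg_nonneg[OF less_imp_le[OF L] vnorm_nonneg[of N "\<lambda>i. R i z"]]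
            vnorm_nonneg[of N "\<lambda>i. G i z"] by linarith
        finally show ?case by (simp add: h_def distrib_left)
      qed
      show "space_weak ?U (v i) (G i)" if "i < N" for i
      proof (rule space_weak_from_slices[where f="\<lambda>z. u z i" and g="\<lambda>z. Du z i" and J="?J"])
        show "AE z in lborel. indicator (?U \<times> ?J) z * u z i = v i z"
          "AE z in lborel. indicator (?U \<times> ?J) z *\<^sub>R Du z i = G i z"
          using comp[OF v(2) that] comp[OF G(2) that] by (simp_all add: DUJ)
        show "?J \<in> sets lebesgue" by (simp add: tint_def)
        show "AE t in lebesgue_on ?J. weak_gradient ?U (\<lambda>x. u (x, t) i) (\<lambda>x. Du (x, t) i)"
          using slab[THEN conjunct1] by eventually_elim (use that in \<open>auto simp: W1q_def\<close>)
      qed (use v G that in auto)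
      show "time_weak (?U \<times> ?J) (v i) (\<lambda>z. P i z - R i z)" if "i < N" for i
        unfolding DUJ[symmetric]
        by (rule time_weak_from_solution[OF sol that DS v(1)[OF that] _ P(1)[OF that] _ R(1)[OF that]])
           (use comp[OF v(2) that] comp[OF P(2) that] comp[OF R(2) that] in simp_all)
    qed (use L \<rho> in auto)
    show "AE z in lborel. z \<in> pcyl x0 t0 (2 * \<rho>) \<longrightarrow> (\<forall>i<N. u z i = v i z)"
      using v(2) unfolding D_def[symmetric] by eventually_elim auto
    show "strong_maximal h = data_maximal N (pcyl x0 t0 (2 * \<rho>)) Du F"
      unfolding data_maximal_def D_def[symmetric]
      by (rule strong_maximal_cong_AE) (use G(3) R(3) in eventually_elim, simp add: h_def distrib_left)
  qed
qed

text \<open>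
  The constant of \<open>oscillation_estimate\<close> with \<open>\<Lambda> = L + 1\<close>.
\<close>

definition osc_const :: "'a::euclidean_space itself \<Rightarrow> real \<Rightarrow> real" where
  "osc_const _ L = 10 * ((1 + 16 * (L + 1)) * 2 ^ (DIM('a) + 2) * unit_ball_vol DIM('a)) / kernel_mass TYPE('a)"

lemma osc_const_pos: "0 < L \<Longrightarrow> 0 < osc_const TYPE('a::euclidean_space) L"
  unfolding osc_const_def using kernel_mass_pos[where 'a='a] unit_ball_vol_pos[OF of_nat_0_le_iff, of "DIM('a)"]
  by (intro divide_pos_pos mult_pos_pos) auto

text \<open>
  The common core of the three parts: \<open>oscillation_estimate\<close> for the representative \<open>v\<close>, read back for
  \<open>u\<close> on the line \<open>{x} \<times> I\<close> for almost every \<open>x\<close>.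
\<close>

lemma solution_controlled:
  fixes \<Omega> :: "'a::euclidean_space set"
  assumes setting: "solution_setting q L N \<Omega> T \<nu> A F u Du" and q: "1 < q" and L: "0 < L" and \<rho>: "0 < \<rho>"
    and comp: "compactly_in (pcyl x0 t0 (2 * \<rho>)) (\<Omega> \<times> {0<..<T})"
  shows "AE x in lebesgue_on (ball x0 \<rho>). controlled (osc_const TYPE('a) L) (t0 - \<rho>\<^sup>2) (t0 + \<rho>\<^sup>2)
     (\<lambda>s. data_maximal N (pcyl x0 t0 (2 * \<rho>)) Du F (x, s)) (osc N (tint t0 \<rho>) u x)"
    (is "AE x in _. ?P x")
proof -
  define I where "I = tint t0 \<rho>"
  obtain v G H h where data: "parabolic_data N v G H h (L + 1) x0 t0 \<rho>"
    and uv: "AE z in lborel. z \<in> pcyl x0 t0 (2 * \<rho>) \<longrightarrow> (\<forall>i<N. u z i = v i z)"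
    and max: "strong_maximal h = data_maximal N (pcyl x0 t0 (2 * \<rho>)) Du F"
    using solution_parabolic_data[OF setting q L \<rho> comp] .
  interpret parabolic_data N v G H h "L + 1" x0 t0 \<rho> by (rule data)
  have c: "10 * step_const / kernel_mass TYPE('a) = osc_const TYPE('a) L" by (simp add: step_const_def osc_const_def)
  have \<rho>2: "\<rho>\<^sup>2 \<le> (2 * \<rho>)\<^sup>2" using \<rho> by (intro power_mono) auto
  have [measurable]: "I \<in> sets borel" by (simp add: I_def tint_def)
  have "AE x in lborel. x \<in> ball x0 \<rho> \<longrightarrow> ?P x"
    using oscillation_estimate AE_lborel_sections(1)[OF uv]
  proof eventually_elim
    case (elim x)
    show ?case
    proof
      assume x: "x \<in> ball x0 \<rho>"
      have int: "integrable lborel (\<lambda>t. v i (x, t))" if "i < N" for i using elim(1) x that by blast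
      have eq: "AE t in lborel. t \<in> I \<longrightarrow> (\<forall>i<N. u (x, t) i = v i (x, t))"
        using elim(2)
      proof eventually_elim
        case (elim t)
        have "(x, t) \<in> pcyl x0 t0 (2 * \<rho>)" if "t \<in> I"
          using x that \<rho> \<rho>2 by (auto simp: pcyl_def I_def tint_def)
        then show ?case using elim by blast
      qed
      have mean: "time_mean I u x i = vmean x i" if "i < N" for i
      proof -
        have [measurable]: "(\<lambda>t. v i (x, t)) \<in> borel_measurable borel"
          using int[OF that] by (auto dest: borel_measurable_integrable)
        have "(LINT t|lebesgue. indicator I t *\<^sub>R u (x, t) i) = (LINT t|lborel. indicator I t * v i (x, t))"
        proof (rule integral_lebesgue_eq_lborel)
          show "AE t in lborel. indicator I t *\<^sub>R u (x, t) i = indicator I t * v i (x, t)"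
            using eq by eventually_elim (use that in \<open>auto simp: indicator_def\<close>)
        qed measurable
        moreover have "measure lebesgue I = 2 * \<rho>\<^sup>2" unfolding I_def tint_def using \<rho> by simp
        ultimately show ?thesis
          unfolding time_mean_def vmean_def set_lebesgue_integral_def I_def by simp
      qed
      let ?o = "\<lambda>t. vnorm N (\<lambda>i. v i (x, t) - vmean x i)"
      show "?P x"
      proof (rule controlledI[where o'="?o"])
        show "?o \<in> borel_measurable borel"
          by (rule vnorm_measurable) (use int in \<open>auto dest!: borel_measurable_integrable\<close>)
        show "0 \<le> ?o t" for t by (rule vnorm_nonneg)
        show "AE t in lborel. t \<in> {t0 - \<rho>\<^sup>2<..<t0 + \<rho>\<^sup>2} \<longrightarrow> osc N (tint t0 \<rho>) u x t = ?o t"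
          using eq unfolding tint_eq[symmetric] I_def[symmetric]
          by eventually_elim (auto simp: osc_def mean intro!: vnorm_cong)
        show "AE t in lborel. t \<in> {t0 - \<rho>\<^sup>2<..<t0 + \<rho>\<^sup>2} \<longrightarrow> ennreal (?o t) \<le> ennreal (osc_const TYPE('a) L) *
            potential (t0 - \<rho>\<^sup>2) (t0 + \<rho>\<^sup>2) (\<lambda>s. data_maximal N (pcyl x0 t0 (2 * \<rho>)) Du F (x, s)) t"
          using elim(1) x unfolding c maximal_potential_eq max tint_eq[symmetric] by blast
        show "(\<lambda>s. data_maximal N (pcyl x0 t0 (2 * \<rho>)) Du F (x, s)) \<in> borel_measurable borel"
          using section_measurable[of x] unfolding max .
      qed
    qed
  qed
  then show ?thesis
    by (subst AE_restrict_space_iff) (simp, simp only: AE_completion_iff)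
qed

theorem theorem5p3:
  fixes q L :: real
  assumes "1 < q" and "0 < L"
  shows
    "(q < 2 \<longrightarrow> (\<forall>qs. q \<le> qs \<and> qs < 2 * q / (2 - q) \<longrightarrow>
       (\<exists>c>0. \<forall>N (\<Omega> :: (real ^ 'n) set) T \<nu> A F u Du x0 t0 \<rho>.
          solution_setting q L N \<Omega> T \<nu> A F u Du \<and> 0 < \<rho> \<and>
          compactly_in (pcyl x0 t0 (2 * \<rho>)) (\<Omega> \<times> {0<..<T}) \<longrightarrow>
          (let I = tint t0 \<rho>; g = data_maximal N (pcyl x0 t0 (2 * \<rho>)) Du F in
            AE x in lebesgue_on (ball x0 \<rho>).
              epowr (mean_on I (\<lambda>t. ennreal (osc N I u x t powr qs / measure lebesgue I powr (qs / 2)))) (1 / qs)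
              \<le> ennreal c * epowr (mean_on I (\<lambda>t. epowr (g (x, t)) q)) (1 / q)))))
     \<and>
     (q = 2 \<longrightarrow>
       (\<exists>c>0. \<forall>N (\<Omega> :: (real ^ 'n) set) T \<nu> A F u Du x0 t0 \<rho>.
          solution_setting q L N \<Omega> T \<nu> A F u Du \<and> 0 < \<rho> \<and>
          compactly_in (pcyl x0 t0 (2 * \<rho>)) (\<Omega> \<times> {0<..<T}) \<longrightarrow>
          (let I = tint t0 \<rho>; g = data_maximal N (pcyl x0 t0 (2 * \<rho>)) Du F in
            AE x in lebesgue_on (ball x0 \<rho>).
              mean_on I (\<lambda>t. ennreal (exp ((quot (osc N I u x t)
                (ennreal (c * measure lebesgue I powr (1 / 2))
                   * epowr (mean_on I (\<lambda>t. epowr (g (x, t)) 2)) (1 / 2)))\<^sup>2)))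
              \<le> ennreal c)))
     \<and>
     (2 < q \<longrightarrow>
       (\<exists>c>0. \<forall>N (\<Omega> :: (real ^ 'n) set) T \<nu> A F u Du x0 t0 \<rho>.
          solution_setting q L N \<Omega> T \<nu> A F u Du \<and> 0 < \<rho> \<and>
          compactly_in (pcyl x0 t0 (2 * \<rho>)) (\<Omega> \<times> {0<..<T}) \<longrightarrow>
          (let I = tint t0 \<rho>; g = data_maximal N (pcyl x0 t0 (2 * \<rho>)) Du F in
            AE x in lebesgue_on (ball x0 \<rho>).
              esssup (lebesgue_on I) (\<lambda>t. ennreal (osc N I u x t / measure lebesgue I powr (1 / 2)))
              \<le> ennreal c * epowr (mean_on I (\<lambda>t. epowr (g (x, t)) q)) (1 / q))))"
proof (intro conjI impI allI, goal_cases)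
  let ?C = "osc_const TYPE(real ^ 'n) L"
  have C: "0 < ?C" using assms(2) by (rule osc_const_pos)
  {
    case (1 qs)
    \<comment> \<open>the exponent of the kernel in Young's inequality from \<open>L^q\<close> to \<open>L^qs\<close>; it is below \<open>2\<close> precisely because \<open>qs < 2 q / (2 - q)\<close>\<close>
    define r where "r = 1 / (1 + 1 / qs - 1 / q)"
    have q: "1 < q" "q \<le> qs" "0 < qs" using assms 1 by auto
    have "qs * (2 - q) < 2 * q" using 1 by (simp add: less_divide_eq)
    then have "1 / q - 1 / 2 < 1 / qs" using q by (simp add: field_simps)
    then have "1 / 2 < 1 + 1 / qs - 1 / q" by simp
    then have r: "1 / r = 1 + 1 / qs - 1 / q" "r < 2"
      by (simp_all add: r_def divide_less_eq)
    show ?case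
    proof (intro exI[of _ "?C * (2 / (1 - r / 2)) powr (1 / r)"] conjI allI impI, goal_cases)
      case 1
      show ?case using C r(2) by simp
    next
      case (2 N \<Omega> T \<nu> A F u Du x0 t0 \<rho>)
      then have "AE x in lebesgue_on (ball x0 \<rho>). controlled ?C (t0 - \<rho>\<^sup>2) (t0 + \<rho>\<^sup>2)
          (\<lambda>s. data_maximal N (pcyl x0 t0 (2 * \<rho>)) Du F (x, s)) (osc N (tint t0 \<rho>) u x)"
        by (intro solution_controlled[OF _ assms]) auto
      then show ?case
        unfolding Let_def
      proof eventually_elim
        case (elim x)
        show ?case unfolding tint_def
          by (rule controlled_power[OF elim[unfolded tint_def] _ C q(1,2) r]) (use 2 in simp)
      qed
    qed
  next
    case 2
    show ?case
    proof (intro exI[of _ "12 + 5 * ?C"] conjI allI impI, goal_cases)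
      case 1
      show ?case using C by simp
    next
      case (2 N \<Omega> T \<nu> A F u Du x0 t0 \<rho>)
      then have "AE x in lebesgue_on (ball x0 \<rho>). controlled ?C (t0 - \<rho>\<^sup>2) (t0 + \<rho>\<^sup>2)
          (\<lambda>s. data_maximal N (pcyl x0 t0 (2 * \<rho>)) Du F (x, s)) (osc N (tint t0 \<rho>) u x)"
        by (intro solution_controlled[OF _ assms]) auto
      then show ?case
        unfolding Let_def
      proof eventually_elim
        case (elim x)
        show ?case unfolding tint_def
          by (rule controlled_exp[OF elim[unfolded tint_def] _ C]) (use 2 in simp)
      qed
    qed
  next
    case 3
    \<comment> \<open>the exponent conjugate to \<open>q\<close>, which is below \<open>2\<close> because \<open>q\<close> is above \<open>2\<close>\<close>
    define r where "r = q / (q - 1)"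
    have "r < 2" using 3 by (simp add: r_def divide_less_eq)
    show ?case
    proof (intro exI[of _ "?C * (2 / (1 - r / 2)) powr (1 / r)"] conjI allI impI, goal_cases)
      case 1
      show ?case using C \<open>r < 2\<close> by simp
    next
      case (2 N \<Omega> T \<nu> A F u Du x0 t0 \<rho>)
      then have "AE x in lebesgue_on (ball x0 \<rho>). controlled ?C (t0 - \<rho>\<^sup>2) (t0 + \<rho>\<^sup>2)
          (\<lambda>s. data_maximal N (pcyl x0 t0 (2 * \<rho>)) Du F (x, s)) (osc N (tint t0 \<rho>) u x)"
        by (intro solution_controlled[OF _ assms]) auto
      then show ?case
        unfolding Let_def
      proof eventually_elim
        case (elim x)
        show ?case unfolding tint_def r_def
          by (rule controlled_sup[OF elim[unfolded tint_def] _ C 3]) (use 2 in simp)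
      qed
    qed
  }
qed

end
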